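(* Let $G$ and $H$ be simple directed graphs and let $c$ denote the number of connected components of $G$. Then for any integer $k\geq 1$, one has (i) $\operatorname{proj\,dim} I_{G\to H}^k\geq |V(H)|-1$; (ii) $\operatorname{proj\,dim} I_{G\to H}^{(k)}\geq |V(H)|-1$; (iii) $\operatorname{reg} I_{G\to H}^k\geq k|V(G)|+(|V(G)|-c)(\alpha(H)-1)$; (iv) $\operatorname{reg} I_{G\to H}^{(k)}\geq k|V(G)|+(|V(G)|-c)(\alpha(H)-1)$.
   Context: Directed graphs are finite with nonempty vertex sets $V(G)=[n]=\{1,\dots,n\}$ and $V(H)=[m]$, and simple: the underlying graph has no loops and no multiple edges. Connected components of $G$ are those of its underlying undirected graph. $\alpha(H)$ is the largest size of a set of vertices of $H$ with no edge between any two of them. A weak graph homomorphism from $G$ to $H$ is a map $\phi:V(G)\to V(H)$ such that for every $(x,y)\in E(G)$ either $\phi(x)=\phi(y)$ or $(\phi(x),\phi(y))\in E(H)$; the set of these is $\mathrm{WHom}(G,H)$. Let $K$ be a field, $S=K[x_{ij}: i\in[n], j\in[m]]$, $u_\phi=\prod_{i=1}^n x_{i\phi(i)}$ and $I_{G\to H}=(u_\phi:\phi\in\mathrm{WHom}(G,H))\subseteq S$, a squarefree monomial ideal. For a graded $S$-module $M$ with graded Betti numbers $\beta_{i,j}(M)$, $\operatorname{reg} M=\max\{j-i:\beta_{i,j}(M)\ne0\}$ and $\operatorname{proj\,dim}M=\max\{i:\beta_{i,j}(M)\neq 0\text{ for some }j\}$. For a squarefree monomial ideal $I$ with irredundant primary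 decomposition $I=\mathfrak p_1\cap\cdots\cap\mathfrak p_r$ (each $\mathfrak p_i$ generated by variables), $I^{(k)}=\mathfrak p_1^k\cap\cdots\cap\mathfrak p_r^k$. *)

theory Defs
  imports
    "Graph_Theory.Graph_Theory"
    "Jordan_Normal_Form.Matrix_Kernel"
    "HOL-Library.Poly_Mapping"
    "HOL-Library.Extended_Real"
begin

section \<open>Directed graphs\<close>

text \<open>Together with looplessness, antisymmetry says that the underlying undirected
  graph has no multiple edges; parallel arcs are excluded by the type.\<close>

definition simple_digraph :: "'a pair_pre_digraph \<Rightarrow> bool" where
  "simple_digraph G \<longleftrightarrow> pair_digraph G \<and> pverts G \<noteq> {} \<and> antisym (parcs G)"

text \<open>The strongly connected components of the symmetrized digraph are the connected
  components of the underlying undirected graph.\<close>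

definition num_components :: "'a pair_pre_digraph \<Rightarrow> nat" where
  "num_components G = card (pre_digraph.sccs_verts (with_proj (mk_symmetric (with_proj G))))"

definition independent_vertices :: "'a pair_pre_digraph \<Rightarrow> 'a set \<Rightarrow> bool" where
  "independent_vertices H A \<longleftrightarrow> A \<subseteq> pverts H \<and> (\<forall>x\<in>A. \<forall>y\<in>A. (x, y) \<notin> parcs H)"

definition independence_number :: "'a pair_pre_digraph \<Rightarrow> nat" where
  "independence_number H = Max {card A | A. independent_vertices H A}"

definition WHom :: "'v pair_pre_digraph \<Rightarrow> 'w pair_pre_digraph \<Rightarrow> ('v \<Rightarrow> 'w) set" where
  "WHom G H = {\<phi>. \<phi> \<in> pverts G \<rightarrow>\<^sub>E pverts H \<and>
     (\<forall>(x, y) \<in> parcs G. \<phi> x = \<phi> y \<or> (\<phi> x, \<phi> y) \<in> parcs H)}"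

section \<open>Polynomial rings and ideals\<close>

text \<open>\<open>('x, 'k) polynomials\<close> is the polynomial ring over \<open>'k\<close> whose variables are indexed
  by the elements of \<open>'x\<close>: finitely supported functions from exponent vectors to
  coefficients, with the convolution product.\<close>

type_synonym ('x, 'k) polynomials = "('x \<Rightarrow>\<^sub>0 nat) \<Rightarrow>\<^sub>0 'k"

definition Var :: "'x \<Rightarrow> ('x, 'k::field) polynomials" where
  "Var x = Poly_Mapping.single (Poly_Mapping.single x 1) 1"

definition monom_degree :: "('x::finite \<Rightarrow>\<^sub>0 nat) \<Rightarrow> nat" where
  "monom_degree m = (\<Sum>x\<in>UNIV. Poly_Mapping.lookup m x)"

text \<open>The zero polynomial is homogeneous of every degree.\<close>

definition homogeneous :: "int \<Rightarrow> ('x::finite, 'k::field) polynomials \<Rightarrow> bool" where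
  "homogeneous d p \<longleftrightarrow> (\<forall>m \<in> Poly_Mapping.keys p. int (monom_degree m) = d)"

definition ideal_of :: "'r::comm_ring_1 set \<Rightarrow> 'r set" where
  "ideal_of B = Modules.module.span (*) B"

definition ideal_power :: "'r::comm_ring_1 set \<Rightarrow> nat \<Rightarrow> 'r set" where
  "ideal_power I k = ideal_of {\<Prod>i<k. f i | f. \<forall>i<k. f i \<in> I}"

text \<open>A finite set of primes generated by variables is represented by the set \<open>P\<close> of the
  generating sets of variables.\<close>

definition irredundant_primary_decomposition ::
  "('x::finite, 'k::field) polynomials set \<Rightarrow> 'x set set \<Rightarrow> bool" where
  "irredundant_primary_decomposition I P \<longleftrightarrow>
     I = (\<Inter>A\<in>P. ideal_of (Var ` A)) \<and>
     (\<forall>Q. Q \<subset> P \<longrightarrow> I \<noteq> (\<Inter>A\<in>Q. ideal_of (Var ` A)))"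

text \<open>For a squarefree monomial ideal \<open>I\<close> the decomposition exists and is unique.\<close>

definition symbolic_power ::
  "('x::finite, 'k::field) polynomials set \<Rightarrow> nat \<Rightarrow> ('x, 'k) polynomials set" where
  "symbolic_power I k =
     (\<Inter>A \<in> (THE P. irredundant_primary_decomposition I P). ideal_power (ideal_of (Var ` A)) k)"

section \<open>Minimal graded free resolutions and Betti numbers\<close>

text \<open>
  A graded free resolution of a homogeneous ideal \<open>I\<close> of \<open>S\<close>,
  \<open>\<dots> \<rightarrow> F\<^sub>2 \<rightarrow> F\<^sub>1 \<rightarrow> F\<^sub>0 \<rightarrow> I \<rightarrow> 0\<close>,
  is given by coordinates: \<open>F\<^sub>i\<close> is the direct sum of the \<open>S(-d)\<close> with \<open>d\<close> running through the
  list \<open>sh i\<close>, the augmentation sends the basis of \<open>F\<^sub>0\<close> to the entries of \<open>g\<close>, and \<open>D i\<close> is the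
  matrix of \<open>F\<^sub>i\<^sub>+\<^sub>1 \<rightarrow> F\<^sub>i\<close>. The conditions on the degrees of the entries say that all maps are
  homogeneous of degree 0. Ranks may be 0, so finite resolutions are included.
\<close>

definition graded_free_resolution ::
  "('x::finite, 'k::field) polynomials set \<Rightarrow> ('x, 'k) polynomials vec \<Rightarrow>
   (nat \<Rightarrow> int list) \<Rightarrow> (nat \<Rightarrow> ('x, 'k) polynomials mat) \<Rightarrow> bool" where
  "graded_free_resolution I g sh D \<longleftrightarrow>
     g \<in> carrier_vec (length (sh 0)) \<and>
     (\<forall>i. D i \<in> carrier_mat (length (sh i)) (length (sh (Suc i)))) \<and>
     (\<forall>s < length (sh 0). homogeneous (sh 0 ! s) (g $ s)) \<and>
     (\<forall>i. \<forall>s < length (sh i). \<forall>t < length (sh (Suc i)).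
        homogeneous (sh (Suc i) ! t - sh i ! s) (D i $$ (s, t))) \<and>
     {g \<bullet> v | v. v \<in> carrier_vec (length (sh 0))} = I \<and>
     {v \<in> carrier_vec (length (sh 0)). g \<bullet> v = 0} =
       {D 0 *\<^sub>v w | w. w \<in> carrier_vec (length (sh 1))} \<and>
     (\<forall>i. mat_kernel (D i) = {D (Suc i) *\<^sub>v w | w. w \<in> carrier_vec (length (sh (Suc (Suc i))))})"

text \<open>Minimality: \<open>F\<^sub>i\<^sub>+\<^sub>1\<close> is mapped into \<open>\<mm> F\<^sub>i\<close>, where \<open>\<mm>\<close> is generated by the variables, i.e.
  no matrix entry has a constant term.\<close>

definition minimal_graded_free_resolution ::
  "('x::finite, 'k::field) polynomials set \<Rightarrow> ('x, 'k) polynomials vec \<Rightarrow>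
   (nat \<Rightarrow> int list) \<Rightarrow> (nat \<Rightarrow> ('x, 'k) polynomials mat) \<Rightarrow> bool" where
  "minimal_graded_free_resolution I g sh D \<longleftrightarrow>
     graded_free_resolution I g sh D \<and>
     (\<forall>i. \<forall>s < length (sh i). \<forall>t < length (sh (Suc i)). D i $$ (s, t) \<in> ideal_of (range Var))"

text \<open>\<open>betti I i j\<close> is the number of summands \<open>S(-j)\<close> in step \<open>i\<close> of the minimal graded free
  resolution of the ideal \<open>I\<close> (not of \<open>S/I\<close>), which exists for homogeneous \<open>I\<close> and is unique
  up to isomorphism.\<close>

definition betti :: "('x::finite, 'k::field) polynomials set \<Rightarrow> nat \<Rightarrow> int \<Rightarrow> nat" where
  "betti I i j = count_list ((SOME sh. \<exists>g D. minimal_graded_free_resolution I g sh D) i) j"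

text \<open>By Hilbert's syzygy theorem only finitely many Betti numbers are nonzero, so for
  \<open>I \<noteq> 0\<close> the suprema are maxima.\<close>

definition proj_dim :: "('x::finite, 'k::field) polynomials set \<Rightarrow> ereal" where
  "proj_dim I = Sup {ereal (real i) | i. \<exists>j. betti I i j \<noteq> 0}"

definition regularity :: "('x::finite, 'k::field) polynomials set \<Rightarrow> ereal" where
  "regularity I = Sup {ereal (of_int (j - int i)) | i j. betti I i j \<noteq> 0}"

section \<open>The ideal of weak homomorphisms\<close>

text \<open>All variables \<open>x\<^sub>i\<^sub>j\<close> with \<open>i :: 'v\<close>, \<open>j :: 'w\<close> belong to the ring, so this is the ideal of
  the mathematical text when the vertex sets exhaust the types \<open>'v\<close> and \<open>'w\<close>.\<close>

definition hom_ideal ::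
  "'v::finite pair_pre_digraph \<Rightarrow> 'w::finite pair_pre_digraph \<Rightarrow> ('v \<times> 'w, 'k::field) polynomials set" where
  "hom_ideal G H = ideal_of {\<Prod>i\<in>pverts G. Var (i, \<phi> i) | \<phi>. \<phi> \<in> WHom G H}"

end

theory Submission
  imports Defs
begin

text \<open>
  Let \<open>J\<close> be a monomial ideal between \<open>I\<^sup>k\<close> and the intersection of the \<open>k\<close>-th powers of all primes
  \<open>\<pp> \<supseteq> I\<close> generated by variables; both \<open>I\<^sup>k\<close> and \<open>I\<^sup>(\<^sup>k\<^sup>)\<close> are such ideals. By dimension shifting along any
  graded free resolution of \<open>J\<close>, a nonzero class of internal degree \<open>d\<close> in the \<open>i\<close>-th homology of the
  Koszul complex of \<open>J\<close> with respect to all variables forces a summand \<open>S(-d)\<close> in step \<open>i\<close>; a class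
  in the Koszul complex with respect to some of the variables still forces step \<open>i\<close> to be nonzero.

  For the projective dimension fix \<open>i\<^sub>0\<close>. The variables \<open>x\<^bsub>i\<^sub>0j\<^esub>\<close> generate a prime containing \<open>I\<close>, and
  the monomial \<open>x\<^bsub>i\<^sub>0j\<^sub>0\<^esub>\<^sup>k\<^sup>-\<^sup>1 \<Prod>\<^bsub>i\<noteq>i\<^sub>0\<^esub> \<Prod>\<^sub>j x\<^bsub>ij\<^esub>\<^sup>k\<close> is not in \<open>J\<close> but is multiplied into \<open>J\<close> by each of them.

  For the regularity let \<open>A\<close> be a maximum independent set of \<open>H\<close> containing \<open>j\<^sub>0\<close>. Weak
  homomorphisms with values in \<open>A\<close> are constant on the components of \<open>G\<close>. Hence in the multidegree
  with exponents \<open>k\<close> at \<open>x\<^bsub>ij\<^sub>0\<^esub>\<close> and \<open>1\<close> at the other \<open>x\<^bsub>ij\<^esub>\<close>, \<open>j \<in> A\<close>, the Koszul complex of \<open>J\<close> is that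
  of the simplicial complex of all sets which, for every component of \<open>G\<close>, are disjoint from a fibre
  over some \<open>j \<in> A\<close>. Contracting components to single vertices maps it onto a join of
  \<open>c\<close> boundaries of simplices on \<open>\<alpha>(H)\<close> vertices, a sphere whose fundamental cycle lifts.
\<close>

section \<open>Monomials and polynomials\<close>

abbreviation "lookup \<equiv> Poly_Mapping.lookup"
abbreviation "keys \<equiv> Poly_Mapping.keys"
abbreviation "single \<equiv> Poly_Mapping.single"

lemma lookup_single_mult:
  fixes p :: "('a::cancel_comm_monoid_add) \<Rightarrow>\<^sub>0 ('k::comm_semiring_1)"
  shows "lookup (single m c * p) (m + n) = c * lookup p n"
proof -
  have *: "lookup (single m c) l * (\<Sum>q. lookup p q when m + n = l + q) =
      (c * lookup p n when l = m)" for l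
  proof (cases "l = m")
    case True
    then show ?thesis by simp
  next
    case False
    then show ?thesis by (simp add: lookup_single when_def)
  qed
  show ?thesis
    unfolding lookup_mult * by simp
qed

lemma keys_single_mult:
  fixes p :: "('a::cancel_comm_monoid_add) \<Rightarrow>\<^sub>0 ('k::field)"
  assumes "n \<in> keys (single m c * p)"
  obtains n' where "n = m + n'" "n' \<in> keys p"
  using keys_mult[of "single m c" p] assms by (auto split: if_splits)

lemma sum_single_lookup: "(\<Sum>m\<in>keys p. single m (lookup p m)) = p"
  by (rule poly_mapping_eqI)
    (auto simp: lookup_sum lookup_single when_def in_keys_iff)

lemma lookup_mult_keys:
  fixes p q :: "('a::cancel_comm_monoid_add) \<Rightarrow>\<^sub>0 ('k::comm_semiring_1)"
  shows "q * p = (\<Sum>m\<in>keys q. single m (lookup q m) * p)"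
  by (subst (1) sum_single_lookup[of q, symmetric]) (rule sum_distrib_right)

text \<open>The variable type is finite, so every function has finite support and
  \<open>Abs_poly_mapping\<close> loses nothing.\<close>

definition exponents :: "('x::finite \<Rightarrow> nat) \<Rightarrow> 'x \<Rightarrow>\<^sub>0 nat" where
  "exponents f = Abs_poly_mapping f"

lemma lookup_exponents [simp]: "lookup (exponents f) = f"
  by (simp add: exponents_def)

lemma monom_degree_add: "monom_degree (m + n) = monom_degree m + monom_degree n"
  by (simp add: monom_degree_def lookup_add sum.distrib)

lemma monom_degree_single [simp]: "monom_degree (single x n) = n"
  by (simp add: monom_degree_def lookup_single when_def)

lemma monom_degree_zero [simp]: "monom_degree 0 = 0"
  by (simp add: monom_degree_def)

lemma monom_degree_eq_0_iff: "monom_degree m = 0 \<longleftrightarrow> m = 0"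
proof
  assume "monom_degree m = 0"
  then show "m = 0" by (intro poly_mapping_eqI) (simp add: monom_degree_def)
qed simp

lemma exponent_split:
  fixes n :: "'x \<Rightarrow>\<^sub>0 nat"
  assumes "\<And>x. lookup m x \<le> lookup n x"
  shows "n = m + (n - m)"
proof (rule poly_mapping_eqI)
  fix x show "lookup n x = lookup (m + (n - m)) x"
    using assms[of x] by (simp add: lookup_add lookup_minus)
qed

lemma lookup_Var_mult:
  "lookup (Var x * p) n = (if lookup n x = 0 then 0 else lookup p (n - single x 1))"
proof (cases "lookup n x = 0")
  case True
  have "n \<notin> keys (Var x * p)"
  proof
    assume "n \<in> keys (Var x * p)"
    then obtain n' where "n = single x 1 + n'"
      unfolding Var_def by (rule keys_single_mult)
    with True show False by (simp add: lookup_add)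
  qed
  with True show ?thesis by (simp add: in_keys_iff)
next
  case False
  then have "single x 1 + (n - single x 1) = n"
    by (intro exponent_split[symmetric]) (auto simp: lookup_single when_def)
  with False show ?thesis
    using lookup_single_mult[of "single x 1" 1 p "n - single x 1"] by (simp add: Var_def)
qed

lemma lookup_Var_mult_add:
  "lookup (Var x * p) (single x 1 + n) = lookup p n"
  by (simp add: Var_def lookup_single_mult)

section \<open>Truncation to a set of monomials and homogeneous components\<close>

definition mfilter :: "('a \<Rightarrow> bool) \<Rightarrow> ('a \<Rightarrow>\<^sub>0 'b::zero) \<Rightarrow> 'a \<Rightarrow>\<^sub>0 'b" where
  "mfilter P p = Abs_poly_mapping (\<lambda>m. if P m then lookup p m else 0)"

lemma lookup_mfilter [simp]: "lookup (mfilter P p) m = (if P m then lookup p m else 0)"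
proof -
  have "finite {m. (if P m then lookup p m else 0) \<noteq> 0}"
    by (rule finite_subset[OF _ finite_keys[of p]]) (auto simp: in_keys_iff split: if_splits)
  then show ?thesis by (simp add: mfilter_def)
qed

lemma keys_mfilter: "keys (mfilter P p) = {m \<in> keys p. P m}"
  by (auto simp: in_keys_iff split: if_splits)

lemma mfilter_sum: "mfilter P (\<Sum>i\<in>A. f i) = (\<Sum>i\<in>A. mfilter P (f i))"
  by (rule poly_mapping_eqI) (simp add: lookup_sum)

abbreviation hcomp :: "int \<Rightarrow> ('x::finite, 'k::field) polynomials \<Rightarrow> ('x, 'k) polynomials" where
  "hcomp d \<equiv> mfilter (\<lambda>m. int (monom_degree m) = d)"

lemma homogeneous_hcomp [simp]: "homogeneous d (hcomp d p)"
  by (simp add: homogeneous_def keys_mfilter)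

lemma hcomp_id: "homogeneous d p \<Longrightarrow> hcomp d p = p"
  by (rule poly_mapping_eqI) (auto simp: homogeneous_def in_keys_iff)

lemma mfilter_0 [simp]: "mfilter P 0 = 0"
  by (rule poly_mapping_eqI) simp

lemma homogeneous_0 [simp]: "homogeneous d 0"
  by (simp add: homogeneous_def)

lemma homogeneous_uminus: "homogeneous d p \<Longrightarrow> homogeneous d (- p)"
  by (simp add: homogeneous_def in_keys_iff)

lemma homogeneous_add: "homogeneous d p \<Longrightarrow> homogeneous d q \<Longrightarrow> homogeneous d (p + q)"
  using keys_add[of p q] by (auto simp: homogeneous_def)

lemma homogeneous_sum: "(\<And>i. i \<in> A \<Longrightarrow> homogeneous d (f i)) \<Longrightarrow> homogeneous d (sum f A)"
  by (induction A rule: infinite_finite_induct) (auto intro: homogeneous_add)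

lemma homogeneous_mult:
  assumes "homogeneous d p" "homogeneous e q" shows "homogeneous (d + e) (p * q)"
  using keys_mult[of p q] assms
  by (fastforce simp: homogeneous_def monom_degree_add)

lemma homogeneous_single: "homogeneous (int (monom_degree m)) (single m c)"
  by (simp add: homogeneous_def)

lemma homogeneous_Var: "homogeneous 1 (Var x)"
  by (simp add: homogeneous_def Var_def)

lemma hcomp_mult_single:
  "hcomp d (single m c * p) = single m c * hcomp (d - int (monom_degree m)) p"
proof (rule poly_mapping_eqI)
  fix n
  show "lookup (hcomp d (single m c * p)) n =
      lookup (single m c * hcomp (d - int (monom_degree m)) p) n"
  proof (cases "\<exists>n'. n = m + n'")
    case True
    then show ?thesis by (auto simp: lookup_single_mult monom_degree_add)
  next
    case False
    then have "n \<notin> keys (single m c * q)" for q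
      by (meson keys_single_mult)
    then show ?thesis by (simp add: in_keys_iff)
  qed
qed

text \<open>Writing \<open>q\<close> as a sum of terms reduces this to a single term, which merely
  shifts degrees.\<close>

lemma hcomp_mult:
  assumes "homogeneous e q"
  shows "hcomp d (q * p) = q * hcomp (d - e) p"
proof -
  have "hcomp d (q * p) =
      (\<Sum>m\<in>keys q. hcomp d (single m (lookup q m) * p))"
    by (subst lookup_mult_keys) (rule mfilter_sum)
  also have "\<dots> = (\<Sum>m\<in>keys q. single m (lookup q m) * hcomp (d - e) p)"
    by (rule sum.cong) (use assms in \<open>auto simp: hcomp_mult_single homogeneous_def\<close>)
  also have "\<dots> = q * hcomp (d - e) p"
    by (rule lookup_mult_keys[symmetric])
  finally show ?thesis .
qed

section \<open>Division by a variable\<close>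

definition div_var :: "'x \<Rightarrow> ('x, 'k::field) polynomials \<Rightarrow> ('x, 'k) polynomials" where
  "div_var x p = Abs_poly_mapping (\<lambda>m. lookup p (single x 1 + m))"

lemma lookup_div_var: "lookup (div_var x p) m = lookup p (single x 1 + m)"
proof -
  have "finite ((\<lambda>m. single x 1 + m) -` keys p)"
    by (rule finite_vimageI) (auto simp: inj_on_def)
  then have "finite {m. lookup p (single x 1 + m) \<noteq> 0}"
    by (simp add: vimage_def in_keys_iff)
  then show ?thesis by (simp add: div_var_def)
qed

lemma div_var_Var_mult: "div_var x (Var x * p) = p"
  by (rule poly_mapping_eqI) (simp only: lookup_div_var lookup_Var_mult_add)

text \<open>Division by \<open>x\<close> touches only the exponent of \<open>x\<close>; hence the
  homotopy below anticommutes with the parts of the differential that belong to other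
  variables.\<close>

lemma div_var_Var_mult_neq:
  assumes "x \<noteq> y" shows "div_var x (Var y * p) = Var y * div_var x p"
proof (rule poly_mapping_eqI)
  fix n :: "'a \<Rightarrow>\<^sub>0 nat"
  have "single x 1 + n - single y 1 =
      single x 1 + (n - single y 1)" if "lookup n y \<noteq> 0"
    by (rule poly_mapping_eqI) (use assms that in \<open>auto simp: lookup_add lookup_minus lookup_single when_def\<close>)
  then show "lookup (div_var x (Var y * p)) n = lookup (Var y * div_var x p) n"
    using assms by (simp add: lookup_div_var lookup_Var_mult lookup_add lookup_single)
qed

lemma div_var_sum: "div_var x (\<Sum>i\<in>A. f i) = (\<Sum>i\<in>A. div_var x (f i))"
  by (rule poly_mapping_eqI) (simp add: lookup_sum lookup_div_var)

lemma div_var_uminus: "div_var x (- p) = - div_var x p"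
  by (rule poly_mapping_eqI) (simp add: lookup_div_var)

lemma div_var_0 [simp]: "div_var x 0 = 0"
  by (rule poly_mapping_eqI) (simp add: lookup_div_var)

lemma div_var_decomp: "Var x * div_var x p + mfilter (\<lambda>m. lookup m x = 0) p = p"
proof (rule poly_mapping_eqI)
  fix n :: "'a \<Rightarrow>\<^sub>0 nat"
  have "single x 1 + (n - single x 1) = n" if "lookup n x \<noteq> 0"
    by (rule exponent_split[symmetric]) (use that in \<open>auto simp: lookup_single when_def\<close>)
  then show "lookup (Var x * div_var x p + mfilter (\<lambda>m. lookup m x = 0) p) n = lookup p n"
    by (simp add: lookup_add lookup_Var_mult lookup_div_var)
qed

section \<open>Ideals\<close>

text \<open>The ring as a module over itself: \<open>ideal.subspace\<close> then means being an
  ideal.\<close>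

interpretation ideal: Modules.module "(*) :: 'r::comm_ring_1 \<Rightarrow> 'r \<Rightarrow> 'r"
  by unfold_locales (auto simp: algebra_simps)

declare ideal.scale_scale [simp del]

lemma ideal_of_base: "b \<in> B \<Longrightarrow> b \<in> ideal_of B"
  unfolding ideal_of_def by (rule ideal.span_base)

lemma ideal_of_mult: "p \<in> ideal_of B \<Longrightarrow> c * p \<in> ideal_of B"
  unfolding ideal_of_def by (rule ideal.span_scale)

lemma ideal_of_mult2: "p \<in> ideal_of B \<Longrightarrow> p * c \<in> ideal_of B"
  by (metis ideal_of_mult mult.commute)

lemma ideal_of_least: "B \<subseteq> J \<Longrightarrow> ideal.subspace J \<Longrightarrow> ideal_of B \<subseteq> J"
  unfolding ideal_of_def by (rule ideal.span_minimal)

lemma ideal_of_subspace: "ideal.subspace (ideal_of B)"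
  unfolding ideal_of_def by (rule ideal.subspace_span)

lemma ideal_of_mono: "A \<subseteq> B \<Longrightarrow> ideal_of A \<subseteq> ideal_of B"
  unfolding ideal_of_def by (rule ideal.span_mono)

lemma ideal_power_mono: "I \<subseteq> J \<Longrightarrow> ideal_power I k \<subseteq> ideal_power J k"
  unfolding ideal_power_def by (rule ideal_of_mono) blast

lemma ideal_power_prod: "(\<And>i. i < k \<Longrightarrow> f i \<in> I) \<Longrightarrow> (\<Prod>i<k. f i) \<in> ideal_power I k"
  unfolding ideal_power_def by (rule ideal_of_base) blast

section \<open>Monomial ideals\<close>

definition monomial_ideal :: "('x::finite, 'k::field) polynomials set \<Rightarrow> bool" where
  "monomial_ideal J \<longleftrightarrow> ideal.subspace J \<and>
     (\<forall>p\<in>J. \<forall>m\<in>keys p. single m 1 \<in> J)"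

lemma single_mult_lookup: "single m c = single 0 c * single m (1::'k::field)"
  by (simp add: mult_single)

lemma monomial_ideal_iff:
  assumes "monomial_ideal J"
  shows "p \<in> J \<longleftrightarrow> (\<forall>m\<in>keys p. single m 1 \<in> J)"
proof
  assume *: "\<forall>m\<in>keys p. single m 1 \<in> J"
  have J: "ideal.subspace J" using assms by (simp add: monomial_ideal_def)
  have "(\<Sum>m\<in>keys p. single m (lookup p m)) \<in> J"
    by (rule ideal.subspace_sum[OF J], subst single_mult_lookup, rule ideal.subspace_scale[OF J])
      (use * in auto)
  then show "p \<in> J" by (simp add: sum_single_lookup)
qed (use assms in \<open>auto simp: monomial_ideal_def\<close>)

text \<open>The polynomials all of whose monomials lie in \<open>ideal_of B\<close> form an ideal,
  so it suffices to test the elements of \<open>B\<close>.\<close>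

lemma monomial_ideal_of:
  fixes B :: "('x::finite, 'k::field) polynomials set"
  assumes "\<And>b m. b \<in> B \<Longrightarrow> m \<in> keys b \<Longrightarrow> single m 1 \<in> ideal_of B"
  shows "monomial_ideal (ideal_of B)"
proof -
  let ?J = "{p :: ('x, 'k) polynomials. \<forall>m\<in>keys p. single m (1::'k) \<in> ideal_of B}"
  have "ideal.subspace ?J"
    unfolding ideal.subspace_def
  proof (intro conjI ballI allI)
    fix p q assume "p \<in> ?J" "q \<in> ?J"
    then show "p + q \<in> ?J"
      using keys_add[of p q] by auto
  next
    fix c q assume q: "q \<in> ?J"
    show "c * q \<in> ?J"
    proof clarify
      fix m assume "m \<in> keys (c * q)"
      then obtain a b where "m = a + b" "b \<in> keys q"
        using keys_mult[of c q] by auto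
      then show "single m (1::'k) \<in> ideal_of B"
        using q ideal_of_mult[of "single b 1" B "single a 1"]
        by (simp add: mult_single)
    qed
  qed simp
  then have "ideal_of B \<subseteq> ?J"
    by (rule ideal_of_least[rotated]) (use assms in auto)
  then show ?thesis
    by (auto simp: monomial_ideal_def ideal_of_subspace)
qed

lemma monomial_ideal_Inter:
  "(\<And>A. A \<in> P \<Longrightarrow> monomial_ideal (f A)) \<Longrightarrow> monomial_ideal (\<Inter>A\<in>P. f A)"
  by (auto simp: monomial_ideal_def ideal.subspace_def)

lemma keys_prod:
  fixes f :: "nat \<Rightarrow> ('x::finite, 'k::field) polynomials"
  assumes "m \<in> keys (\<Prod>i<k. f i)"
  shows "\<exists>g. m = (\<Sum>i<k. g i) \<and> (\<forall>i<k. g i \<in> keys (f i))"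
  using assms
proof (induction k arbitrary: m)
  case (Suc k)
  obtain a b where ab: "m = a + b" "a \<in> keys (\<Prod>i<k. f i)" "b \<in> keys (f k)"
    using Suc.prems keys_mult[of "\<Prod>i<k. f i" "f k"] by auto
  then obtain g where g: "a = (\<Sum>i<k. g i)" "\<forall>i<k. g i \<in> keys (f i)"
    using Suc.IH by blast
  then show ?case using ab
    by (intro exI[of _ "\<lambda>i. if i = k then b else g i"]) (auto simp: less_Suc_eq)
qed simp

lemma prod_single: "(\<Prod>i\<in>A. single (g i) 1) = single (sum g A) 1"
  by (induction A rule: infinite_finite_induct) (auto simp: mult_single)

lemma monomial_ideal_power:
  assumes "monomial_ideal I" shows "monomial_ideal (ideal_power I k)"
  unfolding ideal_power_def
proof (rule monomial_ideal_of)
  fix b m assume "b \<in> {\<Prod>i<k. f i |f. \<forall>i<k. f i \<in> I}" "m \<in> keys b"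
  then obtain f g where f: "\<forall>i<k. f i \<in> I" and g: "m = (\<Sum>i<k. g i)" "\<forall>i<k. g i \<in> keys (f i)"
    using keys_prod by (auto, metis (no_types, lifting))
  have "(\<Prod>i<k. single (g i) 1) \<in> ideal_power I k"
    by (rule ideal_power_prod) (use f g assms in \<open>auto simp: monomial_ideal_def\<close>)
  then show "single m 1 \<in> ideal_of {\<Prod>i<k. f i |f. \<forall>i<k. f i \<in> I}"
    by (simp add: prod_single g ideal_power_def)
qed

lemma monomial_ideal_Vars: "monomial_ideal (ideal_of (Var ` A))"
  by (rule monomial_ideal_of) (auto simp: Var_def split: if_splits intro!: ideal_of_base)

text \<open>The polynomials whose monomials all have degree at least \<open>k\<close> in the
  variables of \<open>A\<close> form an ideal \<open>L k\<close>; the prime lies in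
  \<open>L 1\<close>, and a product of \<open>k\<close> elements of \<open>L 1\<close> lies in
  \<open>L k\<close>.\<close>

lemma keys_power_Vars:
  fixes p :: "('x::finite, 'k::field) polynomials"
  assumes "p \<in> ideal_power (ideal_of (Var ` A)) k" "m \<in> keys p"
  shows "k \<le> (\<Sum>x\<in>A. lookup m x)"
proof -
  define L where "L k = {p :: ('x, 'k) polynomials. \<forall>m\<in>keys p. k \<le> (\<Sum>x\<in>A. lookup m x)}" for k
  have L: "ideal.subspace (L k)" for k
    unfolding ideal.subspace_def
  proof safe
    fix p q assume "p \<in> L k" "q \<in> L k"
    then show "p + q \<in> L k" using keys_add[of p q] by (auto simp: L_def)
  next
    fix c p assume "p \<in> L k"
    then show "c * p \<in> L k" using keys_mult[of c p]
      by (fastforce simp: L_def lookup_add sum.distrib)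
  qed (simp add: L_def)
  have 1: "ideal_of (Var ` A) \<subseteq> L 1"
  proof (rule ideal_of_least[OF _ L], clarsimp simp: L_def Var_def)
    fix x assume "x \<in> A"
    then have "lookup (single x (1::nat)) x \<le> (\<Sum>y\<in>A. lookup (single x (1::nat)) y)"
      by (intro member_le_sum) auto
    then show "Suc 0 \<le> (\<Sum>y\<in>A. lookup (single x (Suc 0)) y)"
      by simp
  qed
  have "ideal_power (ideal_of (Var ` A)) k \<subseteq> L k"
    unfolding ideal_power_def
  proof (rule ideal_of_least[OF _ L], safe)
    fix f :: "nat \<Rightarrow> ('x, 'k) polynomials" assume f: "\<forall>i<k. f i \<in> ideal_of (Var ` A)"
    show "(\<Prod>i<k. f i) \<in> L k"
      unfolding L_def
    proof safe
      fix m assume "m \<in> keys (\<Prod>i<k. f i)"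
      then obtain g where g: "m = (\<Sum>i<k. g i)" "\<forall>i<k. g i \<in> keys (f i)"
        using keys_prod by blast
      have "(\<Sum>i<k. 1) \<le> (\<Sum>i<k. \<Sum>x\<in>A. lookup (g i) x)"
        by (rule sum_mono) (use f 1 g in \<open>auto simp: L_def\<close>)
      also have "\<dots> = (\<Sum>x\<in>A. lookup m x)"
        unfolding g lookup_sum by (rule sum.swap)
      finally show "k \<le> (\<Sum>x\<in>A. lookup m x)" by simp
    qed
  qed
  then show ?thesis using assms by (auto simp: L_def)
qed

lemma Vars_iff:
  fixes p :: "('x::finite, 'k::field) polynomials"
  shows "p \<in> ideal_of (Var ` A) \<longleftrightarrow> (\<forall>m\<in>keys p. \<exists>x\<in>A. lookup m x \<noteq> 0)"
proof
  assume "p \<in> ideal_of (Var ` A)"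
  then have "(\<Prod>i<(1::nat). p) \<in> ideal_power (ideal_of (Var ` A)) 1"
    by (intro ideal_power_prod)
  then have p: "p \<in> ideal_power (ideal_of (Var ` A)) 1" by simp
  show "\<forall>m\<in>keys p. \<exists>x\<in>A. lookup m x \<noteq> 0"
  proof
    fix m assume "m \<in> keys p"
    then have "1 \<le> (\<Sum>x\<in>A. lookup m x)" by (rule keys_power_Vars[OF p])
    then show "\<exists>x\<in>A. lookup m x \<noteq> 0" by (metis not_one_le_zero sum.neutral)
  qed
next
  assume *: "\<forall>m\<in>keys p. \<exists>x\<in>A. lookup m x \<noteq> 0"
  show "p \<in> ideal_of (Var ` A)"
  proof (subst monomial_ideal_iff[OF monomial_ideal_Vars], safe)
    fix m assume "m \<in> keys p"
    with * obtain x where x: "x \<in> A" "lookup m x \<noteq> 0" by blast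
    have "m = (m - single x 1) + single x 1"
      by (subst add.commute, rule exponent_split) (use x in \<open>auto simp: lookup_single when_def\<close>)
    then have "single m 1 = single (m - single x 1) 1 * Var x"
      by (simp add: Var_def mult_single)
    also have "\<dots> \<in> ideal_of (Var ` A)"
      by (intro ideal_of_mult ideal_of_base) (use x in auto)
    finally show "single m 1 \<in> ideal_of (Var ` A)" .
  qed
qed

section \<open>Koszul complexes\<close>

text \<open>A chain assigns to a set \<open>\<tau>\<close> of variables the coefficient of the exterior product of the
  elements of \<open>\<tau>\<close>, taken in the order given by \<open>idx\<close>.\<close>

locale koszul =
  fixes idx :: "'x::finite \<Rightarrow> nat"
  assumes inj_idx: "inj idx"
begin

section \<open>Signs and the Koszul differential\<close>

definition sg :: "'x \<Rightarrow> 'x set \<Rightarrow> 'r::comm_ring_1" where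
  "sg x \<tau> = (- 1) ^ card {y \<in> \<tau>. idx y < idx x}"

lemma sg_cases: "sg x \<tau> = (1 :: 'r::comm_ring_1) \<or> sg x \<tau> = (- 1 :: 'r)"
  by (simp add: sg_def) (metis minus_one_power_iff)

lemma sg_sq [simp]: "sg x \<tau> * sg x \<tau> = (1 :: 'r::comm_ring_1)"
  using sg_cases[of x \<tau>, where 'r = 'r] by auto

lemma sg_sq_mult [simp]: "sg x \<tau> * (sg x \<tau> * c) = (c :: 'r::comm_ring_1)"
  by (simp flip: mult.assoc)

lemma sg_insert:
  assumes "y \<notin> \<tau>"
  shows "sg x (insert y \<tau>) = (if idx y < idx x then - sg x \<tau> else sg x \<tau>)"
proof -
  have "{z \<in> insert y \<tau>. idx z < idx x} =
      (if idx y < idx x then insert y {z \<in> \<tau>. idx z < idx x} else {z \<in> \<tau>. idx z < idx x})"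
    by auto
  then show ?thesis using assms by (simp add: sg_def)
qed

text \<open>Exactly one of \<open>x\<close> and \<open>y\<close> precedes the other, so exactly one
  of the two signs changes when the other element is inserted.\<close>

lemma sg_swap:
  assumes "x \<noteq> y" "x \<notin> \<tau>" "y \<notin> \<tau>"
  shows "sg x \<tau> * sg y (insert x \<tau>) = - (sg y \<tau> * sg x (insert y \<tau>))"
    and "sg y (insert x \<tau>) * sg x (insert y \<tau>) = - (sg x \<tau> * sg y \<tau>)"
proof -
  have "idx x < idx y \<longleftrightarrow> \<not> idx y < idx x"
    using assms(1) inj_idx by (metis injD linorder_less_linear order.asym)
  then show "sg x \<tau> * sg y (insert x \<tau>) = - (sg y \<tau> * sg x (insert y \<tau>))"
    and "sg y (insert x \<tau>) * sg x (insert y \<tau>) = - (sg x \<tau> * sg y \<tau>)"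
    using assms by (auto simp: sg_insert mult.commute)
qed

text \<open>The part of the Koszul differential that removes \<open>x\<close> from the exterior
  product and multiplies by it. Chains being coefficient functions, the value at
  \<open>\<tau>\<close> is read off at \<open>insert x \<tau>\<close>.\<close>

definition contr :: "'x \<Rightarrow> ('x set \<Rightarrow> ('x, 'k::field) polynomials) \<Rightarrow> 'x set \<Rightarrow> ('x, 'k) polynomials" where
  "contr x z \<tau> = (if x \<in> \<tau> then 0 else sg x \<tau> * (Var x * z (insert x \<tau>)))"

definition bd :: "'x set \<Rightarrow> ('x set \<Rightarrow> ('x, 'k::field) polynomials) \<Rightarrow> 'x set \<Rightarrow> ('x, 'k) polynomials" where
  "bd V z \<tau> = (\<Sum>x\<in>V. contr x z \<tau>)"

lemma contr_contr: "contr x (contr x z) \<tau> = 0"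
  by (simp add: contr_def)

lemma contr_anticomm: "contr x (contr y z) \<tau> = - contr y (contr x z) \<tau>"
proof (cases "x = y \<or> x \<in> \<tau> \<or> y \<in> \<tau>")
  case True
  then show ?thesis by (auto simp: contr_def)
next
  case False
  then have xy: "x \<noteq> y" "y \<noteq> x" "x \<notin> \<tau>" "y \<notin> \<tau>" by auto
  define q where "q = z (insert x (insert y \<tau>))"
  have q: "z (insert y (insert x \<tau>)) = q" by (simp add: q_def insert_commute)
  have "contr x (contr y z) \<tau> = sg x \<tau> * (Var x * (sg y (insert x \<tau>) * (Var y * q)))"
    using xy by (simp add: contr_def q)
  also have "\<dots> = (sg x \<tau> * sg y (insert x \<tau>)) * (Var x * Var y * q)"
    by (simp only: mult_ac)
  also have "\<dots> = - ((sg y \<tau> * sg x (insert y \<tau>)) * (Var x * Var y * q))"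
    by (subst sg_swap(1)[OF xy(1,3,4)]) (rule mult_minus_left)
  also have "(sg y \<tau> * sg x (insert y \<tau>)) * (Var x * Var y * q) =
      sg y \<tau> * (Var y * (sg x (insert y \<tau>) * (Var x * q)))"
    by (simp only: mult_ac)
  also have "\<dots> = contr y (contr x z) \<tau>"
    using xy by (simp add: contr_def q_def)
  finally show ?thesis .
qed

lemma contr_add: "contr x (\<lambda>\<tau>. z \<tau> + w \<tau>) \<tau> = contr x z \<tau> + contr x w \<tau>"
  by (simp add: contr_def distrib_left)

lemma contr_diff: "contr x (\<lambda>\<tau>. z \<tau> - w \<tau>) \<tau> = contr x z \<tau> - contr x w \<tau>"
  by (simp add: contr_def right_diff_distrib)

lemma contr_sum: "contr x (\<lambda>\<tau>. \<Sum>i\<in>A. f i * z i \<tau>) \<tau> = (\<Sum>i\<in>A. f i * contr x (z i) \<tau>)"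
proof (cases "x \<in> \<tau>")
  case False
  have "sg x \<tau> * (Var x * (\<Sum>i\<in>A. f i * z i (insert x \<tau>))) =
      (\<Sum>i\<in>A. f i * (sg x \<tau> * (Var x * z i (insert x \<tau>))))"
    unfolding sum_distrib_left by (intro sum.cong refl) (simp only: mult_ac)
  with False show ?thesis by (simp add: contr_def)
qed (simp add: contr_def)

lemma contr_bd: "contr x (bd V z) \<tau> = (\<Sum>y\<in>V. contr x (contr y z) \<tau>)"
  using contr_sum[where f = "\<lambda>_. 1" and A = V and z = "\<lambda>y. contr y z"]
  by (simp add: bd_def[abs_def])

lemma bd_add: "bd V (\<lambda>\<tau>. z \<tau> + w \<tau>) \<tau> = bd V z \<tau> + bd V w \<tau>"
  by (simp add: bd_def contr_add sum.distrib)

lemma bd_diff: "bd V (\<lambda>\<tau>. z \<tau> - w \<tau>) \<tau> = bd V z \<tau> - bd V w \<tau>"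
  by (simp add: bd_def contr_diff sum_subtractf)

lemma bd_sum: "bd V (\<lambda>\<tau>. \<Sum>i\<in>A. f i * z i \<tau>) \<tau> = (\<Sum>i\<in>A. f i * bd V (z i) \<tau>)"
  by (simp add: bd_def contr_sum sum_distrib_left) (rule sum.swap)

lemma bd_zero [simp]: "bd V (\<lambda>_. 0) \<tau> = 0"
  by (simp add: bd_def contr_def)

lemma bd_anticomm: "bd V (bd W z) \<tau> = - bd W (bd V z) \<tau>"
proof -
  have "bd V (bd W z) \<tau> = (\<Sum>x\<in>V. \<Sum>y\<in>W. contr x (contr y z) \<tau>)"
    by (simp add: bd_def[of V] contr_bd)
  also have "\<dots> = (\<Sum>x\<in>V. \<Sum>y\<in>W. - contr y (contr x z) \<tau>)"
    by (subst contr_anticomm) simp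
  also have "\<dots> = - (\<Sum>y\<in>W. \<Sum>x\<in>V. contr y (contr x z) \<tau>)"
    by (simp add: sum_negf) (rule sum.swap)
  also have "\<dots> = - bd W (bd V z) \<tau>"
    by (simp add: bd_def[of W] contr_bd)
  finally show ?thesis .
qed

text \<open>By induction on \<open>V\<close>, because anticommutation alone does not give this in characteristic 2.\<close>

lemma bd_bd: "bd V (bd V z) \<tau> = 0"
proof -
  have "(\<Sum>x\<in>V. \<Sum>y\<in>V. contr x (contr y z) \<tau>) = 0"
  proof (induction V rule: infinite_finite_induct)
    case (insert a V)
    have "(\<Sum>x\<in>V. contr x (contr a z) \<tau>) = - (\<Sum>x\<in>V. contr a (contr x z) \<tau>)"
      by (subst contr_anticomm) (simp add: sum_negf)
    with insert show ?case
      by (simp add: sum.distrib contr_contr)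
  qed auto
  then show ?thesis by (simp add: bd_def[of V] contr_bd)
qed

section \<open>Contracting homotopies and exactness in positive degrees\<close>

definition homot :: "'x \<Rightarrow> ('x set \<Rightarrow> ('x, 'k::field) polynomials) \<Rightarrow> 'x set \<Rightarrow> ('x, 'k) polynomials" where
  "homot x z \<tau> = (if x \<in> \<tau> then sg x (\<tau> - {x}) * div_var x (z (\<tau> - {x})) else 0)"

text \<open>What remains when \<open>homot x\<close>, which divides coefficients by \<open>x\<close>
  and wedges with \<open>x\<close>, is used as a homotopy.\<close>

definition proj :: "'x \<Rightarrow> ('x set \<Rightarrow> ('x, 'k::field) polynomials) \<Rightarrow> 'x set \<Rightarrow> ('x, 'k) polynomials" where
  "proj x z \<tau> = (if x \<in> \<tau> then 0 else mfilter (\<lambda>m. lookup m x = 0) (z \<tau>))"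

lemma div_var_sg:
  fixes p :: "('x, 'k::field) polynomials"
  shows "div_var y (sg x \<tau> * p) = sg x \<tau> * div_var y p"
  using sg_cases[of x \<tau>, where 'r = "('x, 'k) polynomials"] by (auto simp: div_var_uminus)

text \<open>For \<open>x \<in> \<tau>\<close> the second summand undoes a multiplication by
  \<open>x\<close>; for \<open>x \<notin> \<tau>\<close> the first and third are division by
  \<open>x\<close> with remainder.\<close>

lemma homot_same: "contr x (homot x z) \<tau> + homot x (contr x z) \<tau> + proj x z \<tau> = z \<tau>"
proof (cases "x \<in> \<tau>")
  case True
  then show ?thesis
    by (simp add: contr_def homot_def proj_def div_var_sg div_var_Var_mult insert_absorb)
next
  case False
  then show ?thesis
    by (simp add: contr_def homot_def proj_def div_var_decomp mult.left_commute[of "Var x" "sg x \<tau>"])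
qed

lemma homot_other:
  assumes "x \<noteq> y"
  shows "contr y (homot x z) \<tau> + homot x (contr y z) \<tau> = 0"
proof (cases "y \<notin> \<tau> \<and> x \<in> \<tau>")
  case True
  define \<tau>' where "\<tau>' = \<tau> - {x}"
  have \<tau>: "\<tau> = insert x \<tau>'" "x \<notin> \<tau>'" "y \<notin> \<tau>'" "insert y \<tau> - {x} = insert y \<tau>'" "\<tau> - {x} = \<tau>'"
    using True assms by (auto simp: \<tau>'_def)
  define q where "q = div_var x (z (insert y \<tau>'))"
  have "contr y (homot x z) \<tau> = sg y (insert x \<tau>') * (Var y * (sg x (insert y \<tau>') * q))"
    using True assms unfolding contr_def homot_def \<tau>(4) q_def by (simp flip: \<tau>(1))
  also have "\<dots> = (sg y (insert x \<tau>') * sg x (insert y \<tau>')) * (Var y * q)"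
    by (simp only: mult_ac)
  also have "\<dots> = - (sg x \<tau>' * sg y \<tau>') * (Var y * q)"
    by (subst sg_swap(2)[OF assms \<tau>(2,3)]) (rule refl)
  finally have "contr y (homot x z) \<tau> = - (sg x \<tau>' * sg y \<tau>') * (Var y * q)" .
  moreover have "homot x (contr y z) \<tau> = sg x \<tau>' * (sg y \<tau>' * (Var y * q))"
    using True \<tau>(3) assms unfolding homot_def \<tau>(5) contr_def
    by (simp add: div_var_sg div_var_Var_mult_neq q_def)
  ultimately show ?thesis by (simp add: mult.assoc)
next
  case False
  then show ?thesis using assms by (auto simp: contr_def homot_def)
qed

lemma homot_bd: "homot x (bd V z) \<tau> = (\<Sum>y\<in>V. homot x (contr y z) \<tau>)"
  by (simp add: homot_def bd_def div_var_sum sum_distrib_left)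

lemma homotopy:
  assumes "x \<in> V"
  shows "bd V (homot x z) \<tau> + homot x (bd V z) \<tau> + proj x z \<tau> = z \<tau>"
proof -
  have "bd V (homot x z) \<tau> + homot x (bd V z) \<tau> =
      (\<Sum>y\<in>V. contr y (homot x z) \<tau> + homot x (contr y z) \<tau>)"
    by (simp add: homot_bd sum.distrib) (simp add: bd_def)
  also have "\<dots> = (\<Sum>y\<in>V. if y = x then contr x (homot x z) \<tau> + homot x (contr x z) \<tau> else 0)"
    by (rule sum.cong) (auto simp: homot_other)
  also have "\<dots> = contr x (homot x z) \<tau> + homot x (contr x z) \<tau>"
    using assms by simp
  finally show ?thesis using homot_same[of x z \<tau>] by simp
qed

definition chain :: "'x set \<Rightarrow> nat \<Rightarrow> ('x set \<Rightarrow> 'r::zero) \<Rightarrow> bool" where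
  "chain V p z \<longleftrightarrow> (\<forall>\<tau>. z \<tau> \<noteq> 0 \<longrightarrow> \<tau> \<subseteq> V \<and> card \<tau> = p)"

lemma chain_diff: "chain V p z \<Longrightarrow> chain V p w \<Longrightarrow> chain V p (\<lambda>\<tau>. z \<tau> - w \<tau>)" for z :: "_ \<Rightarrow> _::ab_group_add"
  by (force simp: chain_def)

lemma chain_add: "chain V p z \<Longrightarrow> chain V p w \<Longrightarrow> chain V p (\<lambda>\<tau>. z \<tau> + w \<tau>)" for z :: "_ \<Rightarrow> _::ab_group_add"
  by (force simp: chain_def)

lemma chain_bd:
  assumes "chain V (Suc p) z" "W \<subseteq> V" shows "chain V p (bd W z)"
  unfolding chain_def
proof (intro allI impI)
  fix \<tau> assume "bd W z \<tau> \<noteq> 0"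
  then obtain x where "x \<in> W" "contr x z \<tau> \<noteq> 0"
    unfolding bd_def by (meson sum.not_neutral_contains_not_neutral)
  then have x: "x \<in> V" "x \<notin> \<tau>" "z (insert x \<tau>) \<noteq> 0"
    using assms(2) by (auto simp: contr_def split: if_splits)
  then have "insert x \<tau> \<subseteq> V" "card (insert x \<tau>) = Suc p"
    using assms(1) unfolding chain_def by blast+
  with x show "\<tau> \<subseteq> V \<and> card \<tau> = p" by simp
qed

text \<open>The homotopies are applied for one variable of \<open>V\<close> after another: modulo
  boundaries the cycle is replaced by its remainder, whose support avoids one more variable. In the
  end the support consists of sets of positive size in \<open>V\<close> that avoid
  \<open>V\<close>.\<close>

lemma koszul_exact:
  assumes z: "chain V p z" "p > 0" and cycle: "\<And>\<tau>. bd V z \<tau> = 0"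
  shows "\<exists>w. chain V (Suc p) w \<and> (\<forall>\<tau>. bd V w \<tau> = z \<tau>)"
proof -
  have "\<exists>w z'. chain V (Suc p) w \<and> chain V p z' \<and> (\<forall>\<tau>. z \<tau> = bd V w \<tau> + z' \<tau>) \<and>
      (\<forall>\<tau>. z' \<tau> \<noteq> 0 \<longrightarrow> \<tau> \<inter> U = {})" if "U \<subseteq> V" for U
    using finite[of U] that
  proof (induction U rule: finite_induct)
    case empty
    show ?case
      by (rule exI[of _ "\<lambda>_. 0"], rule exI[of _ z]) (use z in \<open>simp add: chain_def\<close>)
  next
    case (insert x U)
    then have "U \<subseteq> V" by blast
    from insert.IH[OF this] obtain w z' where w: "chain V (Suc p) w" and z': "chain V p z'"
      and eq: "\<forall>\<tau>. z \<tau> = bd V w \<tau> + z' \<tau>" and U: "\<forall>\<tau>. z' \<tau> \<noteq> 0 \<longrightarrow> \<tau> \<inter> U = {}"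
      by blast
    \<comment> \<open>The remainder differs from \<open>z\<close> by a boundary, hence is a cycle,
      and one term of the homotopy formula vanishes.\<close>
    have "z' = (\<lambda>\<tau>. z \<tau> - bd V w \<tau>)"
    proof
      fix \<tau> show "z' \<tau> = z \<tau> - bd V w \<tau>" using spec[OF eq, of \<tau>] by simp
    qed
    then have "bd V z' \<tau> = 0" for \<tau>
      by (simp add: bd_diff cycle bd_bd)
    then have "homot x (bd V z') \<tau> = 0" for \<tau>
      by (simp add: homot_def)
    then have "bd V (homot x z') \<tau> + proj x z' \<tau> = z' \<tau>" for \<tau>
      using homotopy[of x V z' \<tau>] insert.prems by simp
    then have "z \<tau> = bd V (\<lambda>\<tau>. w \<tau> + homot x z' \<tau>) \<tau> + proj x z' \<tau>" for \<tau>
      by (simp add: bd_add eq add.assoc)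
    moreover have "chain V (Suc p) (homot x z')"
      unfolding chain_def
    proof (intro allI impI)
      fix \<tau> assume *: "homot x z' \<tau> \<noteq> 0"
      then have "x \<in> \<tau>" by (auto simp: homot_def split: if_splits)
      moreover have "z' (\<tau> - {x}) \<noteq> 0" using * by (auto simp: homot_def split: if_splits)
      then have "\<tau> - {x} \<subseteq> V" "card (\<tau> - {x}) = p" using z' by (auto simp: chain_def)
      ultimately show "\<tau> \<subseteq> V \<and> card \<tau> = Suc p"
        using insert.prems card_Suc_Diff1[of \<tau> x] by auto
    qed
    moreover have proj: "x \<notin> \<tau> \<and> z' \<tau> \<noteq> 0" if "proj x z' \<tau> \<noteq> 0" for \<tau>
      using that by (auto simp: proj_def split: if_splits)
    then have "chain V p (proj x z')"
      using z' unfolding chain_def by blast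
    moreover have "proj x z' \<tau> \<noteq> 0 \<longrightarrow> \<tau> \<inter> insert x U = {}" for \<tau>
      using U proj by blast
    ultimately show ?case
      by (intro exI[of _ "\<lambda>\<tau>. w \<tau> + homot x z' \<tau>"] exI[of _ "proj x z'"] conjI allI chain_add[OF w])
  qed
  then obtain w z' where *: "chain V (Suc p) w" "chain V p z'" "\<forall>\<tau>. z \<tau> = bd V w \<tau> + z' \<tau>"
     "\<forall>\<tau>. z' \<tau> \<noteq> 0 \<longrightarrow> \<tau> \<inter> V = {}" by blast
  have "z' \<tau> = 0" for \<tau>
  proof (rule ccontr)
    assume "z' \<tau> \<noteq> 0"
    then have "\<tau> \<subseteq> V" "card \<tau> = p" "\<tau> \<inter> V = {}" using * by (auto simp: chain_def)
    with z(2) show False by (auto simp: inf.absorb1)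
  qed
  with * show ?thesis by auto
qed

end

section \<open>Koszul homology and resolutions\<close>

text \<open>Vectors of length \<open>r\<close> are padded with zeros to functions on
  \<open>nat\<close>, so that equality of vectors is equality of functions; \<open>mapply\<close>
  ignores matrix entries outside the format.\<close>

definition fvecs :: "nat \<Rightarrow> (nat \<Rightarrow> 'r::zero) set" where
  "fvecs r = {v. \<forall>s\<ge>r. v s = 0}"

definition mapply :: "nat \<Rightarrow> nat \<Rightarrow> (nat \<Rightarrow> nat \<Rightarrow> 'r::comm_ring_1) \<Rightarrow> (nat \<Rightarrow> 'r) \<Rightarrow> nat \<Rightarrow> 'r" where
  "mapply r c A v = (\<lambda>s. if s < r then \<Sum>t<c. A s t * v t else 0)"

definition mimage :: "nat \<Rightarrow> nat \<Rightarrow> (nat \<Rightarrow> nat \<Rightarrow> 'r::comm_ring_1) \<Rightarrow> (nat \<Rightarrow> 'r) set" where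
  "mimage r c A = mapply r c A ` fvecs c"

definition mker :: "nat \<Rightarrow> nat \<Rightarrow> (nat \<Rightarrow> nat \<Rightarrow> 'r::comm_ring_1) \<Rightarrow> (nat \<Rightarrow> 'r) set" where
  "mker r c A = {v \<in> fvecs c. mapply r c A v = (\<lambda>_. 0)}"

text \<open>The elements of degree \<open>d\<close> of the free module with shifts \<open>e\<close>;
  \<open>hmat\<close> below describes maps of degree 0 between such modules.\<close>

definition hvec :: "int list \<Rightarrow> int \<Rightarrow> (nat \<Rightarrow> ('x::finite, 'k::field) polynomials) \<Rightarrow> bool" where
  "hvec e d v \<longleftrightarrow> (\<forall>s<length e. homogeneous (d - e ! s) (v s))"

definition hmat :: "int list \<Rightarrow> int list \<Rightarrow> (nat \<Rightarrow> nat \<Rightarrow> ('x::finite, 'k::field) polynomials) \<Rightarrow> bool" where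
  "hmat e e' A \<longleftrightarrow> (\<forall>s<length e. \<forall>t<length e'. homogeneous (e' ! t - e ! s) (A s t))"

lemma zero_in_mimage: "(\<lambda>_. 0) \<in> mimage r c A"
  unfolding mimage_def by (rule image_eqI[of _ _ "\<lambda>_. 0"]) (auto simp: mapply_def fvecs_def)

definition hcompv :: "int list \<Rightarrow> int \<Rightarrow> (nat \<Rightarrow> ('x::finite, 'k::field) polynomials) \<Rightarrow> nat \<Rightarrow> ('x, 'k) polynomials" where
  "hcompv e d v = (\<lambda>s. if s < length e then hcomp (d - e ! s) (v s) else 0)"

lemma hcompv_in_fvecs: "hcompv e d v \<in> fvecs (length e)"
  by (simp add: hcompv_def fvecs_def)

lemma hvec_hcompv: "hvec e d (hcompv e d v)"
  by (simp add: hcompv_def hvec_def)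

lemma hcompv_id: "hvec e d v \<Longrightarrow> v \<in> fvecs (length e) \<Longrightarrow> hcompv e d v = v"
  by (auto simp: hcompv_def hvec_def fvecs_def hcomp_id fun_eq_iff not_less)

lemma mapply_hcompv:
  assumes A: "hmat e e' A"
  shows "mapply (length e) (length e') A (hcompv e' d v) = hcompv e d (mapply (length e) (length e') A v)"
proof
  fix s
  show "mapply (length e) (length e') A (hcompv e' d v) s = hcompv e d (mapply (length e) (length e') A v) s"
  proof (cases "s < length e")
    case True
    have "mapply (length e) (length e') A (hcompv e' d v) s =
        (\<Sum>t<length e'. A s t * hcomp (d - e' ! t) (v t))"
      using True by (simp add: mapply_def hcompv_def)
    also have "\<dots> = (\<Sum>t<length e'. hcomp (d - e ! s) (A s t * v t))"
    proof (rule sum.cong)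
      fix t assume "t \<in> {..<length e'}"
      then have "homogeneous (e' ! t - e ! s) (A s t)" using A True by (simp add: hmat_def)
      from hcomp_mult[OF this, of "d - e ! s" "v t"]
      show "A s t * hcomp (d - e' ! t) (v t) = hcomp (d - e ! s) (A s t * v t)" by simp
    qed simp
    also have "\<dots> = hcompv e d (mapply (length e) (length e') A v) s"
      using True by (simp add: mfilter_sum mapply_def hcompv_def)
    finally show ?thesis .
  qed (simp add: mapply_def hcompv_def)
qed

text \<open>A map of degree 0 commutes with taking components, so the component of degree
  \<open>d\<close> of any preimage is again a preimage.\<close>

lemma homogeneous_lift:
  assumes A: "hmat e e' A" and v: "hvec e d v" "v \<in> mimage (length e) (length e') A"
  obtains u where "u \<in> fvecs (length e')" "hvec e' d u" "mapply (length e) (length e') A u = v"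
proof -
  obtain u where u: "v = mapply (length e) (length e') A u"
    using v(2) by (auto simp: mimage_def)
  then have "v \<in> fvecs (length e)" by (simp add: fvecs_def mapply_def)
  then have "mapply (length e) (length e') A (hcompv e' d u) = v"
    using v(1) by (simp add: mapply_hcompv[OF A] hcompv_id flip: u)
  then show ?thesis
    by (rule that[OF hcompv_in_fvecs hvec_hcompv])
qed

text \<open>Multiples of the variables are split off one variable at a time; the rest could only be
  a constant term.\<close>

lemma irrelevant_decomp:
  fixes p :: "('x::finite, 'k::field) polynomials"
  assumes "lookup p 0 = 0"
  obtains q where "p = (\<Sum>x\<in>UNIV. Var x * q x)"
proof -
  have "\<exists>q. p = (\<Sum>x\<in>U. Var x * q x) + mfilter (\<lambda>m. \<forall>x\<in>U. lookup m x = 0) p" for U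
    using finite[of U]
  proof (induction U rule: finite_induct)
    case empty
    show ?case by (simp, rule poly_mapping_eqI) simp
  next
    case (insert x U)
    let ?p = "mfilter (\<lambda>m. \<forall>x\<in>U. lookup m x = 0) p"
    obtain q where q: "p = (\<Sum>x\<in>U. Var x * q x) + ?p" using insert.IH by blast
    have p: "?p = Var x * div_var x ?p + mfilter (\<lambda>m. \<forall>x\<in>insert x U. lookup m x = 0) p"
      (is "_ = _ + ?p'")
    proof -
      have "mfilter (\<lambda>m. lookup m x = 0) ?p = ?p'"
        by (rule poly_mapping_eqI) simp
      then show ?thesis using div_var_decomp[of x ?p] by simp
    qed
    have "(\<Sum>y\<in>U. Var y * (q(x := div_var x ?p)) y) = (\<Sum>y\<in>U. Var y * q y)"
      using insert.hyps by (intro sum.cong) auto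
    then have "(\<Sum>y\<in>insert x U. Var y * (q(x := div_var x ?p)) y) + ?p' =
        (\<Sum>y\<in>U. Var y * q y) + (Var x * div_var x ?p + ?p')"
      by (simp only: sum.insert[OF insert.hyps] fun_upd_same) (simp only: ac_simps)
    also have "\<dots> = p"
      by (simp only: p[symmetric] q[symmetric])
    finally show ?case by (intro exI[of _ "q(x := div_var x ?p)"]) (rule sym)
  qed
  from this[of UNIV] obtain q where q: "p = (\<Sum>x\<in>UNIV. Var x * q x) + mfilter (\<lambda>m. \<forall>x. lookup m x = 0) p"
    by auto
  have "mfilter (\<lambda>m. \<forall>x. lookup m x = 0) p = 0"
  proof (rule poly_mapping_eqI)
    fix m :: "'x \<Rightarrow>\<^sub>0 nat"
    have "m = 0" if "\<forall>x. lookup m x = 0" by (rule poly_mapping_eqI) (simp add: that)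
    then show "lookup (mfilter (\<lambda>m. \<forall>x. lookup m x = 0) p) m = lookup 0 m"
      using assms by auto
  qed
  with q show ?thesis by (intro that[of q]) simp
qed

section \<open>Dimension shifting along a resolution\<close>

context koszul
begin

text \<open>\<open>acyclic_at V e p d M\<close> says that the Koszul complex of \<open>M\<close> with respect to the variables in
  \<open>V\<close> has no homology in homological degree \<open>p\<close> and internal degree \<open>d\<close>, where \<open>M\<close> is a submodule
  of the free module with the shifts \<open>e\<close>.\<close>

definition acyclic_at ::
  "'x set \<Rightarrow> int list \<Rightarrow> nat \<Rightarrow> int \<Rightarrow> (nat \<Rightarrow> ('x, 'k::field) polynomials) set \<Rightarrow> bool" where
  "acyclic_at V e p d M \<longleftrightarrow>
     (\<forall>z. (\<forall>\<tau>. z \<tau> \<in> M) \<longrightarrow> (\<forall>s. chain V p (\<lambda>\<tau>. z \<tau> s)) \<longrightarrow> (\<forall>\<tau>. hvec e (d - int p) (z \<tau>)) \<longrightarrow>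
        (\<forall>\<tau> s. bd V (\<lambda>\<sigma>. z \<sigma> s) \<tau> = 0) \<longrightarrow>
        (\<exists>w. (\<forall>\<tau>. w \<tau> \<in> M) \<and> (\<forall>s. chain V (Suc p) (\<lambda>\<tau>. w \<tau> s)) \<and>
           (\<forall>\<tau> s. bd V (\<lambda>\<sigma>. w \<sigma> s) \<tau> = z \<tau> s)))"

lemma bd_mapply:
  "bd V (\<lambda>\<sigma>. mapply r c A (z \<sigma>) s) \<tau> = mapply r c A (\<lambda>t. bd V (\<lambda>\<sigma>. z \<sigma> t) \<tau>) s"
  by (simp add: mapply_def bd_sum[where z = "\<lambda>t \<sigma>. z \<sigma> t"])

lemma mapply_diff: "mapply r c A (\<lambda>t. u t - v t) s = mapply r c A u s - mapply r c A v s"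
  by (simp add: mapply_def right_diff_distrib sum_subtractf)

lemma homogeneous_sg: "homogeneous d p \<Longrightarrow> homogeneous d (sg x \<tau> * p)"
  for p :: "('x, 'k::field) polynomials"
  using sg_cases[of x \<tau>, where 'r = "('x, 'k) polynomials"] by (auto simp: homogeneous_uminus)

lemma homogeneous_bd:
  assumes "\<And>\<tau>. homogeneous d (z \<tau>)" shows "homogeneous (d + 1) (bd V z \<tau>)"
  unfolding bd_def
proof (rule homogeneous_sum)
  fix x
  show "homogeneous (d + 1) (contr x z \<tau>)"
    using homogeneous_mult[OF homogeneous_Var[of x] assms[of "insert x \<tau>"]]
    by (simp add: contr_def homogeneous_sg add.commute)
qed

text \<open>The connecting map of the long exact sequence of \<open>0 \<rightarrow> ker A \<rightarrow> F \<rightarrow> im A \<rightarrow> 0\<close> for a free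
  module \<open>F\<close>, whose Koszul homology vanishes in positive degrees.\<close>

lemma acyclic_at_syzygy:
  assumes A: "hmat e e' A"
    and ker: "acyclic_at V e' p d (mker (length e) (length e') A)"
  shows "acyclic_at V e (Suc p) d (mimage (length e) (length e') A)"
  unfolding acyclic_at_def
proof (intro allI impI)
  let ?A = "mapply (length e) (length e') A"
  fix z assume z: "\<forall>\<tau>. z \<tau> \<in> mimage (length e) (length e') A" "\<forall>s. chain V (Suc p) (\<lambda>\<tau>. z \<tau> s)"
    "\<forall>\<tau>. hvec e (d - int (Suc p)) (z \<tau>)" and cycle: "\<forall>\<tau> s. bd V (\<lambda>\<sigma>. z \<sigma> s) \<tau> = 0"
  \<comment> \<open>Zero is lifted to zero, so that the lift is supported on the same sets as
    \<open>z\<close>.\<close>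
  have "\<exists>u. u \<in> fvecs (length e') \<and> hvec e' (d - int (Suc p)) u \<and> ?A u = z \<tau> \<and>
      (z \<tau> = (\<lambda>_. 0) \<longrightarrow> u = (\<lambda>_. 0))" for \<tau>
  proof (cases "z \<tau> = (\<lambda>_. 0)")
    case True
    then show ?thesis
      by (intro exI[of _ "\<lambda>_. 0"]) (simp add: fvecs_def hvec_def mapply_def fun_eq_iff)
  next
    case False
    obtain u where "u \<in> fvecs (length e')" "hvec e' (d - int (Suc p)) u" "?A u = z \<tau>"
      using homogeneous_lift[OF A spec[OF z(3)] spec[OF z(1)]] by blast
    with False show ?thesis by blast
  qed
  then have "\<forall>\<tau>. \<exists>u. u \<in> fvecs (length e') \<and> hvec e' (d - int (Suc p)) u \<and> ?A u = z \<tau> \<and>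
      (z \<tau> = (\<lambda>_. 0) \<longrightarrow> u = (\<lambda>_. 0))" by blast
  from choice[OF this] obtain u where u: "\<And>\<tau>. u \<tau> \<in> fvecs (length e')"
    "\<And>\<tau>. hvec e' (d - int (Suc p)) (u \<tau>)"
    "\<And>\<tau>. ?A (u \<tau>) = z \<tau>" "\<And>\<tau>. z \<tau> = (\<lambda>_. 0) \<Longrightarrow> u \<tau> = (\<lambda>_. 0)"
    by blast
  have chain_u: "chain V (Suc p) (\<lambda>\<tau>. u \<tau> t)" for t
    unfolding chain_def
  proof (intro allI impI)
    fix \<tau> assume "u \<tau> t \<noteq> 0"
    then have "z \<tau> \<noteq> (\<lambda>_. 0)" using u(4)[of \<tau>] by (metis (mono_tags))
    then obtain s where "z \<tau> s \<noteq> 0" by auto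
    then show "\<tau> \<subseteq> V \<and> card \<tau> = Suc p" using z(2) unfolding chain_def by blast
  qed
  \<comment> \<open>The connecting map: the boundary of the lift lies in the kernel of
    \<open>A\<close>, because \<open>A\<close> commutes with \<open>bd\<close> and \<open>z\<close>
    is a cycle.\<close>
  define y where "y = (\<lambda>\<tau> t. bd V (\<lambda>\<sigma>. u \<sigma> t) \<tau>)"
  have fv: "u \<tau> t = 0" if "t \<ge> length e'" for \<tau> t
    using u(1)[of \<tau>] that by (simp add: fvecs_def)
  have "?A (y \<tau>) = (\<lambda>_. 0)" for \<tau>
  proof
    fix s
    have "?A (y \<tau>) s = bd V (\<lambda>\<sigma>. ?A (u \<sigma>) s) \<tau>"
      unfolding y_def by (rule bd_mapply[symmetric])
    then show "?A (y \<tau>) s = 0" by (simp add: u(3) cycle)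
  qed
  then have "y \<tau> \<in> mker (length e) (length e') A" for \<tau>
    by (simp add: mker_def fvecs_def y_def fv)
  moreover have "chain V p (\<lambda>\<tau>. y \<tau> t)" for t
    unfolding y_def by (rule chain_bd[OF chain_u subset_refl])
  moreover have "hvec e' (d - int p) (y \<tau>)" for \<tau>
    unfolding hvec_def y_def
  proof (intro allI impI)
    fix t assume "t < length e'"
    then have "homogeneous (d - int (Suc p) - e' ! t) (u \<tau> t)" for \<tau>
      using u(2) by (simp add: hvec_def)
    from homogeneous_bd[OF this]
    have "homogeneous (d - int (Suc p) - e' ! t + 1) (bd V (\<lambda>\<sigma>. u \<sigma> t) \<tau>)" .
    moreover have "d - int (Suc p) - e' ! t + 1 = d - int p - e' ! t" by simp
    ultimately show "homogeneous (d - int p - e' ! t) (bd V (\<lambda>\<sigma>. u \<sigma> t) \<tau>)" by metis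
  qed
  moreover have "bd V (\<lambda>\<sigma>. y \<sigma> t) \<tau> = 0" for \<tau> t
    unfolding y_def by (rule bd_bd)
  ultimately obtain w where w: "\<And>\<tau>. w \<tau> \<in> mker (length e) (length e') A"
    "\<And>t. chain V (Suc p) (\<lambda>\<tau>. w \<tau> t)" "\<And>\<tau> t. bd V (\<lambda>\<sigma>. w \<sigma> t) \<tau> = y \<tau> t"
    using ker unfolding acyclic_at_def by blast
  \<comment> \<open>Corrected by \<open>w\<close>, the lift is a cycle of positive degree in the
    free module and bounds there; \<open>A\<close> kills \<open>w\<close> and maps the bounding
    chain to one that bounds \<open>z\<close>.\<close>
  have "\<exists>b. chain V (Suc (Suc p)) b \<and> (\<forall>\<tau>. bd V b \<tau> = u \<tau> t - w \<tau> t)" for t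
  proof (rule koszul_exact)
    show "chain V (Suc p) (\<lambda>\<tau>. u \<tau> t - w \<tau> t)" by (intro chain_diff chain_u w(2))
    show "bd V (\<lambda>\<tau>. u \<tau> t - w \<tau> t) \<tau> = 0" for \<tau>
      unfolding bd_diff w(3) y_def by simp
  qed simp
  then have "\<forall>t. \<exists>b. chain V (Suc (Suc p)) b \<and> (\<forall>\<tau>. bd V b \<tau> = u \<tau> t - w \<tau> t)" by blast
  from choice[OF this] obtain b
    where b: "\<And>t. chain V (Suc (Suc p)) (b t)" "\<And>t \<tau>. bd V (b t) \<tau> = u \<tau> t - w \<tau> t"
    by blast
  define b' where "b' = (\<lambda>\<tau> t. if t < length e' then b t \<tau> else 0)"
  have b': "bd V (\<lambda>\<sigma>. b' \<sigma> t) \<tau> = u \<tau> t - w \<tau> t" for t \<tau>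
    using w(1)[of \<tau>] by (cases "t < length e'") (auto simp: b'_def b(2) fv mker_def fvecs_def)
  have chain_b': "chain V (Suc (Suc p)) (\<lambda>\<tau>. b' \<tau> t)" for t
    using b(1)[of t] by (simp add: b'_def chain_def)
  show "\<exists>w. (\<forall>\<tau>. w \<tau> \<in> mimage (length e) (length e') A) \<and> (\<forall>s. chain V (Suc (Suc p)) (\<lambda>\<tau>. w \<tau> s)) \<and>
           (\<forall>\<tau> s. bd V (\<lambda>\<sigma>. w \<sigma> s) \<tau> = z \<tau> s)"
  proof (intro exI[of _ "\<lambda>\<tau>. ?A (b' \<tau>)"] conjI allI)
    fix \<tau> show "?A (b' \<tau>) \<in> mimage (length e) (length e') A"
      unfolding mimage_def by (rule imageI) (simp add: fvecs_def b'_def)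
  next
    fix s show "chain V (Suc (Suc p)) (\<lambda>\<tau>. ?A (b' \<tau>) s)"
      unfolding chain_def
    proof (intro allI impI)
      fix \<tau> assume nz: "?A (b' \<tau>) s \<noteq> 0"
      have "\<exists>t. b' \<tau> t \<noteq> 0"
      proof (rule ccontr)
        assume "\<nexists>t. b' \<tau> t \<noteq> 0"
        then have "b' \<tau> = (\<lambda>_. 0)" by auto
        with nz show False by (simp add: mapply_def split: if_splits)
      qed
      then obtain t where "b' \<tau> t \<noteq> 0" by blast
      then show "\<tau> \<subseteq> V \<and> card \<tau> = Suc (Suc p)" using chain_b' unfolding chain_def by blast
    qed
  next
    fix \<tau> s
    have "bd V (\<lambda>\<sigma>. ?A (b' \<sigma>) s) \<tau> = ?A (\<lambda>t. u \<tau> t - w \<tau> t) s"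
      by (simp add: bd_mapply b')
    also have "\<dots> = z \<tau> s"
      using w(1)[of \<tau>] u(3)[of \<tau>] by (simp add: mapply_diff mker_def)
    finally show "bd V (\<lambda>\<sigma>. ?A (b' \<sigma>) s) \<tau> = z \<tau> s" .
  qed
qed

lemma acyclic_at_0_zero:
  fixes A :: "nat \<Rightarrow> nat \<Rightarrow> ('x, 'b::field) polynomials"
  shows "acyclic_at V e 0 d (mimage (length e) 0 A)"
  unfolding acyclic_at_def
proof (intro allI impI exI[of _ "\<lambda>_ _. 0"] conjI)
  fix z :: "'x set \<Rightarrow> nat \<Rightarrow> ('x, 'b) polynomials" and \<tau> s
  assume "\<forall>\<tau>. z \<tau> \<in> mimage (length e) 0 A"
  then have "z \<tau> \<in> mimage (length e) 0 A" by blast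
  then have "z \<tau> s = 0" by (auto simp: mimage_def mapply_def)
  then show "bd V (\<lambda>\<sigma>. 0) \<tau> = z \<tau> s" by simp
qed (auto simp: zero_in_mimage chain_def)

text \<open>If \<open>d\<close> is not a shift, a lift of degree \<open>d\<close> has no constant
  entries. Its image is then a combination of multiples of variables, that is, a boundary.\<close>

lemma acyclic_at_0:
  assumes A: "hmat e e' A" and d: "d \<notin> set e'"
  shows "acyclic_at UNIV e 0 d (mimage (length e) (length e') A)"
  unfolding acyclic_at_def
proof (intro allI impI)
  let ?A = "mapply (length e) (length e') A"
  fix z assume z: "\<forall>\<tau>. z \<tau> \<in> mimage (length e) (length e') A" "\<forall>s. chain UNIV 0 (\<lambda>\<tau>. z \<tau> s)"
    "\<forall>\<tau>. hvec e (d - int 0) (z \<tau>)"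
  obtain u where u: "u \<in> fvecs (length e')" "hvec e' d u" "?A u = z {}"
    using homogeneous_lift[OF A, of d "z {}"] z by auto
  have "\<exists>q. u t = (\<Sum>x\<in>UNIV. Var x * q x)" for t
  proof (rule irrelevant_decomp)
    show "lookup (u t) 0 = 0"
    proof (rule ccontr)
      assume *: "lookup (u t) 0 \<noteq> 0"
      with u(1) have t: "t < length e'" by (auto simp: fvecs_def not_le[symmetric])
      then have "homogeneous (d - e' ! t) (u t)" using u(2) by (simp add: hvec_def)
      with * have "int 0 = d - e' ! t" unfolding homogeneous_def
        by (metis in_keys_iff monom_degree_zero)
      with d t show False by auto
    qed
  qed blast
  then obtain q where q: "\<And>t. u t = (\<Sum>x\<in>UNIV. Var x * q t x)" by metis
  \<comment> \<open>At the singleton of \<open>x\<close> stands the image of the cofactors of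
    \<open>x\<close>.\<close>
  define w where "w = (\<lambda>\<sigma> s. if card \<sigma> = 1 then ?A (\<lambda>t. if t < length e' then q t (the_elem \<sigma>) else 0) s else 0)"
  have bd_w: "bd UNIV (\<lambda>\<sigma>. w \<sigma> s) \<tau> = z \<tau> s" for \<tau> s
  proof (cases "\<tau> = {}")
    case True
    have "bd UNIV (\<lambda>\<sigma>. w \<sigma> s) \<tau> = (\<Sum>x\<in>UNIV. Var x * ?A (\<lambda>t. q t x) s)"
      by (simp add: bd_def contr_def True sg_def w_def mapply_def cong: if_cong)
    also have "\<dots> = ?A u s"
    proof (cases "s < length e")
      case True
      have "(\<Sum>x\<in>UNIV. Var x * ?A (\<lambda>t. q t x) s) = (\<Sum>x\<in>UNIV. \<Sum>t<length e'. A s t * (Var x * q t x))"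
        using True by (simp only: mapply_def if_True sum_distrib_left mult.left_commute)
      also have "\<dots> = ?A u s"
        using True by (simp only: mapply_def if_True sum_distrib_left q) (rule sum.swap)
      finally show ?thesis .
    qed (simp add: mapply_def)
    finally show ?thesis by (simp add: u True)
  next
    case False
    then have "z \<tau> s = 0" using z(2) unfolding chain_def by (metis card_0_eq finite)
    moreover have "contr x (\<lambda>\<sigma>. w \<sigma> s) \<tau> = 0" for x
      using False by (simp add: contr_def w_def)
    ultimately show ?thesis by (simp add: bd_def)
  qed
  have "w \<tau> \<in> mimage (length e) (length e') A" for \<tau>
  proof (cases "card \<tau> = 1")
    case True
    then have "w \<tau> = ?A (\<lambda>t. if t < length e' then q t (the_elem \<tau>) else 0)"
      by (auto simp: w_def)
    then show ?thesis unfolding mimage_def by (simp add: fvecs_def)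
  next
    case False
    then have "w \<tau> = (\<lambda>_. 0)" by (auto simp: w_def)
    then show ?thesis by (simp add: zero_in_mimage)
  qed
  moreover have "chain UNIV (Suc 0) (\<lambda>\<tau>. w \<tau> s)" for s
    by (simp add: chain_def w_def)
  ultimately show "\<exists>w. (\<forall>\<tau>. w \<tau> \<in> mimage (length e) (length e') A) \<and>
      (\<forall>s. chain UNIV (Suc 0) (\<lambda>\<tau>. w \<tau> s)) \<and> (\<forall>\<tau> s. bd UNIV (\<lambda>\<sigma>. w \<sigma> s) \<tau> = z \<tau> s)"
    using bd_w by blast
qed

text \<open>Going down from step \<open>i\<close> to step 0, each syzygy step lowers the index in
  the resolution and raises the homological degree by one.\<close>

lemma acyclic_at_resolution:
  assumes A: "\<And>i. hmat (e i) (e (Suc i)) (A i)"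
    and exact: "\<And>i. mker (length (e i)) (length (e (Suc i))) (A i) =
      mimage (length (e (Suc i))) (length (e (Suc (Suc i)))) (A (Suc i))"
    and top: "acyclic_at V (e i) 0 d (mimage (length (e i)) (length (e (Suc i))) (A i))"
  shows "acyclic_at V (e 0) i d (mimage (length (e 0)) (length (e (Suc 0))) (A 0))"
proof -
  have "j \<le> i \<Longrightarrow> acyclic_at V (e (i - j)) j d (mimage (length (e (i - j))) (length (e (Suc (i - j)))) (A (i - j)))" for j
  proof (induction j)
    case (Suc j)
    define l where "l = i - Suc j"
    have l: "i - j = Suc l" using Suc.prems by (simp add: l_def)
    from Suc have "acyclic_at V (e (Suc l)) j d (mker (length (e l)) (length (e (Suc l))) (A l))"
      by (simp add: exact l)
    from acyclic_at_syzygy[OF A this] show ?case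
      by (simp add: l_def)
  qed (use top in simp)
  from this[of i] show ?thesis by simp
qed

end

section \<open>Minimal generators of graded submodules\<close>

text \<open>A monotone subsequence always exists; a decreasing one is constant from its minimum
  on.\<close>

lemma incseq_subseq:
  fixes f :: "nat \<Rightarrow> nat"
  shows "\<exists>r. strict_mono r \<and> incseq (\<lambda>n. f (r n))"
proof -
  obtain r where r: "strict_mono (r :: nat \<Rightarrow> nat)" "monoseq (\<lambda>n. f (r n))"
    using seq_monosub by blast
  consider "incseq (\<lambda>n. f (r n))" | "decseq (\<lambda>n. f (r n))"
    using r(2) by (auto simp: monoseq_iff)
  then show ?thesis
  proof cases
    case 2
    obtain N where N: "\<And>n. f (r N) \<le> f (r n)"
      using ex_has_least_nat[of "\<lambda>_. True" _ "\<lambda>n. f (r n)"] by blast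
    have "f (r (N + n)) = f (r N)" for n
      using N[of "N + n"] decseqD[OF 2, of N "N + n"] by simp
    then have "incseq (\<lambda>n. f (r (N + n)))" by (simp add: incseq_def)
    moreover have "strict_mono (\<lambda>n. r (N + n))"
      using r(1) by (auto simp: strict_mono_def)
    ultimately show ?thesis by (intro exI[of _ "\<lambda>n. r (N + n)"]) simp
  qed (use r in blast)
qed

text \<open>Dickson's lemma, by passing to a subsequence for each coordinate in turn.\<close>

lemma dickson_subseq:
  fixes f :: "nat \<Rightarrow> 'c \<Rightarrow> nat"
  assumes "finite U"
  shows "\<exists>r. strict_mono r \<and> (\<forall>x\<in>U. incseq (\<lambda>n. f (r n) x))"
  using assms
proof (induction U rule: finite_induct)
  case empty
  show ?case by (rule exI[of _ id]) (simp add: strict_mono_def)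
next
  case (insert x U)
  then obtain r where r: "strict_mono r" "\<forall>x\<in>U. incseq (\<lambda>n. f (r n) x)" by blast
  obtain q where q: "strict_mono q" "incseq (\<lambda>n. f (r (q n)) x)"
    using incseq_subseq[of "\<lambda>n. f (r n) x"] by blast
  have "incseq (\<lambda>n. f (r (q n)) y)" if "y \<in> U" for y
    using r(2) that strict_mono_mono[OF q(1)] by (simp add: incseq_def mono_def)
  moreover have "strict_mono (\<lambda>n. r (q n))"
    using r(1) q(1) by (simp add: strict_mono_def)
  ultimately show ?case using q(2) by (intro exI[of _ "\<lambda>n. r (q n)"]) simp
qed

lemma finite_monom_degree: "finite {m :: 'x::finite \<Rightarrow>\<^sub>0 nat. monom_degree m = k}"
proof (rule finite_imageD)
  have "lookup ` {m :: 'x \<Rightarrow>\<^sub>0 nat. monom_degree m = k} \<subseteq> PiE UNIV (\<lambda>_. {..k})"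
    using member_le_sum[of _ "UNIV :: 'x set"] by (fastforce simp: monom_degree_def)
  then show "finite (lookup ` {m :: 'x \<Rightarrow>\<^sub>0 nat. monom_degree m = k})"
    by (rule finite_subset) (simp add: finite_PiE)
  show "inj_on lookup {m :: 'x \<Rightarrow>\<^sub>0 nat. monom_degree m = k}"
    by (auto simp: inj_on_def intro: poly_mapping_eqI)
qed

section \<open>Graded submodules of free modules\<close>

definition graded_submodule :: "int list \<Rightarrow> (nat \<Rightarrow> ('x::finite, 'k::field) polynomials) set \<Rightarrow> bool" where
  "graded_submodule e M \<longleftrightarrow> M \<subseteq> fvecs (length e) \<and> (\<lambda>_. 0) \<in> M \<and>
     (\<forall>u\<in>M. \<forall>v\<in>M. (\<lambda>s. u s + v s) \<in> M) \<and> (\<forall>c. \<forall>v\<in>M. (\<lambda>s. c * v s) \<in> M) \<and>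
     (\<forall>v\<in>M. \<forall>d. hcompv e d v \<in> M)"

lemma graded_submoduleD:
  assumes "graded_submodule e M"
  shows "M \<subseteq> fvecs (length e)" "(\<lambda>_. 0) \<in> M"
    "u \<in> M \<Longrightarrow> v \<in> M \<Longrightarrow> (\<lambda>s. u s + v s) \<in> M"
    "v \<in> M \<Longrightarrow> (\<lambda>s. c * v s) \<in> M"
    "v \<in> M \<Longrightarrow> hcompv e d v \<in> M"
  using assms by (simp_all add: graded_submodule_def)

lemma graded_submodule_sum:
  assumes "graded_submodule e M" "\<And>i. i \<in> A \<Longrightarrow> v i \<in> M"
  shows "(\<lambda>s. \<Sum>i\<in>A. c i * v i s) \<in> M"
  using assms(2)
proof (induction A rule: infinite_finite_induct)
  case (insert a A)
  then have "(\<lambda>s. c a * v a s + (\<Sum>i\<in>A. c i * v i s)) \<in> M"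
    by (intro graded_submoduleD[OF assms(1)]) auto
  then show ?case using insert.hyps by simp
qed (use graded_submoduleD(2)[OF assms(1)] in simp_all)

lemma graded_submodule_mker:
  assumes "hmat e e' A" shows "graded_submodule e' (mker (length e) (length e') A)"
  unfolding graded_submodule_def
proof (intro conjI ballI allI)
  fix u v assume "u \<in> mker (length e) (length e') A" "v \<in> mker (length e) (length e') A"
  then show "(\<lambda>s. u s + v s) \<in> mker (length e) (length e') A"
    by (auto simp: mker_def fvecs_def mapply_def fun_eq_iff distrib_left sum.distrib split: if_splits)
next
  fix c v assume v: "v \<in> mker (length e) (length e') A"
  have "mapply (length e) (length e') A (\<lambda>s. c * v s) = (\<lambda>s. c * mapply (length e) (length e') A v s)"
    by (simp add: mapply_def sum_distrib_left mult.left_commute fun_eq_iff)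
  with v show "(\<lambda>s. c * v s) \<in> mker (length e) (length e') A"
    by (simp add: mker_def fvecs_def)
next
  fix v d assume v: "v \<in> mker (length e) (length e') A"
  then show "hcompv e' d v \<in> mker (length e) (length e') A"
    by (simp add: mker_def hcompv_in_fvecs mapply_hcompv[OF assms]) (simp add: hcompv_def fun_eq_iff)
qed (auto simp: mker_def fvecs_def mapply_def)

lemma sum_hcompv:
  assumes "v \<in> fvecs (length e)"
  obtains D where "finite D" "v = (\<lambda>s. \<Sum>d\<in>D. hcompv e d v s)"
proof
  define D where "D = (\<Union>s<length e. (\<lambda>m. int (monom_degree m) + e ! s) ` keys (v s))"
  show D: "finite D" by (simp add: D_def)
  show "v = (\<lambda>s. \<Sum>d\<in>D. hcompv e d v s)"
  proof (rule ext, rule poly_mapping_eqI)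
    fix s m
    show "lookup (v s) m = lookup (\<Sum>d\<in>D. hcompv e d v s) m"
    proof (cases "s < length e")
      case True
      have "lookup (\<Sum>d\<in>D. hcompv e d v s) m =
          (\<Sum>d\<in>D. if d = int (monom_degree m) + e ! s then lookup (v s) m else 0)"
        unfolding lookup_sum using True by (intro sum.cong) (auto simp: hcompv_def)
      also have "\<dots> = (if int (monom_degree m) + e ! s \<in> D then lookup (v s) m else 0)"
        using D by simp
      also have "int (monom_degree m) + e ! s \<in> D" if "m \<in> keys (v s)"
        using True that unfolding D_def by blast
      then have "(if int (monom_degree m) + e ! s \<in> D then lookup (v s) m else 0) = lookup (v s) m"
        by (auto simp: in_keys_iff)
      finally show ?thesis by simp
    qed (use assms in \<open>simp add: lookup_sum hcompv_def fvecs_def\<close>)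
  qed
qed

text \<open>For infinite \<open>G\<close> the sum is 0 by convention; statements on generation carry
  finiteness separately.\<close>

definition fspan :: "('a \<Rightarrow> 'r::comm_ring_1) set \<Rightarrow> ('a \<Rightarrow> 'r) set" where
  "fspan G = {\<lambda>s. \<Sum>g\<in>G. c g * g s | c. True}"

lemma fspan_add: "u \<in> fspan G \<Longrightarrow> v \<in> fspan G \<Longrightarrow> (\<lambda>s. u s + v s) \<in> fspan G"
  unfolding fspan_def
  by (clarsimp, rule_tac x = "\<lambda>g. c g + ca g" in exI) (simp add: distrib_right sum.distrib)

lemma fspan_base:
  assumes "finite G" "g \<in> G" shows "(\<lambda>s. c * g s) \<in> fspan G"
proof -
  have "c * g s = (\<Sum>h\<in>G. (if h = g then c else 0) * h s)" for s
    using assms by (simp add: if_distrib[of "\<lambda>a. a * _"] cong: if_cong)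
  then show ?thesis unfolding fspan_def by auto
qed

lemma fspan_sum:
  assumes "finite A" "\<And>i. i \<in> A \<Longrightarrow> u i \<in> fspan G"
  shows "(\<lambda>s. \<Sum>i\<in>A. u i s) \<in> fspan G"
  using assms
proof (induction A rule: finite_induct)
  case empty
  show ?case by (simp add: fspan_def) (rule exI[of _ "\<lambda>_. 0"], simp)
next
  case (insert a A)
  then have "(\<lambda>s. u a s + (\<lambda>s. \<Sum>i\<in>A. u i s) s) \<in> fspan G"
    by (intro fspan_add) auto
  with insert.hyps show ?case by simp
qed

section \<open>Finite generation by means of leading terms\<close>

context koszul
begin

text \<open>The monomial order of the free module: terms are compared first by position.\<close>

definition mterm :: "nat \<Rightarrow> ('x \<Rightarrow>\<^sub>0 nat) \<Rightarrow> nat \<Rightarrow>\<^sub>0 nat" where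
  "mterm s m = single 0 s + (\<Sum>x\<in>UNIV. single (Suc (idx x)) (lookup m x))"

lemma lookup_mterm: "lookup (mterm s m) 0 = s" "lookup (mterm s m) (Suc (idx x)) = lookup m x"
proof -
  show "lookup (mterm s m) 0 = s"
    by (simp add: mterm_def lookup_add lookup_sum lookup_single)
  have "lookup (mterm s m) (Suc (idx x)) = (\<Sum>y\<in>UNIV. if y = x then lookup m x else 0)"
    unfolding mterm_def lookup_add lookup_sum
    using inj_eq[OF inj_idx] by (simp add: lookup_single when_def cong: if_cong)
  then show "lookup (mterm s m) (Suc (idx x)) = lookup m x" by simp
qed

lemma mterm_inj: "mterm s m = mterm s' m' \<Longrightarrow> s = s' \<and> m = m'"
  by (metis lookup_mterm poly_mapping_eqI)

text \<open>Multiplication by a monomial becomes addition, which is monotone for the lexicographic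
  order on finitely supported functions.\<close>

lemma mterm_add: "mterm s (m + n) = mterm s m + mterm 0 n"
  by (simp add: mterm_def lookup_add single_add sum.distrib add.assoc)

definition leading :: "nat \<Rightarrow> (nat \<Rightarrow> ('x, 'k::field) polynomials) \<Rightarrow> nat \<Rightarrow> ('x \<Rightarrow>\<^sub>0 nat) \<Rightarrow> bool" where
  "leading r v s m \<longleftrightarrow> s < r \<and> m \<in> keys (v s) \<and> (\<forall>s'<r. \<forall>m'\<in>keys (v s'). mterm s' m' \<le> mterm s m)"

lemma leading_exists:
  assumes "v \<in> fvecs r" "v \<noteq> (\<lambda>_. 0)"
  shows "\<exists>s m. leading r v s m"
proof -
  define T where "T = (\<Union>s<r. mterm s ` keys (v s))"
  have "finite T" by (simp add: T_def)
  moreover have "T \<noteq> {}"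
  proof -
    obtain s where "v s \<noteq> 0" using assms(2) by auto
    moreover from this have "s < r" using assms(1) by (auto simp: fvecs_def not_le[symmetric])
    ultimately show ?thesis by (auto simp: T_def)
  qed
  ultimately have "Max T \<in> T" "\<And>t. t \<in> T \<Longrightarrow> t \<le> Max T" by auto
  moreover from this(1) obtain s m where "Max T = mterm s m" "s < r" "m \<in> keys (v s)"
    by (auto simp: T_def)
  moreover have "mterm s' m' \<in> T" if "s' < r" "m' \<in> keys (v s')" for s' m'
    using that by (auto simp: T_def)
  ultimately show ?thesis unfolding leading_def by metis
qed

text \<open>No term of either summand exceeds \<open>mterm s m\<close>, since multiplication by the
  monomial \<open>l\<close> preserves the order, and the coefficient at this term cancels.\<close>

lemma leading_cancel:
  assumes v: "leading r v s m" "lookup (v s) m = a"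
    and u: "leading r u s n" "lookup (u s) n = b" and m: "m = n + l"
    and w: "w = (\<lambda>t. v t + single l (- (a / b)) * u t)" and w': "leading r w s' m'"
  shows "mterm s' m' < mterm s m"
proof -
  have b: "b \<noteq> 0" using u by (auto simp: leading_def in_keys_iff)
  have s': "s' < r" "m' \<in> keys (w s')" using w' by (auto simp: leading_def)
  have "mterm s' m' \<le> mterm s m"
  proof -
    consider "m' \<in> keys (v s')" | "m' \<in> keys (single l (- (a / b)) * u s')"
      using s'(2) keys_add[of "v s'"] unfolding w by blast
    then show ?thesis
    proof cases
      case 1
      with v(1) s'(1) show ?thesis by (auto simp: leading_def)
    next
      case 2
      then obtain n' where n': "m' = l + n'" "n' \<in> keys (u s')" by (rule keys_single_mult)
      then have "mterm s' n' \<le> mterm s n" using u(1) s'(1) by (auto simp: leading_def)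
      then have "mterm s' n' + mterm 0 l \<le> mterm s n + mterm 0 l" by (rule add_right_mono)
      then show ?thesis by (simp add: n' m add.commute[of l] flip: mterm_add)
    qed
  qed
  moreover have "mterm s' m' \<noteq> mterm s m"
  proof
    assume "mterm s' m' = mterm s m"
    then have eq: "s' = s" "m' = m" using mterm_inj by blast+
    have "lookup (w s) m = a + (- (a / b)) * b"
      using lookup_single_mult[of l "- (a / b)" "u s" n] v(2) u(2)
      by (simp add: w lookup_add m add.commute)
    then have "lookup (w s) m = 0" using b by simp
    with s'(2) eq show False by (simp add: in_keys_iff)
  qed
  ultimately show ?thesis by simp
qed

text \<open>Otherwise homogeneous elements \<open>f n\<close> are chosen outside the span of the
  earlier ones, each with smallest leading term among the candidates of its degree. By Dickson's
  lemma the leading term of some \<open>f i\<close> divides that of a later \<open>f j\<close>, and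
  reducing \<open>f j\<close> by \<open>f i\<close> gives a candidate with smaller leading
  term.\<close>

lemma finitely_generated:
  fixes M :: "(nat \<Rightarrow> ('x, 'k::field) polynomials) set"
  assumes M: "graded_submodule e M"
  shows "\<exists>G. finite G \<and> G \<subseteq> M \<and> (\<forall>g\<in>G. \<exists>d. hvec e d g) \<and> M \<subseteq> fspan G"
proof (rule ccontr)
  let ?r = "length e"
  assume nfg: "\<nexists>G. finite G \<and> G \<subseteq> M \<and> (\<forall>g\<in>G. \<exists>d. hvec e d g) \<and> M \<subseteq> fspan G"
  define new where "new G v \<longleftrightarrow> v \<in> M \<and> v \<notin> fspan G" for G v
  \<comment> \<open>Leading terms are compared within one degree \<open>d\<close> only, where
    finitely many terms are available, so that a minimum exists.\<close>
  define good where "good G v \<longleftrightarrow> (\<exists>d s m. new G v \<and> hvec e d v \<and> leading ?r v s m \<and>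
     (\<forall>v' s' m'. new G v' \<longrightarrow> hvec e d v' \<longrightarrow> leading ?r v' s' m' \<longrightarrow> mterm s m \<le> mterm s' m'))" for G v
  have ex_good: "\<exists>v. good G v" if G: "finite G" "G \<subseteq> M" "\<forall>g\<in>G. \<exists>d. hvec e d g" for G
  proof -
    obtain v where v: "v \<in> M" "v \<notin> fspan G" using nfg G by blast
    then have "v \<in> fvecs ?r" using M by (auto simp: graded_submodule_def)
    then obtain D where D: "finite D" "v = (\<lambda>s. \<Sum>d\<in>D. hcompv e d v s)"
      by (rule sum_hcompv)
    \<comment> \<open>As \<open>v\<close> is the sum of its components, one of them lies outside the
      span.\<close>
    obtain d where d: "hcompv e d v \<notin> fspan G"
      using fspan_sum[OF D(1), of "\<lambda>d. hcompv e d v" G] D(2) v(2) by auto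
    define T where "T = {mterm s m |v' s m. new G v' \<and> hvec e d v' \<and> leading ?r v' s m}"
    have "T \<subseteq> (\<Union>s<?r. mterm s ` {m. monom_degree m = nat (d - e ! s)})"
    proof
      fix t assume "t \<in> T"
      then obtain s m v' where "t = mterm s m \<and> new G v' \<and> hvec e d v' \<and> leading ?r v' s m"
        unfolding T_def by auto
      then have t: "t = mterm s m" "hvec e d v'" "s < ?r" "m \<in> keys (v' s)"
        by (simp_all add: leading_def)
      then have "int (monom_degree m) = d - e ! s"
        unfolding hvec_def homogeneous_def by blast
      then have "monom_degree m = nat (d - e ! s)" by linarith
      with t show "t \<in> (\<Union>s<?r. mterm s ` {m. monom_degree m = nat (d - e ! s)})" by blast
    qed
    then have "finite T" by (rule finite_subset) (simp add: finite_monom_degree)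
    moreover have "T \<noteq> {}"
    proof -
      have "new G (hcompv e d v)"
        using d v(1) M by (auto simp: new_def graded_submodule_def)
      moreover have "hcompv e d v \<noteq> (\<lambda>_. 0)"
      proof
        assume "hcompv e d v = (\<lambda>_. 0)"
        moreover have "(\<lambda>_. 0) \<in> fspan G" using fspan_sum[of "{}"] by simp
        ultimately show False using d by simp
      qed
      ultimately show ?thesis
        using leading_exists[OF hcompv_in_fvecs[of e d v]] hvec_hcompv[of e d v] unfolding T_def
        by (metis (mono_tags, lifting) empty_iff mem_Collect_eq)
    qed
    ultimately have min: "Min T \<in> T" "\<And>t. t \<in> T \<Longrightarrow> Min T \<le> t" by auto
    from min(1) obtain v' s m where v': "Min T = mterm s m" "new G v'" "hvec e d v'" "leading ?r v' s m"
      unfolding T_def by auto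
    have "mterm s m \<le> mterm s' m''" if "new G v''" "hvec e d v''" "leading ?r v'' s' m''" for v'' s' m''
    proof -
      have "mterm s' m'' \<in> T" using that unfolding T_def by blast
      then show ?thesis using min(2) v'(1) by simp
    qed
    with v' show ?thesis unfolding good_def by blast
  qed
  have "\<exists>f :: nat \<Rightarrow> _. \<forall>n. good (f ` {..<n}) (f n)"
  proof (rule dependent_wellorder_choice)
    fix r and f g :: "nat \<Rightarrow> nat \<Rightarrow> ('x, 'k) polynomials" and n :: nat
    assume "\<And>y. y < n \<Longrightarrow> f y = g y"
    then have "f ` {..<n} = g ` {..<n}" by auto
    then show "good (f ` {..<n}) r = good (g ` {..<n}) r" by simp
  next
    fix n and f :: "nat \<Rightarrow> nat \<Rightarrow> ('x, 'k) polynomials"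
    assume "\<And>y. y < n \<Longrightarrow> good (f ` {..<y}) (f y)"
    then have "f y \<in> M \<and> (\<exists>d. hvec e d (f y))" if "y < n" for y
      using that unfolding good_def new_def by blast
    then show "\<exists>r. good (f ` {..<n}) r"
      by (intro ex_good) auto
  qed
  then obtain f where f: "\<And>n :: nat. good (f ` {..<n}) (f n)" by blast
  then have "\<forall>n. \<exists>d s m. new (f ` {..<n}) (f n) \<and> hvec e d (f n) \<and> leading ?r (f n) s m \<and>
     (\<forall>v' s' m'. new (f ` {..<n}) v' \<longrightarrow> hvec e d v' \<longrightarrow> leading ?r v' s' m' \<longrightarrow> mterm s m \<le> mterm s' m')"
    unfolding good_def by blast
  then obtain d where "\<forall>n. \<exists>s m. new (f ` {..<n}) (f n) \<and> hvec e (d n) (f n) \<and> leading ?r (f n) s m \<and>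
     (\<forall>v' s' m'. new (f ` {..<n}) v' \<longrightarrow> hvec e (d n) v' \<longrightarrow> leading ?r v' s' m' \<longrightarrow> mterm s m \<le> mterm s' m')"
    unfolding choice_iff by blast
  then obtain s m where *: "\<forall>n. new (f ` {..<n}) (f n) \<and> hvec e (d n) (f n) \<and> leading ?r (f n) (s n) (m n) \<and>
     (\<forall>v' s' m'. new (f ` {..<n}) v' \<longrightarrow> hvec e (d n) v' \<longrightarrow> leading ?r v' s' m' \<longrightarrow> mterm (s n) (m n) \<le> mterm s' m')"
    unfolding choice_iff by blast
  note fM = spec[OF *, THEN conjunct1] and fd = spec[OF *, THEN conjunct2, THEN conjunct1]
    and lead = spec[OF *, THEN conjunct2, THEN conjunct2, THEN conjunct1]
    and min = spec[OF *, THEN conjunct2, THEN conjunct2, THEN conjunct2, rule_format]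
  text \<open>Coordinates 0 and 1 force equal positions in Dickson's lemma.\<close>
  define h where "h n i = (if i = 0 then s n else if i = 1 then ?r - s n else lookup (mterm 0 (m n)) (i - 1))" for n i
  obtain r where r: "strict_mono r" "\<forall>i\<in>{0, 1} \<union> (\<lambda>x. idx x + 2) ` UNIV. incseq (\<lambda>n. h (r n) i)"
    using dickson_subseq[of "{0, 1} \<union> (\<lambda>x. idx x + 2) ` UNIV" h] by auto
  define i j where "i = r 0" and "j = r 1"
  have ij: "i < j" using r(1) by (simp add: i_def j_def strict_mono_def)
  have h: "h i k \<le> h j k" if "k \<in> {0, 1} \<union> (\<lambda>x. idx x + 2) ` UNIV" for k
    using bspec[OF r(2) that] by (simp add: i_def j_def incseq_def)
  have "s i < ?r" "s j < ?r" using lead by (auto simp: leading_def)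
  then have s: "s i = s j" using h[of 0] h[of 1] by (simp add: h_def)
  have "lookup (m i) x \<le> lookup (m j) x" for x
    using h[of "idx x + 2"] by (simp add: h_def lookup_mterm)
  then have m: "m j = m i + (m j - m i)" by (rule exponent_split)
  define l where "l = m j - m i"
  define a where "a = lookup (f j (s j)) (m j)"
  define b where "b = lookup (f i (s j)) (m i)"
  define c where "c = single l (- (a / b))"
  define w where "w = (\<lambda>t. f j t + c * f i t)"
  have fi: "f i \<in> f ` {..<j}" using ij by auto
  have "w \<in> M"
    using fM[of i] fM[of j] unfolding w_def new_def by (intro graded_submoduleD[OF M]) auto
  moreover have "w \<notin> fspan (f ` {..<j})"
  proof
    assume "w \<in> fspan (f ` {..<j})"
    from fspan_add[OF this fspan_base[OF _ fi, of "- c"]]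
    have "(\<lambda>s. w s + - c * f i s) \<in> fspan (f ` {..<j})" by simp
    moreover have "(\<lambda>s. w s + - c * f i s) = f j" by (simp add: w_def)
    ultimately show False using fM[of j] by (simp add: new_def)
  qed
  ultimately have w: "new (f ` {..<j}) w" by (simp add: new_def)
  have "int (monom_degree (m i)) = d i - e ! s i" "int (monom_degree (m j)) = d j - e ! s j"
    using lead fd unfolding leading_def hvec_def homogeneous_def by blast+
  then have l: "int (monom_degree l) = d j - d i"
    using arg_cong[OF m, of monom_degree] s by (simp add: l_def monom_degree_add)
  have hw: "hvec e (d j) w"
    unfolding hvec_def w_def
  proof (intro allI impI homogeneous_add)
    fix t assume t: "t < ?r"
    show "homogeneous (d j - e ! t) (f j t)" using fd t by (simp add: hvec_def)
    have "homogeneous (int (monom_degree l) + (d i - e ! t)) (c * f i t)"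
      unfolding c_def using fd t by (intro homogeneous_mult homogeneous_single) (simp add: hvec_def)
    moreover have "int (monom_degree l) + (d i - e ! t) = d j - e ! t" by (simp add: l)
    ultimately show "homogeneous (d j - e ! t) (c * f i t)" by metis
  qed
  have "w \<noteq> (\<lambda>_. 0)"
  proof
    assume "w = (\<lambda>_. 0)"
    moreover have "(\<lambda>_. 0) \<in> fspan (f ` {..<j})" using fspan_sum[of "{}"] by simp
    ultimately show False using w by (simp add: new_def)
  qed
  moreover have "w \<in> fvecs ?r" using \<open>w \<in> M\<close> M by (auto simp: graded_submodule_def)
  ultimately obtain s' m' where w': "leading ?r w s' m'" using leading_exists by blast
  have "mterm s' m' < mterm (s j) (m j)"
    by (rule leading_cancel[where u = "f i" and n = "m i" and l = l and a = a and b = b, OF lead])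
      (use lead[of i] s m w' in \<open>auto simp: a_def b_def l_def w_def c_def\<close>)
  with min[OF w hw w'] show False by simp
qed

end

section \<open>Minimal systems of generators and minimal resolutions\<close>

definition minimal_map :: "int list \<Rightarrow> int list \<Rightarrow> (nat \<Rightarrow> nat \<Rightarrow> ('x::finite, 'k::field) polynomials) \<Rightarrow> bool" where
  "minimal_map e e' A \<longleftrightarrow> hmat e e' A \<and>
     (\<forall>u \<in> mker (length e) (length e') A. \<forall>d. hvec e' d u \<longrightarrow> (\<forall>s. lookup (u s) 0 = 0))"

text \<open>A constant entry of a syzygy expresses one generator in terms of the others.\<close>

lemma drop_generator:
  fixes A :: "nat \<Rightarrow> nat \<Rightarrow> ('x::finite, 'k::field) polynomials"
  assumes A: "hmat e e' A" and u: "u \<in> mker (length e) (length e') A"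
    and s: "s < length e'" "u s = single 0 c" "c \<noteq> 0"
  shows "\<exists>e'' A'. length e'' < length e' \<and> hmat e e'' A' \<and>
     mimage (length e) (length e'') A' = mimage (length e) (length e') A"
proof -
  define n where "n = length e' - 1"
  \<comment> \<open>The enumeration of the indices below \<open>length e'\<close> that skips
    \<open>s\<close>.\<close>
  define f where "f t = (if t < s then t else Suc t)" for t
  have f: "bij_betw f {..<n} ({..<length e'} - {s})"
    unfolding bij_betw_def
  proof
    show "inj_on f {..<n}" by (auto simp: inj_on_def f_def split: if_splits)
    show "f ` {..<n} = {..<length e'} - {s}"
    proof (intro equalityI subsetI)
      fix t assume t: "t \<in> {..<length e'} - {s}"
      show "t \<in> f ` {..<n}"
      proof (cases "t < s")
        case True
        then show ?thesis using t s by (intro image_eqI[of _ _ t]) (auto simp: f_def n_def)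
      next
        case False
        then show ?thesis using t s by (intro image_eqI[of _ _ "t - 1"]) (auto simp: f_def n_def)
      qed
    qed (use s(1) in \<open>auto simp: f_def n_def split: if_splits\<close>)
  qed
  have ft: "f t < length e'" "f t \<noteq> s" if "t < n" for t
    using bij_betw_apply[OF f, of t] that by auto
  define e'' where "e'' = map (\<lambda>t. e' ! f t) [0..<n]"
  define A' where "A' q t = A q (f t)" for q t
  have len: "length e'' = n" by (simp add: e''_def)
  have key: "mapply (length e) (length e') A w = mapply (length e) n A' (\<lambda>t. if t < n then w (f t) else 0)"
    if "w s = 0" for w
  proof
    fix q
    have "(\<Sum>t<length e'. A q t * w t) = (\<Sum>t\<in>{..<length e'} - {s}. A q t * w t)"
      using that by (intro sum.mono_neutral_right) auto
    also have "\<dots> = (\<Sum>t<n. A q (f t) * w (f t))"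
      by (rule sum.reindex_bij_betw[OF f, symmetric])
    finally show "mapply (length e) (length e') A w q =
        mapply (length e) n A' (\<lambda>t. if t < n then w (f t) else 0) q"
      by (simp add: mapply_def A'_def)
  qed
  have "mimage (length e) n A' = mimage (length e) (length e') A"
  proof (intro equalityI subsetI)
    fix v assume "v \<in> mimage (length e) n A'"
    then obtain w where w: "v = mapply (length e) n A' w" "w \<in> fvecs n" by (auto simp: mimage_def)
    define w' where "w' t = (if t < s then w t else if t = s then 0 else w (t - 1))" for t
    have "(\<lambda>t. if t < n then w' (f t) else 0) = w"
      using w(2) by (auto simp: w'_def f_def fvecs_def fun_eq_iff)
    then have "v = mapply (length e) (length e') A w'"
      using key[of w'] w(1) by (simp add: w'_def)
    moreover have "w' \<in> fvecs (length e')"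
      using w(2) s(1) by (auto simp: w'_def fvecs_def n_def)
    ultimately show "v \<in> mimage (length e) (length e') A" by (simp add: mimage_def)
  next
    fix v assume "v \<in> mimage (length e) (length e') A"
    then obtain w where w: "v = mapply (length e) (length e') A w" by (auto simp: mimage_def)
    \<comment> \<open>The multiple of the syzygy that clears the coordinate \<open>s\<close> of
      \<open>w\<close> without changing its image.\<close>
    define k where "k = w s * single 0 (inverse c)"
    define w' where "w' t = w t - k * u t" for t
    have "k * u s = w s"
      using s(3) by (simp add: k_def s(2) mult.assoc mult_single)
    then have "w' s = 0" by (simp add: w'_def)
    have "mapply (length e) (length e') A w' q = v q - k * mapply (length e) (length e') A u q" for q
      by (simp add: mapply_def w'_def w right_diff_distrib sum_subtractf sum_distrib_left mult.left_commute)
    then have "v = mapply (length e) (length e') A w'"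
      using u by (simp add: mker_def fun_eq_iff)
    then have "v = mapply (length e) n A' (\<lambda>t. if t < n then w' (f t) else 0)"
      using key[of w'] \<open>w' s = 0\<close> by simp
    then show "v \<in> mimage (length e) n A'"
      by (simp add: mimage_def fvecs_def)
  qed
  moreover have "hmat e e'' A'"
    using A ft by (auto simp: hmat_def e''_def A'_def)
  ultimately show ?thesis
    using s(1) len by (intro exI[of _ e''] exI[of _ A']) (auto simp: n_def)
qed

lemma generators_exist:
  fixes M :: "(nat \<Rightarrow> ('x::finite, 'k::field) polynomials) set"
  assumes M: "graded_submodule e M"
  shows "\<exists>e' A. hmat e e' A \<and> mimage (length e) (length e') A = M"
proof -
  obtain idx :: "'x \<Rightarrow> nat" where "inj idx"
    using finite_imp_inj_to_nat_seg[of "UNIV :: 'x set"] by auto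
  then have "koszul idx" by unfold_locales
  from koszul.finitely_generated[OF this M] obtain G
    where G: "finite G" "G \<subseteq> M" "\<forall>g\<in>G. \<exists>d. hvec e d g" "M \<subseteq> fspan G" by blast
  from bchoice[OF G(3)] obtain dg where dg: "\<forall>g\<in>G. hvec e (dg g) g" ..
  obtain gs where gs: "set gs = G" "distinct gs" using finite_distinct_list[OF G(1)] by blast
  define A where "A s t = (gs ! t) s" for s t
  have gsM: "gs ! t \<in> M" "gs ! t \<in> G" if "t < length gs" for t
    using that gs(1) G(2) nth_mem by blast+
  have "hmat e (map dg gs) A"
    using dg gsM(2) by (auto simp: hmat_def A_def hvec_def)
  have app: "mapply (length e) (length gs) A u = (\<lambda>s. \<Sum>t<length gs. u t * (gs ! t) s)" for u
  proof
    fix s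
    show "mapply (length e) (length gs) A u s = (\<Sum>t<length gs. u t * (gs ! t) s)"
    proof (cases "s < length e")
      case False
      then have "(gs ! t) s = 0" if "t < length gs" for t
        using gsM(1)[OF that] graded_submoduleD(1)[OF M] by (auto simp: fvecs_def)
      then show ?thesis using False by (simp add: mapply_def)
    qed (simp add: mapply_def A_def mult.commute)
  qed
  have "mimage (length e) (length gs) A = M"
  proof (intro equalityI subsetI)
    fix v assume "v \<in> mimage (length e) (length gs) A"
    then show "v \<in> M"
      by (auto simp: mimage_def app intro!: graded_submodule_sum[OF M] gsM(1))
  next
    fix v assume "v \<in> M"
    then obtain c where v: "v = (\<lambda>s. \<Sum>g\<in>G. c g * g s)" using G(4) by (auto simp: fspan_def)
    have "bij_betw (\<lambda>t. gs ! t) {..<length gs} G"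
      using gs by (simp add: bij_betw_nth)
    from sum.reindex_bij_betw[OF this, where g = "\<lambda>g. c g * g _"]
    have "v = (\<lambda>s. \<Sum>t<length gs. c (gs ! t) * (gs ! t) s)"
      unfolding v by simp
    also have "\<dots> = mapply (length e) (length gs) A (\<lambda>t. if t < length gs then c (gs ! t) else 0)"
      by (simp add: app)
    finally show "v \<in> mimage (length e) (length gs) A"
      by (simp add: mimage_def fvecs_def)
  qed
  with \<open>hmat e (map dg gs) A\<close> show ?thesis by (intro exI[of _ "map dg gs"] exI[of _ A]) simp
qed

text \<open>A homogeneous generating system of smallest size is taken. An entry with constant term
  in a homogeneous syzygy is itself a constant, and then a generator could be dropped.\<close>

lemma minimal_generators_exist:
  fixes M :: "(nat \<Rightarrow> ('x::finite, 'k::field) polynomials) set"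
  assumes M: "graded_submodule e M"
  shows "\<exists>e' A. minimal_map e e' A \<and> mimage (length e) (length e') A = M"
proof -
  define gens where "gens p \<longleftrightarrow> hmat e (fst p) (snd p) \<and> mimage (length e) (length (fst p)) (snd p) = M" for p
  obtain p0 where "gens p0" using generators_exist[OF M] by (auto simp: gens_def)
  then obtain p where p: "gens p" "\<And>q. gens q \<Longrightarrow> length (fst p) \<le> length (fst q)"
    using ex_has_least_nat[of gens p0 "\<lambda>p. length (fst p)"] by blast
  obtain e' A where eA: "p = (e', A)" by fastforce
  have "lookup (u s) 0 = 0" if u: "u \<in> mker (length e) (length e') A" "hvec e' d u" for u d s
  proof (rule ccontr)
    assume nz: "lookup (u s) 0 \<noteq> 0"
    then have s: "s < length e'" using u(1) by (auto simp: mker_def fvecs_def not_le[symmetric])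
    then have hom: "homogeneous (d - e' ! s) (u s)" using u(2) by (simp add: hvec_def)
    have "0 \<in> keys (u s)" using nz by (simp add: in_keys_iff)
    then have "int (monom_degree (0 :: 'x \<Rightarrow>\<^sub>0 nat)) = d - e' ! s"
      using hom unfolding homogeneous_def by blast
    then have "monom_degree m = 0" if "m \<in> keys (u s)" for m
      using hom that unfolding homogeneous_def by fastforce
    then have "u s = single 0 (lookup (u s) 0)"
      by (intro poly_mapping_eqI) (auto simp: lookup_single when_def in_keys_iff monom_degree_eq_0_iff)
    from drop_generator[OF _ u(1) s this nz] obtain e'' A'
      where *: "length e'' < length e'" "hmat e e'' A'"
        "mimage (length e) (length e'') A' = mimage (length e) (length e') A"
      using p(1) by (auto simp: gens_def eA)
    then have "gens (e'', A')" using p(1) by (simp add: gens_def eA)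
    from p(2)[OF this] *(1) show False by (simp add: eA)
  qed
  then show ?thesis
    using p(1) by (intro exI[of _ e'] exI[of _ A]) (auto simp: minimal_map_def gens_def eA)
qed

lemma minimal_resolution_exists:
  fixes M :: "(nat \<Rightarrow> ('x::finite, 'k::field) polynomials) set"
  assumes M: "graded_submodule e\<^sub>0 M"
  shows "\<exists>e A. e 0 = e\<^sub>0 \<and> mimage (length e\<^sub>0) (length (e (Suc 0))) (A 0) = M \<and>
     (\<forall>i. hmat (e i) (e (Suc i)) (A i) \<and>
       mimage (length (e (Suc i))) (length (e (Suc (Suc i)))) (A (Suc i)) =
         mker (length (e i)) (length (e (Suc i))) (A i)) \<and>
     (\<forall>i. \<forall>s<length (e (Suc i)). \<forall>t<length (e (Suc (Suc i))). lookup (A (Suc i) s t) 0 = 0)"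
proof -
  \<comment> \<open>The recursion runs over the maps of the resolution, each with the shifts of its
    target and source; \<open>Q\<close> links consecutive maps.\<close>
  define P where "P n p = (case p of (e, e', A) \<Rightarrow> minimal_map e e' A \<and>
     (n = 0 \<longrightarrow> e = e\<^sub>0 \<and> mimage (length e) (length e') A = M))" for n :: nat and p
  define Q where "Q p q = (case p of (e, e', A) \<Rightarrow> case q of (d, d', B) \<Rightarrow>
     d = e' \<and> mimage (length d) (length d') B = mker (length e) (length e') A)"
    for p q :: "int list \<times> int list \<times> (nat \<Rightarrow> nat \<Rightarrow> ('x, 'k) polynomials)"
  have "\<exists>f. \<forall>n. P n (f n) \<and> Q (f n) (f (Suc n))"
  proof (rule dependent_nat_choice)
    show "\<exists>p. P 0 p"
      using minimal_generators_exist[OF M] by (auto simp: P_def)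
  next
    fix p and n :: nat assume "P n p"
    then obtain e e' A where p: "p = (e, e', A)" "minimal_map e e' A" by (cases p) (auto simp: P_def)
    then have "graded_submodule e' (mker (length e) (length e') A)"
      by (intro graded_submodule_mker) (simp add: minimal_map_def)
    from minimal_generators_exist[OF this] obtain e'' A' where
      "minimal_map e' e'' A'" "mimage (length e') (length e'') A' = mker (length e) (length e') A" by blast
    then show "\<exists>q. P (Suc n) q \<and> Q p q"
      by (intro exI[of _ "(e', e'', A')"]) (simp add: P_def Q_def p)
  qed
  then obtain f where f: "\<And>n. P n (f n)" "\<And>n. Q (f n) (f (Suc n))" by blast
  define e where "e n = fst (f n)" for n
  define A where "A n = snd (snd (f n))" for n
  have e': "fst (snd (f n)) = e (Suc n)" for n
    using f(2)[of n] by (auto simp: Q_def e_def split: prod.splits)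
  have fn: "f n = (e n, e (Suc n), A n)" for n
    using e'[of n] by (simp add: e_def A_def prod_eq_iff)
  have min: "minimal_map (e n) (e (Suc n)) (A n)" for n
    using f(1)[of n] by (simp add: P_def fn)
  have exact: "mimage (length (e (Suc n))) (length (e (Suc (Suc n)))) (A (Suc n)) =
      mker (length (e n)) (length (e (Suc n))) (A n)" for n
    using f(2)[of n] by (simp add: Q_def fn)
  have "lookup (A (Suc i) s t) 0 = 0"
    if s: "s < length (e (Suc i))" and t: "t < length (e (Suc (Suc i)))" for i s t
  proof -
    \<comment> \<open>Column \<open>t\<close> is a homogeneous syzygy of the preceding map, whose
      minimality excludes constant terms.\<close>
    define c where "c = mapply (length (e (Suc i))) (length (e (Suc (Suc i)))) (A (Suc i)) (\<lambda>t'. if t' = t then 1 else 0)"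
    have c: "c s = (if s < length (e (Suc i)) then A (Suc i) s t else 0)" for s
      using t by (simp add: c_def mapply_def if_distrib[of "\<lambda>a. _ * a"] cong: if_cong)
    have "c \<in> mker (length (e i)) (length (e (Suc i))) (A i)"
      unfolding exact[symmetric] c_def mimage_def using t by (auto simp: fvecs_def)
    moreover have "hvec (e (Suc i)) (e (Suc (Suc i)) ! t) c"
      using min[of "Suc i"] t by (simp add: hvec_def c minimal_map_def hmat_def)
    ultimately have "lookup (c s) 0 = 0"
      using min[of i] unfolding minimal_map_def by blast
    then show ?thesis using s by (simp add: c)
  qed
  moreover have "e 0 = e\<^sub>0" "mimage (length e\<^sub>0) (length (e (Suc 0))) (A 0) = M"
    using f(1)[of 0] by (auto simp: P_def fn)
  ultimately show ?thesis
    using min exact by (intro exI[of _ e] exI[of _ A]) (simp add: minimal_map_def)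
qed

section \<open>Koszul homology detects Betti numbers\<close>

definition vec_fun :: "'r::zero vec \<Rightarrow> nat \<Rightarrow> 'r" where
  "vec_fun v = (\<lambda>t. if t < dim_vec v then v $ t else 0)"

text \<open>An ideal as a submodule of the free module of rank one.\<close>

definition embed :: "'r::zero set \<Rightarrow> (nat \<Rightarrow> 'r) set" where
  "embed J = (\<lambda>p s. if s = 0 then p else 0) ` J"

lemma vec_fun_image: "vec_fun ` carrier_vec c = fvecs c"
proof (intro equalityI subsetI)
  fix u :: "nat \<Rightarrow> 'a" assume "u \<in> fvecs c"
  then have "u = vec_fun (vec c u)" by (auto simp: vec_fun_def fvecs_def fun_eq_iff)
  then show "u \<in> vec_fun ` carrier_vec c" by (rule image_eqI) simp
qed (auto simp: vec_fun_def fvecs_def)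

lemma inj_on_vec_fun: "inj_on vec_fun (carrier_vec c)"
proof (rule inj_onI)
  fix v w :: "'a vec" assume vw: "v \<in> carrier_vec c" "w \<in> carrier_vec c" "vec_fun v = vec_fun w"
  show "v = w"
  proof (rule eq_vecI)
    fix i assume "i < dim_vec w"
    moreover have "vec_fun v i = vec_fun w i" by (simp add: vw(3))
    ultimately show "v $ i = w $ i" using vw(1,2) by (simp add: vec_fun_def)
  qed (use vw in auto)
qed

lemma vec_fun_mult_mat_vec:
  assumes "D \<in> carrier_mat r c" "v \<in> carrier_vec c"
  shows "vec_fun (D *\<^sub>v v) = mapply r c (\<lambda>s t. D $$ (s, t)) (vec_fun v)"
  using assms by (auto simp: vec_fun_def mapply_def scalar_prod_def lessThan_atLeast0 intro!: sum.cong)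

lemma scalar_prod_mapply:
  assumes "g \<in> carrier_vec c" "v \<in> carrier_vec c"
  shows "mapply (Suc 0) c (\<lambda>s t. g $ t) (vec_fun v) = (\<lambda>s. if s = 0 then g \<bullet> v else 0)"
  using assms by (auto simp: vec_fun_def mapply_def scalar_prod_def lessThan_atLeast0 intro!: sum.cong)

lemma mimage_mat:
  assumes "D \<in> carrier_mat r c"
  shows "mimage r c (\<lambda>s t. D $$ (s, t)) = vec_fun ` {D *\<^sub>v w | w. w \<in> carrier_vec c}"
  unfolding mimage_def vec_fun_image[symmetric]
  using vec_fun_mult_mat_vec[OF assms] by (auto simp: image_iff) metis+

lemma mker_mat:
  assumes D: "D \<in> carrier_mat r c"
  shows "mker r c (\<lambda>s t. D $$ (s, t)) = vec_fun ` mat_kernel D"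
proof -
  have "mapply r c (\<lambda>s t. D $$ (s, t)) (vec_fun v) = (\<lambda>_. 0) \<longleftrightarrow> D *\<^sub>v v = 0\<^sub>v r"
    if "v \<in> carrier_vec c" for v
  proof -
    have "(\<lambda>_. 0) = vec_fun (0\<^sub>v r :: 'a vec)" by (auto simp: vec_fun_def)
    then show ?thesis
      using inj_on_eq_iff[OF inj_on_vec_fun, of "D *\<^sub>v v" r "0\<^sub>v r"] D that
      by (simp add: vec_fun_mult_mat_vec[symmetric])
  qed
  then show ?thesis
    using D unfolding mker_def vec_fun_image[symmetric] mat_kernel_def by auto
qed

lemma mimage_row:
  assumes "g \<in> carrier_vec c"
  shows "mimage (Suc 0) c (\<lambda>s t. g $ t) = embed {g \<bullet> v | v. v \<in> carrier_vec c}"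
  unfolding mimage_def vec_fun_image[symmetric] embed_def
  using scalar_prod_mapply[OF assms] by (auto simp: image_iff)

lemma mker_row:
  assumes "g \<in> carrier_vec c"
  shows "mker (Suc 0) c (\<lambda>s t. g $ t) = vec_fun ` {v \<in> carrier_vec c. g \<bullet> v = 0}"
proof -
  have "mapply (Suc 0) c (\<lambda>s t. g $ t) (vec_fun v) = (\<lambda>_. 0) \<longleftrightarrow> g \<bullet> v = 0"
    if "v \<in> carrier_vec c" for v
    using scalar_prod_mapply[OF assms that] by (auto simp: fun_eq_iff)
  then show ?thesis
    unfolding mker_def vec_fun_image[symmetric] by auto
qed

lemma mapply_cong:
  assumes "\<And>s t. s < r \<Longrightarrow> t < c \<Longrightarrow> A s t = B s t"
  shows "mapply r c A = mapply r c B"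
  using assms by (auto simp: mapply_def fun_eq_iff)

lemma inj_embed: "embed J = embed J' \<longleftrightarrow> J = J'"
proof -
  have "inj (\<lambda>(p :: 'a) s :: nat. if s = 0 then p else 0)"
    by (auto simp: inj_def fun_eq_iff)
  then show ?thesis unfolding embed_def by (rule inj_image_eq_iff)
qed

lemma minimal_graded_free_resolution_exists:
  fixes J :: "('x::finite, 'k::field) polynomials set"
  assumes "graded_submodule [0] (embed J)"
  shows "\<exists>sh g D. minimal_graded_free_resolution J g sh D"
proof -
  from minimal_resolution_exists[OF assms] obtain e A where e0: "e 0 = [0]"
    and img: "mimage (Suc 0) (length (e (Suc 0))) (A 0) = embed J"
    and hom: "\<And>i. hmat (e i) (e (Suc i)) (A i)"
    and exact: "\<And>i. mimage (length (e (Suc i))) (length (e (Suc (Suc i)))) (A (Suc i)) =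
         mker (length (e i)) (length (e (Suc i))) (A i)"
    and min: "\<And>i s t. s < length (e (Suc i)) \<Longrightarrow> t < length (e (Suc (Suc i))) \<Longrightarrow> lookup (A (Suc i) s t) 0 = 0"
    by auto
  \<comment> \<open>The constructed resolution has \<open>S\<close> itself in position 0: its first
    map becomes the row \<open>g\<close>, and all later data are shifted by one.\<close>
  define g where "g = vec (length (e (Suc 0))) (A 0 0)"
  define sh where "sh i = e (Suc i)" for i
  define D where "D i = mat (length (sh i)) (length (sh (Suc i))) (\<lambda>(s, t). A (Suc i) s t)" for i
  have g: "g \<in> carrier_vec (length (sh 0))" by (simp add: g_def sh_def)
  have D: "D i \<in> carrier_mat (length (sh i)) (length (sh (Suc i)))" for i by (simp add: D_def)
  have A0: "mapply (Suc 0) (length (sh 0)) (A 0) = mapply (Suc 0) (length (sh 0)) (\<lambda>s t. g $ t)"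
    by (rule mapply_cong) (simp add: g_def sh_def)
  have AS: "mapply (length (sh i)) (length (sh (Suc i))) (A (Suc i)) =
      mapply (length (sh i)) (length (sh (Suc i))) (\<lambda>s t. D i $$ (s, t))" for i
    by (rule mapply_cong) (simp add: D_def)
  have imD: "mimage (length (sh i)) (length (sh (Suc i))) (A (Suc i)) =
      vec_fun ` {D i *\<^sub>v w | w. w \<in> carrier_vec (length (sh (Suc i)))}" for i
    using mimage_mat[OF D] AS by (simp add: mimage_def)
  have kerD: "mker (length (sh i)) (length (sh (Suc i))) (A (Suc i)) = vec_fun ` mat_kernel (D i)" for i
    using mker_mat[OF D] AS by (simp add: mker_def)
  have "embed {g \<bullet> v | v. v \<in> carrier_vec (length (sh 0))} = embed J"
    unfolding img[symmetric] mimage_row[OF g, symmetric] by (simp add: mimage_def A0 flip: sh_def)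
  then have "{g \<bullet> v | v. v \<in> carrier_vec (length (sh 0))} = J" by (simp add: inj_embed)
  moreover have "{v \<in> carrier_vec (length (sh 0)). g \<bullet> v = 0} =
      {D 0 *\<^sub>v w | w. w \<in> carrier_vec (length (sh 1))}"
  proof (rule iffD1[OF inj_on_image_eq_iff[OF inj_on_vec_fun]])
    show "vec_fun ` {v \<in> carrier_vec (length (sh 0)). g \<bullet> v = 0} =
        vec_fun ` {D 0 *\<^sub>v w | w. w \<in> carrier_vec (length (sh 1))}"
      using exact[of 0] imD[of 0] unfolding mker_row[OF g, symmetric]
      by (simp add: mker_def e0 A0 flip: sh_def)
    show "{D 0 *\<^sub>v w | w. w \<in> carrier_vec (length (sh 1))} \<subseteq> carrier_vec (length (sh 0))"
      using D[of 0] by auto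
  qed auto
  moreover have "mat_kernel (D i) = {D (Suc i) *\<^sub>v w | w. w \<in> carrier_vec (length (sh (Suc (Suc i))))}" for i
  proof (rule iffD1[OF inj_on_image_eq_iff[OF inj_on_vec_fun]])
    show "vec_fun ` mat_kernel (D i) =
        vec_fun ` {D (Suc i) *\<^sub>v w | w. w \<in> carrier_vec (length (sh (Suc (Suc i))))}"
      using exact[of "Suc i"] imD[of "Suc i"] kerD[of i] by (simp flip: sh_def)
    show "mat_kernel (D i) \<subseteq> carrier_vec (length (sh (Suc i)))"
      using D[of i] by (auto simp: mat_kernel_def)
    show "{D (Suc i) *\<^sub>v w | w. w \<in> carrier_vec (length (sh (Suc (Suc i))))} \<subseteq> carrier_vec (length (sh (Suc i)))"
      using D[of "Suc i"] by auto
  qed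
  moreover have "homogeneous (sh 0 ! s) (g $ s)" if "s < length (sh 0)" for s
    using hom[of 0] that by (simp add: hmat_def e0 g_def sh_def)
  moreover have "homogeneous (sh (Suc i) ! t - sh i ! s) (D i $$ (s, t))"
    if "s < length (sh i)" "t < length (sh (Suc i))" for i s t
    using hom[of "Suc i"] that by (simp add: hmat_def D_def sh_def)
  moreover have "D i $$ (s, t) \<in> ideal_of (range Var)"
    if "s < length (sh i)" "t < length (sh (Suc i))" for i s t
  proof -
    have "lookup (D i $$ (s, t)) 0 = 0" using min that by (simp add: D_def sh_def)
    then have "\<exists>x. lookup m x \<noteq> 0" if "m \<in> keys (D i $$ (s, t))" for m
      using that by (metis in_keys_iff lookup_zero poly_mapping_eqI)
    then show ?thesis by (simp add: Vars_iff)
  qed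
  ultimately show ?thesis
    unfolding minimal_graded_free_resolution_def graded_free_resolution_def
    by (intro exI[of _ sh] exI[of _ g] exI[of _ D] conjI allI impI g D)
qed

section \<open>Nonvanishing of Betti numbers\<close>

context koszul
begin

text \<open>With \<open>S\<close> put in front of the resolution, dimension shifting leads to degree
  0 of the image of step \<open>i\<close>. There the homology vanishes if \<open>d\<close> is not a
  shift and all variables are used, or if step \<open>i\<close> is zero.\<close>

lemma acyclic_at_graded_free_resolution:
  fixes J :: "('x, 'k::field) polynomials set"
  assumes res: "graded_free_resolution J g sh D"
    and d: "d \<notin> set (sh i) \<and> V = UNIV \<or> sh i = []"
  shows "acyclic_at V [0] i d (embed J)"
proof -
  define e where "e j = (case j of 0 \<Rightarrow> [0] | Suc j \<Rightarrow> sh j)" for j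
  define A where "A j = (case j of 0 \<Rightarrow> \<lambda>s t. g $ t | Suc j \<Rightarrow> \<lambda>s t. D j $$ (s, t))" for j
  have e: "e 0 = [0]" "e (Suc j) = sh j" for j by (simp_all add: e_def)
  have A: "A 0 = (\<lambda>s t. g $ t)" "A (Suc j) = (\<lambda>s t. D j $$ (s, t))" for j by (simp_all add: A_def)
  note r = res[unfolded graded_free_resolution_def]
  note g = r[THEN conjunct1] and D = r[THEN conjunct2, THEN conjunct1, rule_format]
    and deg = r[THEN conjunct2, THEN conjunct2, THEN conjunct1]
      r[THEN conjunct2, THEN conjunct2, THEN conjunct2, THEN conjunct1]
  have hom: "hmat (e j) (e (Suc j)) (A j)" for j
    using deg by (cases j) (simp_all add: hmat_def e A)
  have exact: "mker (length (e j)) (length (e (Suc j))) (A j) =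
      mimage (length (e (Suc j))) (length (e (Suc (Suc j)))) (A (Suc j))" for j
  proof (cases j)
    case 0
    then show ?thesis using r by (simp add: e A mker_row[OF g] mimage_mat[OF D])
  next
    case (Suc j')
    then show ?thesis using r by (simp add: e A mker_mat[OF D] mimage_mat[OF D])
  qed
  have top: "acyclic_at V (e i) 0 d (mimage (length (e i)) (length (e (Suc i))) (A i))"
  proof (cases "sh i = []")
    case True
    then show ?thesis using acyclic_at_0_zero[of V "e i" d "A i"] by (simp add: e)
  next
    case False
    then show ?thesis using acyclic_at_0[OF hom[of i]] d by (simp add: e)
  qed
  have "mimage (length (e 0)) (length (e (Suc 0))) (A 0) = embed J"
    using r by (simp add: e A mimage_row[OF g])
  with acyclic_at_resolution[OF hom exact top] show ?thesis by (simp add: e)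
qed

text \<open>The Koszul criterion holds for every graded free resolution, hence for the one picked by
  the choice operator in \<open>betti\<close>.\<close>

lemma betti_nonzero:
  fixes J :: "('x, 'k::field) polynomials set"
  assumes "graded_submodule [0] (embed J)"
  shows "\<not> acyclic_at UNIV [0] i d (embed J) \<Longrightarrow> betti J i d \<noteq> 0"
    and "\<not> acyclic_at V [0] i d (embed J) \<Longrightarrow> \<exists>j. betti J i j \<noteq> 0"
proof -
  define sh where "sh = (SOME sh. \<exists>g D. minimal_graded_free_resolution J g sh D)"
  have "\<exists>g D. minimal_graded_free_resolution J g sh D"
    unfolding sh_def by (rule someI_ex[OF minimal_graded_free_resolution_exists[OF assms]])
  then obtain g D where res: "graded_free_resolution J g sh D"
    by (auto simp: minimal_graded_free_resolution_def)
  have betti: "betti J i j \<noteq> 0 \<longleftrightarrow> j \<in> set (sh i)" for j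
    by (simp add: betti_def sh_def count_list_0_iff)
  show "\<not> acyclic_at UNIV [0] i d (embed J) \<Longrightarrow> betti J i d \<noteq> 0"
    using acyclic_at_graded_free_resolution[OF res, of d i UNIV] betti by blast
  show "\<not> acyclic_at V [0] i d (embed J) \<Longrightarrow> \<exists>j. betti J i j \<noteq> 0"
    using acyclic_at_graded_free_resolution[OF res, of d i V] betti by fastforce
qed

end

lemma graded_submodule_embed:
  assumes J: "monomial_ideal J" shows "graded_submodule [0] (embed J)"
  unfolding graded_submodule_def
proof (intro conjI ballI allI)
  have S: "ideal.subspace J" using J by (simp add: monomial_ideal_def)
  show "embed J \<subseteq> fvecs (length [0])" by (auto simp: embed_def fvecs_def)
  show "(\<lambda>_. 0) \<in> embed J" using ideal.subspace_0[OF S] unfolding embed_def by (intro image_eqI[of _ _ 0]) auto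
  fix u assume "u \<in> embed J"
  then obtain p where p: "u = (\<lambda>s. if s = 0 then p else 0)" "p \<in> J" by (auto simp: embed_def)
  show "(\<lambda>s. u s + v s) \<in> embed J" if v: "v \<in> embed J" for v
  proof -
    obtain q where q: "v = (\<lambda>s. if s = 0 then q else 0)" "q \<in> J" using v by (auto simp: embed_def)
    show ?thesis unfolding embed_def
      by (rule image_eqI[of _ _ "p + q"]) (use p q ideal.subspace_add[OF S] in auto)
  qed
  show "(\<lambda>s. c * u s) \<in> embed J" for c
    unfolding embed_def by (rule image_eqI[of _ _ "c * p"]) (use p ideal.subspace_scale[OF S] in auto)
  show "hcompv [0] d u \<in> embed J" for d
    unfolding embed_def
  proof (rule image_eqI[of _ _ "hcomp d p"])
    show "hcompv [0] d u = (\<lambda>s. if s = 0 then hcomp d p else 0)" by (auto simp: hcompv_def p)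
    show "hcomp d p \<in> J"
      using p(2) by (subst (asm) (1) monomial_ideal_iff[OF J], subst monomial_ideal_iff[OF J]) (simp add: keys_mfilter)
  qed
qed

section \<open>Symbolic powers of squarefree monomial ideals\<close>

definition minimal_covers :: "('x::finite, 'k::field) polynomials set \<Rightarrow> 'x set set" where
  "minimal_covers I = {A. I \<subseteq> ideal_of (Var ` A) \<and> (\<forall>B. B \<subset> A \<longrightarrow> \<not> I \<subseteq> ideal_of (Var ` B))}"

lemma minimal_cover_below:
  assumes "I \<subseteq> ideal_of (Var ` A)"
  obtains B where "B \<in> minimal_covers I" "B \<subseteq> (A :: 'x::finite set)"
proof -
  from finite_has_minimal2[of "{B. I \<subseteq> ideal_of (Var ` B)}" A]
  obtain B where "I \<subseteq> ideal_of (Var ` B)" "B \<subseteq> A" "\<forall>C. I \<subseteq> ideal_of (Var ` C) \<longrightarrow> C \<subseteq> B \<longrightarrow> B = C"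
    using assms by auto
  then show ?thesis by (intro that[of B]) (auto simp: minimal_covers_def)
qed

text \<open>Otherwise the product of all variables outside \<open>A'\<close> lies in every prime of
  the family, but it never lies in the prime of \<open>A'\<close>.\<close>

lemma prime_above_Inter:
  fixes A' :: "'x::finite set"
  assumes "(\<Inter>A\<in>P. ideal_of (Var ` A) :: ('x, 'k::field) polynomials set) \<subseteq> ideal_of (Var ` A')"
  obtains A where "A \<in> P" "A \<subseteq> A'"
proof (rule ccontr)
  assume "\<not> thesis"
  then have nsub: "\<exists>x\<in>A. x \<notin> A'" if "A \<in> P" for A using that assms(1) \<open>\<And>A. A \<in> P \<Longrightarrow> A \<subseteq> A' \<Longrightarrow> thesis\<close> by blast
  define m where "m = exponents (\<lambda>x. if x \<in> A' then 0 else 1 :: nat)"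
  have "(single m 1 :: ('x, 'k) polynomials) \<in> ideal_of (Var ` A)" if "A \<in> P" for A
    using nsub[OF that] by (auto simp: Vars_iff m_def)
  then have "(single m 1 :: ('x, 'k) polynomials) \<in> ideal_of (Var ` A')" using assms by blast
  then show False by (auto simp: Vars_iff m_def)
qed

text \<open>The minimal covers already intersect in \<open>I\<close>. Any decomposition contains
  each of them, since it has a member below it, which equals it by minimality. So the irredundant
  decomposition is unique and the definite description is meaningful.\<close>

lemma symbolic_power_eq:
  fixes I :: "('x::finite, 'k::field) polynomials set"
  assumes I: "I = (\<Inter>A\<in>{A. I \<subseteq> ideal_of (Var ` A)}. ideal_of (Var ` A))"
  shows "symbolic_power I k = (\<Inter>A\<in>minimal_covers I. ideal_power (ideal_of (Var ` A)) k)"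
proof -
  let ?P = "\<lambda>A. ideal_of (Var ` A) :: ('x, 'k) polynomials set"
  have eq: "(\<Inter>A\<in>minimal_covers I. ?P A) = I"
  proof
    show "(\<Inter>A\<in>minimal_covers I. ?P A) \<subseteq> I"
    proof
      fix p assume p: "p \<in> (\<Inter>A\<in>minimal_covers I. ?P A)"
      have *: "p \<in> ?P A" if A: "I \<subseteq> ?P A" for A
      proof -
        obtain B where B: "B \<in> minimal_covers I" "B \<subseteq> A" by (rule minimal_cover_below[OF A])
        have "?P B \<subseteq> ?P A" by (rule ideal_of_mono) (use B(2) in blast)
        with p B(1) show ?thesis by blast
      qed
      have "p \<in> (\<Inter>A\<in>{A. I \<subseteq> ?P A}. ?P A)" by (rule INT_I) (rule *, simp)
      then show "p \<in> I" by (rule subsetD[OF equalityD2[OF I]])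
    qed
  qed (auto simp: minimal_covers_def)
  have "irredundant_primary_decomposition I P \<longleftrightarrow> P = minimal_covers I" for P
  proof
    assume P: "irredundant_primary_decomposition I P"
    have "minimal_covers I \<subseteq> P"
    proof
      fix A' assume A': "A' \<in> minimal_covers I"
      then have "(\<Inter>A\<in>P. ?P A) \<subseteq> ?P A'"
        using P unfolding irredundant_primary_decomposition_def minimal_covers_def by blast
      then obtain A where A: "A \<in> P" "A \<subseteq> A'" by (rule prime_above_Inter)
      then have "I \<subseteq> ?P A" using P unfolding irredundant_primary_decomposition_def by blast
      then have "A = A'" using A' A(2) unfolding minimal_covers_def by blast
      with A show "A' \<in> P" by simp
    qed
    then show "P = minimal_covers I"
      using P eq unfolding irredundant_primary_decomposition_def by (metis psubsetI)
  next
    assume P: "P = minimal_covers I"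
    have "I \<noteq> (\<Inter>A\<in>Q. ?P A)" if Q: "Q \<subset> P" for Q
    proof
      assume IQ: "I = (\<Inter>A\<in>Q. ?P A)"
      obtain A' where A': "A' \<in> minimal_covers I" "A' \<notin> Q" using Q P by blast
      then have "(\<Inter>A\<in>Q. ?P A) \<subseteq> ?P A'" unfolding IQ[symmetric] by (auto simp: minimal_covers_def)
      then obtain A where A: "A \<in> Q" "A \<subseteq> A'" by (rule prime_above_Inter)
      then have "I \<subseteq> ?P A" using IQ by blast
      then have "A = A'" using A' A(2) unfolding minimal_covers_def by blast
      with A A' show False by simp
    qed
    then show "irredundant_primary_decomposition I P"
      unfolding irredundant_primary_decomposition_def using eq P by simp
  qed
  then have "(THE P. irredundant_primary_decomposition I P) = minimal_covers I"
    by (intro the_equality) auto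
  then show ?thesis by (simp add: symbolic_power_def)
qed

section \<open>Weak homomorphisms\<close>

text \<open>The exponent vector of the generator \<open>u_\<phi>\<close>.\<close>

definition hom_exp :: "('v::finite \<Rightarrow> 'w::finite) \<Rightarrow> 'v \<times> 'w \<Rightarrow>\<^sub>0 nat" where
  "hom_exp \<phi> = (\<Sum>i\<in>UNIV. single (i, \<phi> i) 1)"

lemma lookup_hom_exp: "lookup (hom_exp \<phi>) (v, w) = (if \<phi> v = w then 1 else 0)"
proof -
  have "lookup (hom_exp \<phi>) (v, w) = (\<Sum>i\<in>UNIV. if i = v then (if \<phi> v = w then 1 else 0) else 0)"
    unfolding hom_exp_def lookup_sum by (intro sum.cong) (auto simp: lookup_single when_def)
  then show ?thesis by simp
qed

lemma hom_ideal_eq: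
  assumes "pverts G = UNIV"
  shows "hom_ideal G H = ideal_of {single (hom_exp \<phi>) 1 |\<phi>. \<phi> \<in> WHom G H}"
  by (simp add: hom_ideal_def assms Var_def prod_single hom_exp_def)

lemma monomial_ideal_hom_ideal:
  assumes "pverts G = UNIV"
  shows "monomial_ideal (hom_ideal G H)"
  unfolding hom_ideal_eq[OF assms]
  by (rule monomial_ideal_of) (auto split: if_splits intro!: ideal_of_base)

lemma hom_ideal_subset_prime:
  assumes "pverts G = UNIV"
  shows "(hom_ideal G H :: ('v::finite \<times> 'w::finite, 'k::field) polynomials set) \<subseteq> ideal_of (Var ` A) \<longleftrightarrow>
    (\<forall>\<phi>\<in>WHom G H. \<exists>i. (i, \<phi> i) \<in> A)" (is "?I \<subseteq> ?P \<longleftrightarrow> _")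
proof -
  have gen: "(single (hom_exp \<phi>) 1 :: ('v \<times> 'w, 'k) polynomials) \<in> ?P \<longleftrightarrow> (\<exists>i. (i, \<phi> i) \<in> A)" for \<phi>
    by (auto simp: Vars_iff lookup_hom_exp Bex_def split: if_splits)
  have "?I \<subseteq> ?P \<longleftrightarrow> {single (hom_exp \<phi>) 1 |\<phi>. \<phi> \<in> WHom G H} \<subseteq> ?P"
    unfolding hom_ideal_eq[OF assms]
  proof
    assume "ideal_of {single (hom_exp \<phi>) 1 |\<phi>. \<phi> \<in> WHom G H} \<subseteq> ?P"
    then show "{single (hom_exp \<phi>) 1 |\<phi>. \<phi> \<in> WHom G H} \<subseteq> ?P"
      by (rule order_trans[rotated]) (rule subsetI, erule ideal_of_base)
  qed (rule ideal_of_least[OF _ ideal_of_subspace])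
  also have "\<dots> \<longleftrightarrow> (\<forall>\<phi>\<in>WHom G H. \<exists>i. (i, \<phi> i) \<in> A)"
    using gen by auto
  finally show ?thesis .
qed

text \<open>For a monomial \<open>m\<close> of \<open>p\<close>, the variables not dividing
  \<open>m\<close> generate a prime without \<open>p\<close>, which therefore does not contain the
  ideal. So the support of some generator lies in that of \<open>m\<close>, and being squarefree the
  generator divides \<open>m\<close>.\<close>

lemma hom_ideal_eq_Inter:
  fixes G :: "'v::finite pair_pre_digraph" and H :: "'w::finite pair_pre_digraph"
  assumes G: "pverts G = UNIV"
  shows "(hom_ideal G H :: ('v \<times> 'w, 'k::field) polynomials set) =
    (\<Inter>A\<in>{A. (hom_ideal G H :: ('v \<times> 'w, 'k) polynomials set) \<subseteq> ideal_of (Var ` A)}. ideal_of (Var ` A))"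
    (is "?I = ?J")
proof
  show "?J \<subseteq> ?I"
  proof
    fix p assume p: "p \<in> ?J"
    have "single m 1 \<in> ?I" if m: "m \<in> keys p" for m
    proof -
      have "p \<notin> ideal_of (Var ` {x. lookup m x = 0})" using m by (auto simp: Vars_iff)
      with p have "\<not> ?I \<subseteq> ideal_of (Var ` {x. lookup m x = 0})" by blast
      then obtain \<phi> where \<phi>: "\<phi> \<in> WHom G H" "\<forall>i. lookup m (i, \<phi> i) \<noteq> 0"
        by (auto simp: hom_ideal_subset_prime[OF G])
      have "m = hom_exp \<phi> + (m - hom_exp \<phi>)"
      proof (rule exponent_split)
        fix x show "lookup (hom_exp \<phi>) x \<le> lookup m x"
          using \<phi>(2) by (cases x) (auto simp: lookup_hom_exp Suc_le_eq)
      qed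
      then have "single m 1 = single (hom_exp \<phi>) 1 * (single (m - hom_exp \<phi>) 1 :: ('v \<times> 'w, 'k) polynomials)"
        by (simp add: mult_single)
      also have "\<dots> \<in> ?I"
        unfolding hom_ideal_eq[OF G] by (intro ideal_of_mult2 ideal_of_base) (use \<phi> in auto)
      finally show ?thesis .
    qed
    then have "\<forall>m\<in>keys p. single m 1 \<in> ?I" by (rule ballI)
    then show "p \<in> ?I" by (rule iffD2[OF monomial_ideal_iff[OF monomial_ideal_hom_ideal[OF G]]])
  qed
qed blast

text \<open>The monomial is divisible by \<open>u_\<phi>\<close> times the \<open>k\<close>-th power
  of \<open>u_\<psi>\<close>, a product of \<open>Suc k\<close> generators.\<close>

lemma hom_ideal_power_monomial:
  assumes G: "pverts G = UNIV" and \<phi>: "\<phi> \<in> WHom G H" and \<psi>: "\<psi> \<in> WHom G H"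
    and m: "\<And>v w. (if \<phi> v = w then 1 else 0) + (if \<psi> v = w then k else 0) \<le> lookup m (v, w)"
  shows "(single m 1 :: ('v::finite \<times> 'w::finite, 'k::field) polynomials) \<in> ideal_power (hom_ideal G H) (Suc k)"
proof -
  let ?I = "hom_ideal G H :: ('v \<times> 'w, 'k) polynomials set"
  define g where "g i = (case i of 0 \<Rightarrow> hom_exp \<phi> | Suc _ \<Rightarrow> hom_exp \<psi>)" for i :: nat
  have sum: "(\<Sum>i<Suc k. g i) = hom_exp \<phi> + (\<Sum>i<k. hom_exp \<psi>)"
    by (subst sum.lessThan_Suc_shift) (simp add: g_def)
  have "(\<Prod>i<Suc k. single (g i) 1) \<in> ideal_power ?I (Suc k)"
  proof (rule ideal_power_prod)
    fix i
    show "single (g i) 1 \<in> ?I"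
      unfolding hom_ideal_eq[OF G] by (rule ideal_of_base) (use \<phi> \<psi> in \<open>auto simp: g_def split: nat.split\<close>)
  qed
  then have "single (sum g {..<Suc k}) 1 \<in> ideal_power ?I (Suc k)"
    by (simp only: prod_single)
  then have "single (sum g {..<Suc k}) 1 * single (m - sum g {..<Suc k}) 1 \<in> ideal_power ?I (Suc k)"
    unfolding ideal_power_def by (rule ideal_of_mult2)
  moreover have "m = sum g {..<Suc k} + (m - sum g {..<Suc k})"
  proof (rule exponent_split)
    fix x show "lookup (sum g {..<Suc k}) x \<le> lookup m x"
      using m[of "fst x" "snd x"] unfolding sum
      by (cases x) (auto simp: lookup_add lookup_sum lookup_hom_exp split: if_splits)
  qed
  ultimately show ?thesis by (simp only: mult_single mult_1_right)
qed

text \<open>Reachability in the symmetrized digraph is the equivalence relation generated by the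
  arcs, so the strongly connected components are its classes; \<open>rep\<close> picks one vertex of
  each.\<close>

lemma component_representatives:
  fixes G :: "'v::finite pair_pre_digraph"
  assumes "pverts G = UNIV"
  obtains rep where "\<And>v. rep (rep v) = rep v"
    "\<And>x y. rep x = rep y \<longleftrightarrow> (x, y) \<in> (parcs G \<union> (parcs G)\<inverse>)\<^sup>*"
    "card (range rep) = num_components G"
proof -
  define E where "E = (parcs G \<union> (parcs G)\<inverse>)\<^sup>*"
  define S where "S = with_proj (mk_symmetric (with_proj G))"
  have "arcs_ends S = parcs G \<union> (parcs G)\<inverse>"
    by (auto simp: S_def parcs_mk_symmetric)
  moreover have "verts S = UNIV" by (simp add: S_def assms)
  ultimately have reach: "u \<rightarrow>\<^sup>*\<^bsub>S\<^esub> v \<longleftrightarrow> (u, v) \<in> E" for u v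
    using rtrancl_consistent_rtrancl_on[of u v "parcs G \<union> (parcs G)\<inverse>" UNIV]
    by (auto simp: reachable_def E_def dest: rtrancl_on_rtranclI)
  have E: "equiv UNIV E"
    unfolding E_def by (intro equivI) (auto simp: refl_on_def intro: sym_rtrancl sym_Un_converse trans_rtrancl)
  have cl: "E `` {u} = E `` {v} \<longleftrightarrow> (u, v) \<in> E" for u v
    using eq_equiv_class_iff[OF E] by simp
  have "pre_digraph.sccs_verts S = range (\<lambda>u. E `` {u})"
  proof (intro equalityI subsetI)
    fix C assume "C \<in> pre_digraph.sccs_verts S"
    then have C: "C \<noteq> {}" "\<forall>u\<in>C. \<forall>v\<in>C. (u, v) \<in> E" "\<forall>u\<in>C. \<forall>v. v \<notin> C \<longrightarrow> (u, v) \<notin> E \<or> (v, u) \<notin> E"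
      by (simp_all add: pre_digraph.sccs_verts_def reach)
    then obtain u where "u \<in> C" by blast
    then have "C = E `` {u}" using C(2,3) E by (auto simp: equiv_def sym_def)
    then show "C \<in> range (\<lambda>u. E `` {u})" by blast
  next
    fix C assume "C \<in> range (\<lambda>u. E `` {u})"
    then obtain u where C: "C = E `` {u}" by blast
    have refl: "(u, u) \<in> E" using E by (simp add: equiv_def refl_on_def)
    have 1: "(v, w) \<in> E" if "(u, v) \<in> E" "(u, w) \<in> E" for v w
      using that E by (meson equivE symE transE)
    have 2: "(u, w) \<in> E" if "(u, v) \<in> E" "(v, w) \<in> E" for v w
      using that E by (meson equivE transE)
    have "C \<noteq> {}" using refl by (auto simp: C)
    moreover have "\<forall>v\<in>C. \<forall>w\<in>C. (v, w) \<in> E" using 1 by (simp add: C)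
    moreover have "\<forall>v\<in>C. \<forall>w. w \<notin> C \<longrightarrow> (v, w) \<notin> E \<or> (w, v) \<notin> E"
      using 2 by (simp add: C) blast
    ultimately show "C \<in> pre_digraph.sccs_verts S"
      by (simp add: pre_digraph.sccs_verts_def reach)
  qed
  then have num: "num_components G = card (range (\<lambda>u. E `` {u}))"
    by (simp add: num_components_def S_def)
  define rep where "rep u = (SOME v. v \<in> E `` {u})" for u
  have rep_E: "(u, rep u) \<in> E" for u
  proof -
    have "u \<in> E `` {u}" using E by (simp add: equiv_def refl_on_def)
    then have "rep u \<in> E `` {u}" unfolding rep_def by (rule someI)
    then show ?thesis by simp
  qed
  have rep_eq: "rep u = rep v \<longleftrightarrow> (u, v) \<in> E" for u v
  proof
    assume "rep u = rep v"
    then show "(u, v) \<in> E" using rep_E[of u] rep_E[of v] E by (metis equivE symE transE)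
  next
    assume "(u, v) \<in> E"
    then have "E `` {u} = E `` {v}" using cl by blast
    then show "rep u = rep v" by (simp add: rep_def)
  qed
  show thesis
  proof (rule that[of rep])
    show "rep (rep v) = rep v" for v using rep_eq rep_E E by (meson equivE symE)
    show "rep x = rep y \<longleftrightarrow> (x, y) \<in> (parcs G \<union> (parcs G)\<inverse>)\<^sup>*" for x y
      unfolding rep_eq E_def ..
    have "range rep = (\<lambda>C. SOME v. v \<in> C) ` range (\<lambda>u. E `` {u})"
      by (simp only: image_image rep_def[abs_def])
    moreover have "inj_on (\<lambda>C. SOME v. v \<in> C) (range (\<lambda>u. E `` {u}))"
    proof (intro inj_onI, elim imageE)
      fix C D u v
      assume "(SOME v. v \<in> C) = (SOME v. v \<in> D)" "C = E `` {u}" "D = E `` {v}"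
      then have "rep u = rep v" by (simp only: rep_def)
      then show "C = D" using \<open>C = _\<close> \<open>D = _\<close> cl rep_eq by blast
    qed
    ultimately show "card (range rep) = num_components G"
      by (simp add: num card_image)
  qed
qed

section \<open>Nonzero Koszul homology classes\<close>

definition ind :: "'x::finite set \<Rightarrow> 'x \<Rightarrow>\<^sub>0 nat" where
  "ind S = exponents (\<lambda>x. if x \<in> S then 1 else 0)"

lemma lookup_ind [simp]: "lookup (ind S) x = (if x \<in> S then 1 else 0)"
  by (simp add: ind_def)

lemma monom_degree_ind [simp]: "monom_degree (ind S) = card S"
  by (simp add: monom_degree_def sum.If_cases)

text \<open>An order of the variables in which the fibres of \<open>f\<close> are intervals makes \<open>f\<close> compatible with
  the signs of the Koszul complex.\<close>

lemma ex_fibre_order: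
  fixes f :: "'x::finite \<Rightarrow> 'x"
  obtains idx :: "'x \<Rightarrow> nat" where "inj idx"
    "\<And>x x' y. f x = f x' \<Longrightarrow> f y \<noteq> f x \<Longrightarrow> idx y < idx x \<longleftrightarrow> idx y < idx x'"
proof -
  obtain h n where h: "h ` (UNIV :: 'x set) = {i::nat. i < n}" "inj h"
    using finite_imp_inj_to_nat_seg[of "UNIV :: 'x set"] by auto
  have hn: "h x < n" for x using h(1) by auto
  \<comment> \<open>A number in base \<open>n\<close> with digits \<open>h (f x)\<close> and
    \<open>h x\<close>; different fibres are compared by the first digit alone.\<close>
  define idx where "idx x = h (f x) * n + h x" for x
  have less: "idx x < idx y" if "h (f x) < h (f y)" for x y
  proof -
    have "idx x < Suc (h (f x)) * n" using hn[of x] by (simp add: idx_def)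
    also have "\<dots> \<le> h (f y) * n" using that by (intro mult_le_mono1) simp
    also have "\<dots> \<le> idx y" by (simp add: idx_def)
    finally show ?thesis .
  qed
  have iff: "idx y < idx x \<longleftrightarrow> h (f y) < h (f x)" if "f y \<noteq> f x" for x y
    using that less[of y x] less[of x y] inj_eq[OF h(2), of "f y" "f x"] by linarith
  show thesis
  proof (rule that[of idx])
    show "inj idx"
    proof (rule injI)
      fix x y assume eq: "idx x = idx y"
      then have "f x = f y" using iff[of x y] iff[of y x] inj_eq[OF h(2), of "f x" "f y"] by fastforce
      then show "x = y" using eq h(2) by (simp add: idx_def inj_eq)
    qed
    show "idx y < idx x \<longleftrightarrow> idx y < idx x'" if "f x = f x'" "f y \<noteq> f x" for x x' y
      using that iff by simp
  qed
qed

section \<open>Socle elements and products of boundaries of simplices\<close>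

context koszul
begin

lemma not_acyclicI:
  fixes J :: "('x, 'k::field) polynomials set"
  assumes z: "\<And>\<tau>. z \<tau> \<in> J" "chain V p z" "\<And>\<tau>. homogeneous (d - int p) (z \<tau>)" "\<And>\<tau>. bd V z \<tau> = 0"
    and no: "\<And>w. (\<And>\<tau>. w \<tau> \<in> J) \<Longrightarrow> chain V (Suc p) w \<Longrightarrow> (\<And>\<tau>. bd V w \<tau> = z \<tau>) \<Longrightarrow> False"
  shows "\<not> acyclic_at V [0] p d (embed J)"
proof
  assume acyclic: "acyclic_at V [0] p d (embed J)"
  define z' :: "'x set \<Rightarrow> nat \<Rightarrow> ('x, 'k) polynomials" where "z' = (\<lambda>\<tau> s. if s = 0 then z \<tau> else 0)"
  have "\<forall>\<tau>. z' \<tau> \<in> embed J" using z(1) by (simp add: z'_def embed_def)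
  moreover have "\<forall>s. chain V p (\<lambda>\<tau>. z' \<tau> s)" using z(2) by (simp add: z'_def chain_def)
  moreover have "\<forall>\<tau>. hvec [0] (d - int p) (z' \<tau>)" using z(3) by (simp add: z'_def hvec_def)
  moreover have "bd V (\<lambda>\<sigma>. z' \<sigma> s) \<tau> = 0" for \<tau> s
    by (cases "s = 0") (simp_all add: z'_def z(4))
  ultimately obtain w where w: "\<forall>\<tau>. w \<tau> \<in> embed J" "\<forall>s. chain V (Suc p) (\<lambda>\<tau>. w \<tau> s)"
    "\<forall>\<tau> s. bd V (\<lambda>\<sigma>. w \<sigma> s) \<tau> = z' \<tau> s"
    using acyclic unfolding acyclic_at_def by blast
  show False
  proof (rule no[of "\<lambda>\<tau>. w \<tau> 0"])
    show "w \<tau> 0 \<in> J" for \<tau> using spec[OF w(1), of \<tau>] by (auto simp: embed_def)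
    show "chain V (Suc p) (\<lambda>\<tau>. w \<tau> 0)" using w(2) by blast
    show "bd V (\<lambda>\<tau>. w \<tau> 0) \<tau> = z \<tau>" for \<tau> using w(3) by (simp add: z'_def)
  qed
qed

definition top_chain :: "'x set \<Rightarrow> ('x \<Rightarrow>\<^sub>0 nat) \<Rightarrow> 'x set \<Rightarrow> ('x, 'k::field) polynomials" where
  "top_chain W b \<sigma> = (if \<sigma> = W then single b 1 else 0)"

text \<open>A monomial outside \<open>J\<close> that is multiplied into \<open>J\<close> by all variables in \<open>V\<close> gives a class in
  the top Koszul homology of \<open>S/J\<close>, that is, in degree \<open>card V - 1\<close> of that of \<open>J\<close>.\<close>

lemma socle_not_acyclic:
  fixes J :: "('x, 'k::field) polynomials set"
  assumes J: "ideal.subspace J" and V: "V \<noteq> {}"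
    and b: "\<And>x. x \<in> V \<Longrightarrow> single (single x 1 + b) 1 \<in> J" "single b 1 \<notin> J"
  shows "\<exists>d. \<not> acyclic_at V [0] (card V - 1) d (embed J)"
proof -
  define p where "p = card V - 1"
  have cardV: "card V = Suc p" using V by (simp add: p_def card_gt_0_iff Suc_leI)
  let ?e = "top_chain V b :: 'x set \<Rightarrow> ('x, 'k) polynomials"
  have "\<not> acyclic_at V [0] p (int (monom_degree b) + 1 + int p) (embed J)"
  proof (rule not_acyclicI[where z = "bd V ?e"])
    fix \<tau>
    have "contr x ?e \<tau> \<in> J" if "x \<in> V" for x
    proof (cases "x \<notin> \<tau> \<and> insert x \<tau> = V")
      case True
      then have "contr x ?e \<tau> = sg x \<tau> * single (single x 1 + b) 1"
        by (simp add: contr_def top_chain_def Var_def mult_single)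
      then show ?thesis using ideal.subspace_scale[OF J b(1)[OF that]] by simp
    next
      case False
      then have "contr x ?e \<tau> = 0" by (auto simp: contr_def top_chain_def)
      then show ?thesis using ideal.subspace_0[OF J] by simp
    qed
    then show "bd V ?e \<tau> \<in> J" unfolding bd_def by (rule ideal.subspace_sum[OF J])
    have "homogeneous (int (monom_degree b)) (?e \<tau>)" for \<tau>
      by (simp add: top_chain_def homogeneous_single)
    then show "homogeneous (int (monom_degree b) + 1 + int p - int p) (bd V ?e \<tau>)"
      using homogeneous_bd by fastforce
    show "bd V (bd V ?e) \<tau> = 0" by (rule bd_bd)
  next
    have "chain V (Suc p) ?e" by (simp add: chain_def top_chain_def cardV)
    then show "chain V p (bd V ?e)" by (rule chain_bd) simp
  next
    fix w assume w: "\<And>\<tau>. w \<tau> \<in> J" "chain V (Suc p) w" "\<And>\<tau>. bd V w \<tau> = bd V ?e \<tau>"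
    \<comment> \<open>At \<open>V - {x}\<close> the differential sees only the coefficient at
      \<open>V\<close>, so that of \<open>w\<close> would have to be the monomial \<open>b\<close>,
      which is not in \<open>J\<close>.\<close>
    obtain x where x: "x \<in> V" using V by blast
    have single: "bd V u (V - {x}) = contr x u (V - {x})" for u :: "'x set \<Rightarrow> ('x, 'k) polynomials"
    proof -
      have "bd V u (V - {x}) = (\<Sum>y\<in>V. if y = x then contr x u (V - {x}) else 0)"
        unfolding bd_def by (rule sum.cong) (auto simp: contr_def)
      then show ?thesis using x by simp
    qed
    have "contr x w (V - {x}) = contr x ?e (V - {x})" using w(3) single by metis
    then have "sg x (V - {x}) * (Var x * w V) = sg x (V - {x}) * (Var x * single b 1)"
      using x by (simp add: contr_def top_chain_def insert_absorb)
    then have "Var x * w V = Var x * single b 1" by (metis sg_sq_mult)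
    then have "w V = single b 1" by (metis div_var_Var_mult)
    with w(1)[of V] b(2) show False by simp
  qed
  then show ?thesis unfolding p_def by blast
qed

text \<open>\<open>foldr bd Bs (top_chain W b)\<close> is the product of the boundaries of the simplices on the blocks
  \<open>Bs\<close>; its support consists of the sets that miss exactly one element of each block.\<close>

definition misses_one :: "'x set \<Rightarrow> 'x set list \<Rightarrow> 'x set \<Rightarrow> bool" where
  "misses_one W Bs \<sigma> \<longleftrightarrow> \<sigma> \<subseteq> W \<and> (\<forall>B\<in>set Bs. \<exists>x. B - \<sigma> = {x}) \<and> W - \<sigma> \<subseteq> \<Union>(set Bs)"

text \<open>Such a set arises in only one way: each \<open>bd B\<close> removes the missing element
  of \<open>B\<close>. So nothing cancels, and the coefficient collects the removed
  variables.\<close>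

lemma foldr_bd_value:
  assumes "distinct Bs" "pairwise disjnt (set Bs)" "\<Union>(set Bs) \<subseteq> W"
  shows "misses_one W Bs \<sigma> \<Longrightarrow> \<exists>u. (u = 1 \<or> u = - 1) \<and>
      foldr bd Bs (top_chain W b) \<sigma> = u * (single (b + ind (W - \<sigma>)) 1 :: ('x, 'k::field) polynomials)"
    and "\<not> misses_one W Bs \<sigma> \<Longrightarrow> foldr bd Bs (top_chain W b) \<sigma> = (0 :: ('x, 'k) polynomials)"
  using assms
proof (induction Bs arbitrary: \<sigma>)
  case Nil
  {
    case 1
    then have "\<sigma> = W" by (auto simp: misses_one_def)
    moreover have "ind ({} :: 'x set) = 0" by (rule poly_mapping_eqI) simp
    ultimately show ?case by (intro exI[of _ 1]) (simp add: top_chain_def)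
  next
    case 2
    then show ?case by (auto simp: misses_one_def top_chain_def)
  }
next
  case (Cons B Bs)
  let ?z = "foldr bd Bs (top_chain W b) :: 'x set \<Rightarrow> ('x, 'k) polynomials"
  have hyps: "distinct Bs" "pairwise disjnt (set Bs)" "\<Union>(set Bs) \<subseteq> W" "B \<subseteq> W"
    and disj: "\<And>C. C \<in> set Bs \<Longrightarrow> B \<inter> C = {}"
    if "distinct (B # Bs)" "pairwise disjnt (set (B # Bs))" "\<Union>(set (B # Bs)) \<subseteq> W"
    using that by (auto simp: pairwise_insert disjnt_def)
  {
    case 1
    note hyps = hyps[OF 1(2-4)] and disj = disj[OF 1(2-4)]
    obtain x where x: "B - \<sigma> = {x}" using 1(1) by (auto simp: misses_one_def)
    then have xB: "x \<in> B" "x \<notin> \<sigma>" by auto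
    have "misses_one W Bs (insert x \<sigma>)"
      unfolding misses_one_def
    proof (intro conjI ballI)
      show "insert x \<sigma> \<subseteq> W" using 1(1) xB hyps(4) by (auto simp: misses_one_def)
      fix C assume C: "C \<in> set Bs"
      then have "C - insert x \<sigma> = C - \<sigma>" using disj xB(1) by blast
      then show "\<exists>y. C - insert x \<sigma> = {y}" using 1(1) C by (simp add: misses_one_def)
    next
      show "W - insert x \<sigma> \<subseteq> \<Union>(set Bs)" using 1(1) x by (auto simp: misses_one_def)
    qed
    from Cons.IH(1)[OF this hyps(1-3)] obtain u where u: "u = 1 \<or> u = - 1"
      "?z (insert x \<sigma>) = u * single (b + ind (W - insert x \<sigma>)) 1" by blast
    have "bd B ?z \<sigma> = (\<Sum>y\<in>B. if y = x then contr x ?z \<sigma> else 0)"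
      unfolding bd_def by (rule sum.cong) (use x in \<open>auto simp: contr_def\<close>)
    also have "\<dots> = contr x ?z \<sigma>" using xB by simp
    also have "\<dots> = (sg x \<sigma> * u) * (Var x * single (b + ind (W - insert x \<sigma>)) 1)"
      using xB(2) by (simp only: contr_def u(2) if_False mult_ac)
    also have "Var x * single (b + ind (W - insert x \<sigma>)) 1 = (single (b + ind (W - \<sigma>)) 1 :: ('x, 'k) polynomials)"
    proof -
      have "single x 1 + (b + ind (W - insert x \<sigma>)) = b + ind (W - \<sigma>)"
        using xB hyps(4) by (intro poly_mapping_eqI) (auto simp: lookup_add lookup_single when_def)
      then show ?thesis by (simp add: Var_def mult_single)
    qed
    finally have "foldr bd (B # Bs) (top_chain W b) \<sigma> = (sg x \<sigma> * u) * (single (b + ind (W - \<sigma>)) 1 :: ('x, 'k) polynomials)"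
      by simp
    moreover have "sg x \<sigma> * u = 1 \<or> sg x \<sigma> * u = - 1"
      using u(1) sg_cases[of x \<sigma>, where 'r = "('x, 'k) polynomials"] by auto
    ultimately show ?case by blast
  next
    case 2
    note hyps = hyps[OF 2(2-4)] and disj = disj[OF 2(2-4)]
    have "contr x ?z \<sigma> = 0" if x: "x \<in> B" for x
    proof (cases "x \<notin> \<sigma> \<and> misses_one W Bs (insert x \<sigma>)")
      case True
      have "W - insert x \<sigma> \<subseteq> \<Union>(set Bs)" using True by (simp add: misses_one_def)
      then have "B - insert x \<sigma> = {}" using disj hyps(4) by blast
      then have "B - \<sigma> = {x}" using True x by auto
      moreover have "\<exists>y. C - \<sigma> = {y}" if "C \<in> set Bs" for C
      proof -
        have "\<exists>y. C - insert x \<sigma> = {y}" using True that by (simp add: misses_one_def)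
        moreover have "C - insert x \<sigma> = C - \<sigma>" using disj[OF that] x by blast
        ultimately show ?thesis by (simp only:)
      qed
      ultimately have "misses_one W (B # Bs) \<sigma>" using True x by (auto simp: misses_one_def)
      with 2(1) show ?thesis by simp
    next
      case False
      then show ?thesis using Cons.IH(2)[OF _ hyps(1-3), of "insert x \<sigma>"] by (auto simp: contr_def)
    qed
    then show ?case by (simp add: bd_def[of B])
  }
qed

lemma chain_foldr_bd:
  "q + length Bs = card W \<Longrightarrow>
    chain UNIV q (foldr bd Bs (top_chain W b :: 'x set \<Rightarrow> ('x, 'k::field) polynomials))"
proof (induction Bs arbitrary: q)
  case (Cons B Bs)
  have "chain UNIV (Suc q) (foldr bd Bs (top_chain W b :: 'x set \<Rightarrow> ('x, 'k) polynomials))"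
    using Cons.IH[of "Suc q"] Cons.prems by simp
  from chain_bd[OF this subset_UNIV] show ?case by simp
qed (simp add: chain_def top_chain_def)

lemma homogeneous_foldr_bd:
  "homogeneous (int (monom_degree b) + int (length Bs)) (foldr bd Bs (top_chain W b) \<sigma>)"
proof (induction Bs arbitrary: \<sigma>)
  case (Cons B Bs)
  from homogeneous_bd[OF this, where V = B and \<tau> = \<sigma>] show ?case by (simp add: add.commute add.left_commute)
qed (simp add: top_chain_def homogeneous_single)

text \<open>By anticommutation \<open>bd B\<close> moves inwards to its own occurrence, where the
  square is zero.\<close>

lemma bd_foldr_bd: "B \<in> set Bs \<Longrightarrow> bd B (foldr bd Bs z) \<tau> = 0"
proof (induction Bs arbitrary: \<tau>)
  case (Cons C Bs)
  show ?case
  proof (cases "B = C")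
    case False
    then have "bd B (foldr bd Bs z) = (\<lambda>_. 0)" using Cons by auto
    then show ?thesis by (simp add: bd_anticomm[of B C])
  qed (simp add: bd_bd)
qed simp

text \<open>The full differential is the sum of those of the blocks; variables outside
  \<open>W\<close> contribute nothing, as the chain is supported on subsets of
  \<open>W\<close>.\<close>

lemma cycle_foldr_bd:
  assumes Bs: "distinct Bs" "pairwise disjnt (set Bs)" "\<Union>(set Bs) = W"
  shows "bd UNIV (foldr bd Bs (top_chain W b)) \<tau> = (0 :: ('x, 'k::field) polynomials)"
proof -
  let ?z = "foldr bd Bs (top_chain W b) :: 'x set \<Rightarrow> ('x, 'k) polynomials"
  have "contr x ?z \<tau> = 0" if "x \<notin> W" for x
    using foldr_bd_value(2)[OF Bs(1,2), of W "insert x \<tau>" b, where 'k = 'k] Bs(3) that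
    by (simp add: contr_def misses_one_def)
  then have "bd UNIV ?z \<tau> = (\<Sum>x\<in>W. contr x ?z \<tau>)"
    unfolding bd_def by (intro sum.mono_neutral_right) auto
  also have "\<dots> = (\<Sum>B\<in>set Bs. \<Sum>x\<in>B. contr x ?z \<tau>)"
    unfolding Bs(3)[symmetric] using Bs(2)
    by (intro sum.Union_disjoint[unfolded comp_def]) (auto simp: pairwise_def disjnt_def)
  also have "\<dots> = 0"
    by (rule sum.neutral) (simp add: bd_foldr_bd flip: bd_def)
  finally show ?thesis .
qed

text \<open>The functional that adds up the coefficients of all simplices mapped bijectively onto
  \<open>\<tau>\<^sub>0\<close> by \<open>f\<close> vanishes on boundaries: a simplex with two such faces drops one of two vertices
  that are identified by \<open>f\<close>, and these faces have opposite signs.\<close>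

lemma pushforward_boundary:
  fixes c :: "'x set \<Rightarrow> 'r::comm_ring_1"
  assumes f: "\<And>x x' y. f x = f x' \<Longrightarrow> f y \<noteq> f x \<Longrightarrow> idx y < idx x \<longleftrightarrow> idx y < idx x'"
    and c: "\<And>\<rho>. \<rho> \<subseteq> S \<Longrightarrow> c \<rho> \<noteq> 0 \<Longrightarrow> \<tau>\<^sub>0 \<subseteq> f ` \<rho> \<Longrightarrow> f ` \<rho> = \<tau>\<^sub>0"
  shows "(\<Sum>\<tau>\<in>{\<tau>. \<tau> \<subseteq> S \<and> bij_betw f \<tau> \<tau>\<^sub>0}. \<Sum>x\<in>S - \<tau>. sg x \<tau> * c (insert x \<tau>)) = 0"
proof -
  define F where "F = {\<tau>. \<tau> \<subseteq> S \<and> bij_betw f \<tau> \<tau>\<^sub>0}"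
  \<comment> \<open>The vertices of \<open>\<rho>\<close> whose removal leaves a face counted by the
    functional.\<close>
  define X where "X \<rho> = {x \<in> \<rho>. \<rho> - {x} \<in> F}" for \<rho>
  have "(\<Sum>\<tau>\<in>F. \<Sum>x\<in>S - \<tau>. sg x \<tau> * c (insert x \<tau>)) =
      (\<Sum>(\<tau>, x)\<in>Sigma F (\<lambda>\<tau>. S - \<tau>). sg x \<tau> * c (insert x \<tau>))"
    by (rule sum.Sigma) auto
  also have "\<dots> = (\<Sum>(\<rho>, x)\<in>Sigma (Pow S) X. sg x (\<rho> - {x}) * c \<rho>)"
    by (rule sum.reindex_bij_witness[of _ "\<lambda>(\<rho>, x). (\<rho> - {x}, x)" "\<lambda>(\<tau>, x). (insert x \<tau>, x)"])
      (auto simp: X_def F_def insert_absorb)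
  also have "\<dots> = (\<Sum>\<rho>\<in>Pow S. \<Sum>x\<in>X \<rho>. sg x (\<rho> - {x}) * c \<rho>)"
    by (rule sum.Sigma[symmetric]) auto
  also have "\<dots> = 0"
  proof (rule sum.neutral, rule ballI)
    fix \<rho> assume \<rho>: "\<rho> \<in> Pow S"
    show "(\<Sum>x\<in>X \<rho>. sg x (\<rho> - {x}) * c \<rho>) = 0"
    proof (cases "X \<rho> = {} \<or> c \<rho> = 0")
      case False
      then obtain x where x: "x \<in> \<rho>" "\<rho> - {x} \<subseteq> S" "bij_betw f (\<rho> - {x}) \<tau>\<^sub>0"
        by (auto simp: X_def F_def)
      have img: "f ` (\<rho> - {x}) = \<tau>\<^sub>0" and inj: "inj_on f (\<rho> - {x})"
        using x(3) by (auto simp: bij_betw_def)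
      \<comment> \<open>Since \<open>\<rho>\<close> and a face on which \<open>f\<close> is
        bijective have the same image, the removed vertex \<open>x\<close> shares its image with one
        vertex \<open>y\<close>; only the faces opposite to these two count.\<close>
      have "f ` \<rho> = \<tau>\<^sub>0" using c[of \<rho>] False \<rho> img by blast
      then have "f x \<in> f ` (\<rho> - {x})" using x(1) img by blast
      then obtain y where "f x = f y" "y \<in> \<rho> - {x}" by (elim imageE)
      then have y: "y \<in> \<rho>" "y \<noteq> x" "f y = f x" by auto
      define R where "R = \<rho> - {x, y}"
      have R: "\<rho> - {x} = insert y R" "\<rho> - {y} = insert x R" "x \<notin> R" "y \<notin> R"
        using x(1) y by (auto simp: R_def)
      have neq: "f z \<noteq> f x" if "z \<in> R" for z
        using inj_onD[OF inj, of z y] that y by (auto simp: R_def)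
      have "X \<rho> = {x, y}"
      proof (intro equalityI subsetI)
        fix z assume "z \<in> X \<rho>"
        then have "z \<in> \<rho>" "inj_on f (\<rho> - {z})" by (auto simp: X_def F_def bij_betw_def)
        then show "z \<in> {x, y}" using inj_onD[of f "\<rho> - {z}" x y] x(1) y by auto
      next
        fix z assume z: "z \<in> {x, y}"
        have "f ` insert x R = f ` insert y R" using y(3) by simp
        moreover have "f x \<notin> f ` R" using neq by (metis imageE)
        then have "inj_on f (insert x R)"
          using inj unfolding R(1) inj_on_insert by blast
        ultimately have "bij_betw f (\<rho> - {y}) \<tau>\<^sub>0" using img unfolding R bij_betw_def by simp
        then show "z \<in> X \<rho>" using z x y \<rho> by (auto simp: X_def F_def)
      qed
      then have "(\<Sum>x\<in>X \<rho>. sg x (\<rho> - {x}) * c \<rho>) = (sg x (insert y R) + sg y (insert x R)) * c \<rho>"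
        using y(2) by (simp add: R distrib_right)
      \<comment> \<open>Being in one fibre, \<open>x\<close> and \<open>y\<close> lie on the same
        side of every element of \<open>R\<close>; only their mutual order distinguishes the
        signs.\<close>
      also have "sg x (insert y R) + sg y (insert x R) = (0 :: 'r)"
      proof -
        have "{z \<in> R. idx z < idx x} = {z \<in> R. idx z < idx y}"
          using neq f[of x y] y(3) by auto
        then have "sg x R = (sg y R :: 'r)" by (simp add: sg_def)
        moreover have "idx x < idx y \<longleftrightarrow> \<not> idx y < idx x"
          using y(2) inj_idx by (metis injD linorder_less_linear order.asym)
        ultimately show ?thesis using R by (simp add: sg_insert)
      qed
      finally show ?thesis by simp
    qed auto
  qed
  finally show ?thesis by (simp add: F_def)
qed

lemma lookup_sg_mult: "lookup (sg x \<tau> * p) m = sg x \<tau> * lookup p m"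
  for p :: "('x, 'k::field) polynomials"
proof (cases "even (card {y \<in> \<tau>. idx y < idx x})")
  case True
  then show ?thesis by (simp add: sg_def)
next
  case False
  then show ?thesis by (simp add: sg_def)
qed

text \<open>In multidegree \<open>a\<close> a chain amounts to its coefficients at the monomials
  \<open>a - ind \<tau>\<close>, on which the Koszul differential is the simplicial boundary with
  vertex set \<open>S\<close>.\<close>

lemma lookup_bd:
  fixes w :: "'x set \<Rightarrow> ('x, 'k::field) polynomials"
  assumes S: "S = {x. lookup a x \<noteq> 0}"
  shows "lookup (bd UNIV w \<tau>) (a - ind \<tau>) =
    (\<Sum>x\<in>S - \<tau>. sg x \<tau> * lookup (w (insert x \<tau>)) (a - ind (insert x \<tau>)))"
proof -
  have "lookup (contr x w \<tau>) (a - ind \<tau>) =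
      (if x \<in> S - \<tau> then sg x \<tau> * lookup (w (insert x \<tau>)) (a - ind (insert x \<tau>)) else 0)" for x
  proof (cases "x \<in> \<tau>")
    case False
    have "a - ind \<tau> - single x 1 = a - ind (insert x \<tau>)"
      using False by (intro poly_mapping_eqI) (auto simp: lookup_minus lookup_single when_def)
    then show ?thesis
      using False by (simp add: contr_def lookup_sg_mult lookup_Var_mult lookup_minus S)
  qed (simp add: contr_def)
  then show ?thesis
    by (simp add: bd_def lookup_sum sum.If_cases Int_def set_diff_eq)
qed

text \<open>The functional of the preceding pushforward vanishes on the boundary of
  \<open>w\<close>. On the product of boundaries of simplices only \<open>\<tau>\<^sub>0\<close>
  counts, because \<open>f\<close> fixes \<open>W\<close> pointwise, and its coefficient is 1 or
  -1.\<close>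

lemma foldr_bd_not_boundary:
  fixes w :: "'x set \<Rightarrow> ('x, 'k::field) polynomials"
  assumes Bs: "distinct Bs" "pairwise disjnt (set Bs)" "\<Union>(set Bs) = W"
    and f: "\<And>x x' y. f x = f x' \<Longrightarrow> f y \<noteq> f x \<Longrightarrow> idx y < idx x \<longleftrightarrow> idx y < idx x'"
    and fW: "\<And>x. x \<in> W \<Longrightarrow> f x = x"
    and \<tau>\<^sub>0: "misses_one W Bs \<tau>\<^sub>0"
    and w: "\<And>\<tau>. bd UNIV w \<tau> = foldr bd Bs (top_chain W b) \<tau>"
    and supp: "\<And>\<rho>. (\<forall>x\<in>\<rho>. lookup (b + ind W) x \<noteq> 0) \<Longrightarrow> lookup (w \<rho>) (b + ind W - ind \<rho>) \<noteq> 0 \<Longrightarrow>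
       \<tau>\<^sub>0 \<subseteq> f ` \<rho> \<Longrightarrow> f ` \<rho> = \<tau>\<^sub>0"
  shows False
proof -
  define a where "a = b + ind W"
  define S where "S = {x. lookup a x \<noteq> 0}"
  define F where "F = {\<tau>. \<tau> \<subseteq> S \<and> bij_betw f \<tau> \<tau>\<^sub>0}"
  let ?z = "foldr bd Bs (top_chain W b) :: 'x set \<Rightarrow> ('x, 'k) polynomials"
  have \<tau>\<^sub>0W: "\<tau>\<^sub>0 \<subseteq> W" using \<tau>\<^sub>0 by (simp add: misses_one_def)
  then have "\<tau>\<^sub>0 \<subseteq> S" by (auto simp: S_def a_def lookup_add)
  moreover have "bij_betw f \<tau>\<^sub>0 \<tau>\<^sub>0"
    using fW \<tau>\<^sub>0W by (intro bij_betw_byWitness[where f' = id]) auto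
  ultimately have \<tau>\<^sub>0F: "\<tau>\<^sub>0 \<in> F" by (simp add: F_def)
  have "?z \<tau> = 0" if "\<tau> \<in> F - {\<tau>\<^sub>0}" for \<tau>
  proof (rule ccontr)
    assume "?z \<tau> \<noteq> 0"
    then have "misses_one W Bs \<tau>" using foldr_bd_value(2)[OF Bs(1,2)] Bs(3) by blast
    then have "\<tau> \<subseteq> W" by (simp add: misses_one_def)
    then have "f ` \<tau> = (\<lambda>x. x) ` \<tau>" using fW by (intro image_cong) auto
    then show False using that by (auto simp: F_def bij_betw_def)
  qed
  then have "(\<Sum>\<tau>\<in>F. lookup (?z \<tau>) (a - ind \<tau>)) = (\<Sum>\<tau>\<in>{\<tau>\<^sub>0}. lookup (?z \<tau>) (a - ind \<tau>))"
    using \<tau>\<^sub>0F by (intro sum.mono_neutral_right) auto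
  also have "\<dots> \<noteq> 0"
  proof -
    obtain u where u: "u = 1 \<or> u = - 1" "?z \<tau>\<^sub>0 = u * single (b + ind (W - \<tau>\<^sub>0)) 1"
      using foldr_bd_value(1)[OF Bs(1,2) _ \<tau>\<^sub>0] Bs(3) by blast
    have "a - ind \<tau>\<^sub>0 = b + ind (W - \<tau>\<^sub>0)"
      unfolding a_def using \<tau>\<^sub>0W by (intro poly_mapping_eqI) (auto simp: lookup_minus lookup_add)
    with u show ?thesis by auto
  qed
  finally have "(\<Sum>\<tau>\<in>F. lookup (bd UNIV w \<tau>) (a - ind \<tau>)) \<noteq> 0" by (simp add: w)
  moreover have supp': "f ` \<rho> = \<tau>\<^sub>0" if "\<rho> \<subseteq> S" "lookup (w \<rho>) (a - ind \<rho>) \<noteq> 0" "\<tau>\<^sub>0 \<subseteq> f ` \<rho>" for \<rho>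
    by (rule supp) (use that in \<open>auto simp: a_def S_def\<close>)
  have "(\<Sum>\<tau>\<in>F. lookup (bd UNIV w \<tau>) (a - ind \<tau>)) = 0"
    unfolding lookup_bd[OF S_def] F_def
    by (rule pushforward_boundary[where c = "\<lambda>\<rho>. lookup (w \<rho>) (a - ind \<rho>)", OF f supp'])
  ultimately show False by simp
qed

end

section \<open>Betti numbers of powers of the ideal of weak homomorphisms\<close>

text \<open>All that is used of the ordinary and symbolic powers is that they lie between \<open>I\<^sup>k\<close> and the
  intersection of the \<open>k\<close>-th powers of all monomial primes containing \<open>I\<close>.\<close>

locale hom_ideal_power =
  fixes G :: "'v::finite pair_pre_digraph" and H :: "'w::finite pair_pre_digraph"
    and J :: "('v \<times> 'w, 'k::field) polynomials set" and k :: nat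
  assumes G: "pverts G = UNIV" and H: "pverts H = UNIV"
    and J: "monomial_ideal J"
    and lower: "ideal_power (hom_ideal G H) (Suc k) \<subseteq> J"
    and upper: "\<And>A. hom_ideal G H \<subseteq> (ideal_of (Var ` A) :: ('v \<times> 'w, 'k) polynomials set) \<Longrightarrow>
      J \<subseteq> ideal_power (ideal_of (Var ` A)) (Suc k)"
begin

text \<open>A map constant along arcs is a weak homomorphism, as is the constant map
  \<open>j\<^sub>0\<close>; one factor for the former and \<open>k\<close> for the latter make up
  the power \<open>Suc k\<close>.\<close>

lemma in_J:
  assumes "\<And>x y. (x, y) \<in> parcs G \<Longrightarrow> \<phi> x = \<phi> y"
    "\<And>v w. (if \<phi> v = w then 1 else 0) + (if w = j\<^sub>0 then k else 0) \<le> lookup m (v, w)"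
  shows "single m 1 \<in> J"
proof -
  have "\<phi> \<in> WHom G H" "(\<lambda>_. j\<^sub>0) \<in> WHom G H"
    using assms(1) by (auto simp: WHom_def G H)
  from hom_ideal_power_monomial[OF G this, where k = k and m = m] assms(2) lower show ?thesis
    by (auto simp: eq_commute[of j\<^sub>0])
qed

lemma degree_ge:
  assumes "p \<in> J" "m \<in> keys p" "\<And>\<phi>. \<phi> \<in> WHom G H \<Longrightarrow> \<exists>i. (i, \<phi> i) \<in> A"
  shows "Suc k \<le> (\<Sum>x\<in>A. lookup m x)"
proof -
  have "hom_ideal G H \<subseteq> (ideal_of (Var ` A) :: ('v \<times> 'w, 'k) polynomials set)"
    by (subst hom_ideal_subset_prime[OF G]) (use assms(3) in blast)
  then have "p \<in> ideal_power (ideal_of (Var ` A)) (Suc k)" using upper assms(1) by blast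
  then show ?thesis using assms(2) by (rule keys_power_Vars)
qed

lemma proj_dim_ge: "ereal (real (card (UNIV :: 'w set)) - 1) \<le> proj_dim J"
proof -
  obtain i\<^sub>0 j\<^sub>0 where "i\<^sub>0 \<in> (UNIV :: 'v set)" "j\<^sub>0 \<in> (UNIV :: 'w set)" by blast
  define V where "V = {i\<^sub>0} \<times> (UNIV :: 'w set)"
  \<comment> \<open>Over \<open>i\<^sub>0\<close> the degree is \<open>k\<close>, one less than
    elements of \<open>J\<close> have; in the other rows the exponents suffice for all the products
    used.\<close>
  define b where "b = exponents (\<lambda>(i, j). if i = i\<^sub>0 then (if j = j\<^sub>0 then k else 0) else Suc k)"
  have b: "lookup b (i, j) = (if i = i\<^sub>0 then (if j = j\<^sub>0 then k else 0) else Suc k)" for i j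
    by (simp add: b_def)
  obtain idx :: "'v \<times> 'w \<Rightarrow> nat" where "inj idx"
    by (rule ex_fibre_order[of id]) blast
  then interpret koszul idx by unfold_locales
  have "\<exists>d. \<not> acyclic_at V [0] (card V - 1) d (embed J)"
  proof (rule socle_not_acyclic)
    show "ideal.subspace J" using J by (simp add: monomial_ideal_def)
    show "V \<noteq> {}" by (simp add: V_def)
    show "single (single x 1 + b) 1 \<in> J" if xV: "x \<in> V" for x
    proof -
      obtain j where x: "x = (i\<^sub>0, j)" using xV by (auto simp: V_def)
      show ?thesis
        by (rule in_J[of "\<lambda>_. j" j\<^sub>0]) (auto simp: x lookup_add lookup_single b when_def)
    qed
    show "single b 1 \<notin> J"
    proof
      assume "single b 1 \<in> J"
      then have "Suc k \<le> (\<Sum>x\<in>V. lookup b x)"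
        by (rule degree_ge) (auto simp: V_def)
      also have "V = Pair i\<^sub>0 ` UNIV" by (auto simp: V_def)
      also have "(\<Sum>x\<in>Pair i\<^sub>0 ` UNIV. lookup b x) = (\<Sum>j\<in>UNIV. if j = j\<^sub>0 then k else 0)"
        by (subst sum.reindex) (auto simp: inj_on_def b)
      finally show False by simp
    qed
  qed
  then obtain j where "betti J (card V - 1) j \<noteq> 0"
    using betti_nonzero(2)[OF graded_submodule_embed[OF J]] by blast
  then have "ereal (real (card V - 1)) \<le> proj_dim J"
    unfolding proj_dim_def by (intro Sup_upper) blast
  moreover have "card V = (card (UNIV :: 'w set))" by (simp add: V_def card_cartesian_product)
  moreover have "card (UNIV :: 'w set) \<ge> 1" by (simp add: Suc_le_eq card_gt_0_iff)
  ultimately show ?thesis by (simp add: of_nat_diff)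
qed

lemma regularity_ge:
  assumes A: "independent_vertices H A" "j\<^sub>0 \<in> A"
  shows "ereal (real (Suc k) * real (card (UNIV :: 'v set)) +
      (real (card (UNIV :: 'v set)) - real (num_components G)) * (real (card A) - 1)) \<le> regularity J"
proof -
  obtain rep :: "'v \<Rightarrow> 'v" where rep_rep: "\<And>v. rep (rep v) = rep v"
    and rep_iff: "\<And>x y. rep x = rep y \<longleftrightarrow> (x, y) \<in> (parcs G \<union> (parcs G)\<inverse>)\<^sup>*"
    and card_rep: "card (range rep) = num_components G"
    by (rule component_representatives[OF G]) (rule that; blast)
  define T where "T = range rep"
  \<comment> \<open>Contraction of the components of \<open>G\<close>, on the level of
    variables.\<close>
  define f where "f x = (rep (fst x), snd x)" for x :: "'v \<times> 'w"
  obtain idx :: "'v \<times> 'w \<Rightarrow> nat" where idx: "inj idx"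
    "\<And>x x' y. f x = f x' \<Longrightarrow> f y \<noteq> f x \<Longrightarrow> idx y < idx x \<longleftrightarrow> idx y < idx x'"
    by (rule ex_fibre_order[of f]) blast
  interpret koszul idx using idx(1) by unfold_locales
  define W where "W = T \<times> A"
  obtain ts where ts: "set ts = T" "distinct ts" using finite_distinct_list[of T] by auto
  define Bs where "Bs = map (\<lambda>t. {t} \<times> A) ts"
  have A_ne: "A \<noteq> {}" using A(2) by blast
  have Bs: "distinct Bs" "pairwise disjnt (set Bs)" "\<Union>(set Bs) = W"
    using ts A_ne by (auto simp: Bs_def W_def distinct_map inj_on_def pairwise_def disjnt_def)
  \<comment> \<open>The extra \<open>k\<close> at \<open>j\<^sub>0\<close> makes room for the
    \<open>k\<close> factors given by the constant map \<open>j\<^sub>0\<close>.\<close>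
  define a where "a = exponents (\<lambda>(i :: 'v, j). if j \<in> A then (if j = j\<^sub>0 then Suc k else 1) else 0)"
  have a: "lookup a (i, j) = (if j \<in> A then (if j = j\<^sub>0 then Suc k else 1) else 0)" for i j
    by (simp add: a_def)
  \<comment> \<open>With this top coefficient the product of the block boundaries lives in
    multidegree \<open>a\<close>.\<close>
  define b where "b = a - ind W"
  have b_W: "b + ind W = a"
    by (rule poly_mapping_eqI) (auto simp: b_def W_def lookup_add lookup_minus a)
  define \<tau>\<^sub>0 where "\<tau>\<^sub>0 = T \<times> (A - {j\<^sub>0})"
  \<comment> \<open>One element of each block is removed, so \<open>p\<close> is the number of
    components times \<open>card A - 1\<close>.\<close>
  define p where "p = card W - length Bs"
  have card_W: "card W = card T * card A" by (simp add: W_def card_cartesian_product)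
  have len: "length Bs = card T" using ts distinct_card[of ts] by (simp add: Bs_def)
  have "card A > 0" using A_ne by (simp add: card_gt_0_iff)
  then have p: "p + length Bs = card W" by (simp add: p_def len card_W)
  define z where "z = (foldr bd Bs (top_chain W b) :: ('v \<times> 'w) set \<Rightarrow> ('v \<times> 'w, 'k) polynomials)"
  have subJ: "ideal.subspace J" using J by (simp add: monomial_ideal_def)
  have deg: "monom_degree a = monom_degree b + card W"
    by (simp add: b_W[symmetric] monom_degree_add)
  have "\<not> acyclic_at UNIV [0] p (int (monom_degree a)) (embed J)"
  proof (rule not_acyclicI)
    show "chain UNIV p z" unfolding z_def by (rule chain_foldr_bd[OF p])
    show "homogeneous (int (monom_degree a) - int p) (z \<tau>)" for \<tau>
    proof -
      have "int (monom_degree a) - int p = int (monom_degree b) + int (length Bs)"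
        using p by (simp add: deg)
      then show ?thesis unfolding z_def using homogeneous_foldr_bd by metis
    qed
    show "bd UNIV z \<tau> = 0" for \<tau> unfolding z_def by (rule cycle_foldr_bd[OF Bs])
    show "z \<sigma> \<in> J" for \<sigma>
    proof (cases "misses_one W Bs \<sigma>")
      case False
      then have "z \<sigma> = 0" unfolding z_def using foldr_bd_value(2)[OF Bs(1,2)] Bs(3) by blast
      then show ?thesis using ideal.subspace_0[OF subJ] by simp
    next
      case True
      \<comment> \<open>The missing elements, one per component, define a map that is constant along
        arcs and whose monomial divides the coefficient at \<open>\<sigma>\<close>.\<close>
      have "\<forall>t\<in>T. \<exists>j. ({t} \<times> A) - \<sigma> = {(t, j)}"
      proof
        fix t assume "t \<in> T"
        then have "{t} \<times> A \<in> set Bs" using ts by (auto simp: Bs_def)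
        then obtain x where "{t} \<times> A - \<sigma> = {x}" using True by (auto simp: misses_one_def)
        then show "\<exists>j. ({t} \<times> A) - \<sigma> = {(t, j)}" by (cases x) auto
      qed
      from bchoice[OF this] obtain j where j: "\<And>t. t \<in> T \<Longrightarrow> ({t} \<times> A) - \<sigma> = {(t, j t)}" by blast
      have repT: "rep v \<in> T" for v by (simp add: T_def)
      have jA: "j (rep v) \<in> A" for v using j[OF repT, of v] by blast
      have j\<sigma>: "(v, j (rep v)) \<notin> \<sigma>" if "v \<in> T" for v
      proof -
        have "rep v = v" using that rep_rep by (auto simp: T_def)
        then show ?thesis using j[OF that] by auto
      qed
      have "single (b + ind (W - \<sigma>)) 1 \<in> J"
      proof (rule in_J[of "\<lambda>v. j (rep v)" j\<^sub>0])
        show "j (rep x) = j (rep y)" if "(x, y) \<in> parcs G" for x y using that rep_iff[of x y] by auto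
        fix v w
        have "lookup (b + ind (W - \<sigma>)) (v, w) = lookup a (v, w) - (if (v, w) \<in> W \<inter> \<sigma> then 1 else 0)"
          by (auto simp: b_def lookup_add lookup_minus a W_def)
        then show "(if j (rep v) = w then 1 else 0) + (if w = j\<^sub>0 then k else 0)
            \<le> lookup (b + ind (W - \<sigma>)) (v, w)"
          using jA[of v] j\<sigma>[of v] A(2) by (auto simp: a W_def)
      qed
      moreover obtain u where "z \<sigma> = u * single (b + ind (W - \<sigma>)) 1"
        unfolding z_def using foldr_bd_value(1)[OF Bs(1,2) _ True] Bs(3) by blast
      ultimately show ?thesis using ideal.subspace_scale[OF subJ] by simp
    qed
  next
    fix w assume w: "\<And>\<tau>. w \<tau> \<in> J" "\<And>\<tau>. bd UNIV w \<tau> = z \<tau>"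
    show False
    proof (rule foldr_bd_not_boundary[OF Bs idx(2), where \<tau>\<^sub>0 = \<tau>\<^sub>0 and w = w and b = b])
      show "f x = x" if "x \<in> W" for x
        using that rep_rep by (auto simp: W_def T_def f_def)
      show "misses_one W Bs \<tau>\<^sub>0"
        unfolding misses_one_def
      proof (intro conjI ballI)
        show "\<tau>\<^sub>0 \<subseteq> W" by (auto simp: \<tau>\<^sub>0_def W_def)
        show "W - \<tau>\<^sub>0 \<subseteq> \<Union>(set Bs)" using Bs(3) by blast
        fix B assume "B \<in> set Bs"
        then obtain t where t: "B = {t} \<times> A" "t \<in> T" using ts by (auto simp: Bs_def)
        then have "B - \<tau>\<^sub>0 = {(t, j\<^sub>0)}" using A(2) by (auto simp: \<tau>\<^sub>0_def)
        then show "\<exists>x. B - \<tau>\<^sub>0 = {x}" by blast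
      qed
      show "bd UNIV w \<tau> = foldr bd Bs (top_chain W b) \<tau>" for \<tau>
        using w(2) by (simp add: z_def)
      fix \<rho> assume \<rho>: "\<forall>x\<in>\<rho>. lookup (b + ind W) x \<noteq> 0" "lookup (w \<rho>) (b + ind W - ind \<rho>) \<noteq> 0"
        "\<tau>\<^sub>0 \<subseteq> f ` \<rho>"
      \<comment> \<open>Otherwise \<open>\<rho>\<close> also meets the fibre over
        \<open>(t, j\<^sub>0)\<close> for some component \<open>t\<close>, hence all fibres over
        \<open>t\<close>, and the degree bound for \<open>J\<close> fails.\<close>
      have "f x \<in> \<tau>\<^sub>0" if x: "x \<in> \<rho>" for x
      proof (rule ccontr)
        assume nx: "f x \<notin> \<tau>\<^sub>0"
        obtain i j where ij: "x = (i, j)" by (cases x)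
        define t where "t = rep i"
        have "lookup a x \<noteq> 0" using \<rho>(1) x by (simp add: b_W)
        then have "j \<in> A" by (auto simp: ij a split: if_splits)
        then have j: "j = j\<^sub>0" using nx by (auto simp: \<tau>\<^sub>0_def f_def ij T_def)
        have "\<forall>j\<in>A. \<exists>i. rep i = t \<and> (i, j) \<in> \<rho>"
        proof
          fix j' assume j': "j' \<in> A"
          show "\<exists>i. rep i = t \<and> (i, j') \<in> \<rho>"
          proof (cases "j' = j\<^sub>0")
            case True
            then show ?thesis using x ij j t_def by auto
          next
            case False
            then have "(t, j') \<in> f ` \<rho>" using \<rho>(3) j' by (auto simp: \<tau>\<^sub>0_def t_def T_def)
            then show ?thesis by (auto simp: f_def)
          qed
        qed
        from bchoice[OF this] obtain c where c: "\<And>j. j \<in> A \<Longrightarrow> rep (c j) = t" "\<And>j. j \<in> A \<Longrightarrow> (c j, j) \<in> \<rho>"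
          by blast
        text \<open>The transversal of \<open>\<rho>\<close> over the component \<open>t\<close> and all variables outside \<open>A\<close> generate
          a prime containing \<open>I\<close>.\<close>
        define C where "C = (\<lambda>j. (c j, j)) ` A \<union> UNIV \<times> (- A)"
        have "\<exists>i. (i, \<phi> i) \<in> C" if \<phi>: "\<phi> \<in> WHom G H" for \<phi>
        proof (cases "\<forall>i. \<phi> i \<in> A")
          case True
          have \<phi>_arc: "\<forall>(x, y) \<in> parcs G. \<phi> x = \<phi> y"
            using \<phi> True A(1) unfolding WHom_def independent_vertices_def by blast
          have const: "\<phi> x = \<phi> y" if "rep x = rep y" for x y
            using that unfolding rep_iff by (induction rule: rtrancl_induct) (use \<phi>_arc in auto)
          \<comment> \<open>On the component \<open>t\<close> the map has the single value
            \<open>\<phi> t\<close>, so it passes through the transversal at the vertex chosen for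
            this value.\<close>
          have "rep (c (\<phi> t)) = t" using c(1) True by blast
          then have "\<phi> (c (\<phi> t)) = \<phi> t" using const rep_rep by (metis t_def)
          then show ?thesis using True by (intro exI[of _ "c (\<phi> t)"]) (auto simp: C_def)
        qed (auto simp: C_def)
        then have "Suc k \<le> (\<Sum>x\<in>C. lookup (b + ind W - ind \<rho>) x)"
          using \<rho>(2) by (intro degree_ge[OF w(1), of _ \<rho>]) (auto simp: in_keys_iff)
        \<comment> \<open>Exponents outside \<open>A\<close> are 0, and subtracting
          \<open>ind \<rho>\<close> clears the transversal except for the surplus \<open>k\<close>
          at \<open>j\<^sub>0\<close>, one short of the bound.\<close>
        also have "\<dots> = (\<Sum>x\<in>C. if x = (c j\<^sub>0, j\<^sub>0) then k else 0)"
          by (rule sum.cong) (auto simp: C_def b_W lookup_minus a c A(2) split: if_splits)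
        also have "\<dots> \<le> k" by simp
        finally show False by simp
      qed
      then show "f ` \<rho> = \<tau>\<^sub>0" using \<rho>(3) by blast
    qed
  qed
  then have "betti J p (int (monom_degree a)) \<noteq> 0"
    by (rule betti_nonzero(1)[OF graded_submodule_embed[OF J]])
  then have "ereal (of_int (int (monom_degree a) - int p)) \<le> regularity J"
    unfolding regularity_def by (intro Sup_upper) blast
  \<comment> \<open>With \<open>n\<close> vertices, \<open>c\<close> components and \<alpha> the
    size of \<open>A\<close>, the bound is the identity \<open>n(k + \<alpha>) - c(\<alpha> - 1) =
    (k + 1)n + (n - c)(\<alpha> - 1)\<close>.\<close>
  moreover have "real (monom_degree a) = real (card (UNIV :: 'v set)) * (real k + real (card A))"
  proof -
    have "(\<Sum>j\<in>UNIV. lookup a (i, j)) = k + card A" for i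
    proof -
      have "(\<Sum>j\<in>UNIV. lookup a (i, j)) = (\<Sum>j\<in>UNIV. (if j = j\<^sub>0 then k else 0) + (if j \<in> A then 1 else 0))"
        by (rule sum.cong) (use A(2) in \<open>auto simp: a\<close>)
      then show ?thesis by (simp add: sum.distrib sum.If_cases)
    qed
    then have "monom_degree a = (\<Sum>i\<in>(UNIV :: 'v set). k + card A)"
      by (simp add: monom_degree_def sum.cartesian_product' flip: UNIV_Times_UNIV)
    then show ?thesis by simp
  qed
  moreover have "real p = real (card T) * (real (card A) - 1)"
    using p by (simp add: len card_W algebra_simps flip: of_nat_mult of_nat_add)
  ultimately show ?thesis
    by (simp add: card_rep[folded T_def] algebra_simps)
qed

end

theorem theorem3p9:
  fixes G :: "'v::finite pair_pre_digraph"
    and H :: "'w::finite pair_pre_digraph"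
    and I :: "('v \<times> 'w, 'k::field) polynomials set"
    and k :: nat
  assumes "simple_digraph G" and "pverts G = UNIV"
    and "simple_digraph H" and "pverts H = UNIV"
    and "I = hom_ideal G H"
    and "k \<ge> 1"
  shows "proj_dim (ideal_power I k) \<ge> ereal (real (card (pverts H)) - 1) \<and>
    proj_dim (symbolic_power I k) \<ge> ereal (real (card (pverts H)) - 1) \<and>
    regularity (ideal_power I k) \<ge>
      ereal (real k * real (card (pverts G)) +
        (real (card (pverts G)) - real (num_components G)) * (real (independence_number H) - 1)) \<and>
    regularity (symbolic_power I k) \<ge>
      ereal (real k * real (card (pverts G)) +
        (real (card (pverts G)) - real (num_components G)) * (real (independence_number H) - 1))"
proof -
  note G = assms(2) and H = assms(4)
  \<comment> \<open>The locale is parametrized by the exponent minus one.\<close>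
  obtain k' where k: "k = Suc k'" using assms(6) by (cases k) auto
  have I: "monomial_ideal I" unfolding assms(5) by (rule monomial_ideal_hom_ideal[OF G])
  have "I = (\<Inter>A\<in>{A. I \<subseteq> ideal_of (Var ` A)}. ideal_of (Var ` A))"
    unfolding assms(5) by (rule hom_ideal_eq_Inter[OF G])
  then have symb: "symbolic_power I k = (\<Inter>A\<in>minimal_covers I. ideal_power (ideal_of (Var ` A)) k)"
    by (rule symbolic_power_eq)
  have le: "ideal_power I k \<subseteq> symbolic_power I k"
    unfolding symb by (intro INT_greatest ideal_power_mono) (simp add: minimal_covers_def)
  \<comment> \<open>Every prime of variables above \<open>I\<close> contains that of a minimal
    cover, whose power occurs in the intersection.\<close>
  have ge: "symbolic_power I k \<subseteq> ideal_power (ideal_of (Var ` A)) k" if A: "I \<subseteq> ideal_of (Var ` A)" for A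
  proof -
    obtain B where B: "B \<in> minimal_covers I" "B \<subseteq> A" by (rule minimal_cover_below[OF A])
    then have "symbolic_power I k \<subseteq> ideal_power (ideal_of (Var ` B)) k" unfolding symb by blast
    also have "\<dots> \<subseteq> ideal_power (ideal_of (Var ` A)) k"
      using B(2) by (intro ideal_power_mono ideal_of_mono image_mono)
    finally show ?thesis .
  qed
  interpret P: hom_ideal_power G H "ideal_power I k" k'
  proof
    show "monomial_ideal (ideal_power I k)" by (rule monomial_ideal_power[OF I])
    show "ideal_power (hom_ideal G H) (Suc k') \<subseteq> ideal_power I k" by (simp add: k assms(5))
    show "ideal_power I k \<subseteq> ideal_power (ideal_of (Var ` A)) (Suc k')"
      if "hom_ideal G H \<subseteq> (ideal_of (Var ` A) :: ('v \<times> 'w, 'k) polynomials set)" for A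
      unfolding k assms(5) by (rule ideal_power_mono[OF that])
  qed (use G H in simp_all)
  interpret S: hom_ideal_power G H "symbolic_power I k" k'
  proof
    show "monomial_ideal (symbolic_power I k)"
      unfolding symb by (intro monomial_ideal_Inter monomial_ideal_power monomial_ideal_Vars)
    show "ideal_power (hom_ideal G H) (Suc k') \<subseteq> symbolic_power I k" using le by (simp add: k assms(5))
    show "symbolic_power I k \<subseteq> ideal_power (ideal_of (Var ` A)) (Suc k')"
      if "hom_ideal G H \<subseteq> (ideal_of (Var ` A) :: ('v \<times> 'w, 'k) polynomials set)" for A
      using ge[of A] that by (simp add: k assms(5))
  qed (use G H in simp_all)
  \<comment> \<open>The independence number is attained, and by a nonempty set: singletons are
    independent as there are no loops.\<close>
  have "finite {card A |A. independent_vertices H A}"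
    by (rule finite_subset[of _ "card ` UNIV"]) auto
  moreover obtain j where "independent_vertices H {j}"
  proof -
    obtain j where "j \<in> pverts H" using assms(3) by (auto simp: simple_digraph_def)
    moreover have "(j, j) \<notin> parcs H"
      using assms(3) pair_loopfree_digraph.pair_no_loops[of H "(j, j)"]
      by (auto simp: simple_digraph_def pair_digraph_def)
    ultimately show thesis by (intro that[of j]) (simp add: independent_vertices_def)
  qed
  ultimately have "independence_number H \<in> {card A |A. independent_vertices H A}"
    "card {j} \<le> independence_number H"
    unfolding independence_number_def by (intro Max_in Max_ge; blast)+
  then obtain A where A: "independent_vertices H A" "card A = independence_number H" "1 \<le> card A" by auto
  then obtain j\<^sub>0 where "j\<^sub>0 \<in> A" by fastforce
  then show ?thesis
    using P.proj_dim_ge S.proj_dim_ge P.regularity_ge[OF A(1)] S.regularity_ge[OF A(1)] A(2)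
    by (simp add: k G H)
qed

end
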